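(* Let $l\ge1$ and $k>2$ be integers. The assignment $$\mu\colon x^ry^s(u,v)\longmapsto(-1)^s\,\tilde s^{(s+1)}_{u/l}\,\tilde s^{(r+1)}_{v/l}$$ induces a well-defined linear map from the space $M$ of Manin symbols of weight $k$ and level $l$ to the quotient $\mathcal{Q}$ of the space of weight $k$ quasimodular forms on $\Gamma_1(l)$ by the subspace generated by the Eisenstein series $\tilde s^{(k)}_{a/l}$ and the derivatives $\partial_\tau\tilde s^{(k-2)}_{a/l}$, $a\in\mathbb{Z}/l\mathbb{Z}$.
   Context: Manin symbols: let $E_l\subset(\mathbb{Z}/l\mathbb{Z})^2$ be the set of pairs $(u,v)$ with $\mathbb{Z}u+\mathbb{Z}v=\mathbb{Z}/l\mathbb{Z}$. $M$ is the $\mathbb{C}$-vector space generated by symbols $x^ry^s(u,v)$, with $r,s\ge0$, $r+s=k-2$, $(u,v)\in E_l$ (extended linearly to $P(x,y)(u,v)$ for homogeneous polynomials $P$ of degree $k-2$), modulo the relations (1) $x^ry^s(u,v)+(-1)^rx^sy^r(v,-u)=0$; (2) $x^ry^s(u,v)+(-1)^ry^r(x-y)^s(v,-u-v)+(-1)^s(y-x)^rx^s(-u-v,u)=0$. Let $q=e^{2\pi i\tau}$ and $E_2=-\frac1{24}+\sum_{n>0}q^n\sum_{d\mid n}d$. Quasimodular forms on $\Gamma_1(l)$ are the elements of the ring generated over the ring of modular forms on $\Gamma_1(l)$ by $E_2$ (of weight $2$), graded by weight. For integers $a,d$ put $\delta_d^{a \bmod l}=1$ if $d\equiv a \pmod l$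 and $0$ otherwise. For $j\ge 1$ and $a\in\mathbb{Z}/l\mathbb{Z}$ put $$\tilde s^{(j)}_{a/l}=C+\sum_{n>0}q^n\sum_{d\mid n}d^{j-1}\bigl(\delta_d^{a\bmod l}+(-1)^j\delta_d^{-a\bmod l}\bigr),$$ where for $(a,j)\neq(0,2)$ the constant $C$ is the unique one making $\tilde s^{(j)}_{a/l}$ a modular form of weight $j$ on $\Gamma_1(l)$ (for $j=1$ and $1\le a\le l-1$, $C=\frac12-\frac al$; $\tilde s^{(1)}_{0/l}=0$), and for $(a,j)=(0,2)$ it is $C=-l/12$, so that $\tilde s^{(2)}_{0/l}(\tau)=2l\,E_2(l\tau)$ is quasimodular. *)

theory Defs
  imports
    "HOL-Complex_Analysis.Complex_Analysis"
    "HOL-Computational_Algebra.Polynomial"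
    "HOL-Number_Theory.Cong"
    "HOL-Library.Function_Algebras"
    "HOL-Library.Set_Algebras"
    "HOL-Library.FuncSet"
    "HOL-Algebra.Module"
begin

section \<open>Complex vector spaces of functions and their quotients\<close>

definition cscale :: "complex \<Rightarrow> ('a \<Rightarrow> complex) \<Rightarrow> ('a \<Rightarrow> complex)" where
  "cscale c f = (\<lambda>x. c * f x)"

interpretation cfun: vector_space cscale
  by standard (auto simp: cscale_def fun_eq_iff algebra_simps)

definition complex_ring :: "complex ring" where
  "complex_ring = \<lparr>carrier = UNIV, mult = (*), one = 1, zero = 0, add = (+)\<rparr>"

text \<open>The quotient \<open>V / W\<close>, as the set of cosets \<open>f + W\<close> with \<open>f\<close> in \<open>V\<close>. Addition of cosets is
  the elementwise sum of sets. The \<open>mult\<close> and \<open>one\<close> fields, which every \<open>module\<close> record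
  carries, have no meaning here.\<close>

definition quotient_space ::
    "('a \<Rightarrow> complex) set \<Rightarrow> ('a \<Rightarrow> complex) set \<Rightarrow> (complex, ('a \<Rightarrow> complex) set) module" where
  "quotient_space V W =
     \<lparr>carrier = (\<lambda>f. f +o W) ` V, mult = undefined, one = undefined, zero = W,
      add = (\<lambda>X Y. X + Y), smult = (\<lambda>c X. \<Union>f\<in>X. cscale c f +o W)\<rparr>"

text \<open>Linear maps are required to be \<open>undefined\<close> outside the carrier of the source, so that two of
  them are equal as soon as they agree on the carrier.\<close>

definition linear_maps ::
    "(complex, 'a) module \<Rightarrow> (complex, 'b) module \<Rightarrow> ('a \<Rightarrow> 'b) set" where
  "linear_maps M N =
     {\<phi> \<in> carrier M \<rightarrow>\<^sub>E carrier N.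
        (\<forall>x\<in>carrier M. \<forall>y\<in>carrier M. \<phi> (x \<oplus>\<^bsub>M\<^esub> y) = \<phi> x \<oplus>\<^bsub>N\<^esub> \<phi> y) \<and>
        (\<forall>c. \<forall>x\<in>carrier M. \<phi> (c \<odot>\<^bsub>M\<^esub> x) = c \<odot>\<^bsub>N\<^esub> \<phi> x)}"

lemma subspace_coset_add:
  assumes "cfun.subspace W"
  shows "(f +o W) + (g +o W) = (f + g) +o W"
proof -
  have "W + W = W"
  proof
    show "W + W \<subseteq> W"
      using assms by (auto simp: set_plus_def cfun.subspace_add)
    show "W \<subseteq> W + W"
      using assms set_zero_plus2[of W W] by (auto simp: cfun.subspace_0)
  qed
  then show ?thesis
    by (simp add: set_plus_rearrange)
qed

lemma subspace_coset_scale: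
  assumes "cfun.subspace W"
  shows "(\<Union>h\<in>f +o W. cscale c h +o W) = cscale c f +o W"
proof
  show "(\<Union>h\<in>f +o W. cscale c h +o W) \<subseteq> cscale c f +o W"
  proof
    fix x assume "x \<in> (\<Union>h\<in>f +o W. cscale c h +o W)"
    then obtain w w' where w: "w \<in> W" "w' \<in> W" "x = cscale c (f + w) + w'"
      by (auto simp: elt_set_plus_def)
    then have "x = cscale c f + (cscale c w + w')"
      by (simp add: cfun.scale_right_distrib add.assoc)
    moreover have "cscale c w + w' \<in> W"
      using assms w by (simp add: cfun.subspace_add cfun.subspace_scale)
    ultimately show "x \<in> cscale c f +o W"
      by (auto simp: elt_set_plus_def)
  qed
  have "f \<in> f +o W"
    using cfun.subspace_0[OF assms] by (force simp: elt_set_plus_def)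
  then show "cscale c f +o W \<subseteq> (\<Union>h\<in>f +o W. cscale c h +o W)"
    by blast
qed

lemma quotient_space_smult:
  assumes "cfun.subspace W"
  shows "c \<odot>\<^bsub>quotient_space V W\<^esub> (f +o W) = cscale c f +o W"
  using subspace_coset_scale[OF assms] by (simp add: quotient_space_def)

lemma quotient_space_add:
  assumes "cfun.subspace W"
  shows "(f +o W) \<oplus>\<^bsub>quotient_space V W\<^esub> (g +o W) = (f + g) +o W"
  using subspace_coset_add[OF assms] by (simp add: quotient_space_def)

lemma quotient_space_carrier: "carrier (quotient_space V W) = (\<lambda>f. f +o W) ` V"
  by (simp add: quotient_space_def)

lemma module_quotient_space:
  assumes V: "cfun.subspace V" and W: "cfun.subspace W"
  shows "Module.module complex_ring (quotient_space V W)"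
proof (rule Module.moduleI)
  note cadd = subspace_coset_add[OF W]
  have zero: "W = 0 +o W" by simp
  show "cring complex_ring"
  proof (rule cringI)
    show "abelian_group complex_ring"
    proof (rule abelian_groupI)
      fix x assume "x \<in> carrier complex_ring"
      show "\<exists>y\<in>carrier complex_ring. y \<oplus>\<^bsub>complex_ring\<^esub> x = \<zero>\<^bsub>complex_ring\<^esub>"
        by (rule bexI[of _ "- x"]) (simp_all add: complex_ring_def)
    qed (auto simp: complex_ring_def)
  qed (auto simp: complex_ring_def algebra_simps intro!: comm_monoidI)
  show "abelian_group (quotient_space V W)"
  proof (rule abelian_groupI)
    show "\<zero>\<^bsub>quotient_space V W\<^esub> \<in> carrier (quotient_space V W)"
      using V zero by (auto simp: quotient_space_def cfun.subspace_0 intro!: image_eqI[of _ _ 0])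
  next
    fix X assume "X \<in> carrier (quotient_space V W)"
    then obtain f where f: "f \<in> V" "X = f +o W" by (auto simp: quotient_space_def)
    then show "\<zero>\<^bsub>quotient_space V W\<^esub> \<oplus>\<^bsub>quotient_space V W\<^esub> X = X"
      using cadd[of 0 f] by (simp add: quotient_space_def)
    have "(- f) +o W + X = W" "- f \<in> V"
      using f cadd[of "- f" f] V by (simp_all add: cfun.subspace_neg)
    then show "\<exists>Y\<in>carrier (quotient_space V W). Y \<oplus>\<^bsub>quotient_space V W\<^esub> X = \<zero>\<^bsub>quotient_space V W\<^esub>"
      by (auto simp: quotient_space_def)
  qed (use V subspace_coset_add[OF W] in \<open>auto simp: quotient_space_def cfun.subspace_add add_ac\<close>)
qed (use V in \<open>auto simp: quotient_space_carrier quotient_space_add[OF W] quotient_space_smult[OF W]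
       complex_ring_def cfun.subspace_scale cfun.scale_left_distrib cfun.scale_right_distrib\<close>)


section \<open>Manin symbols\<close>

text \<open>The residue classes modulo \<open>l\<close> are represented by the integers \<open>0, \<dots>, l - 1\<close>.\<close>

definition unimodular_pairs :: "nat \<Rightarrow> (int \<times> int) set" where
  "unimodular_pairs l =
     {(u, v). u \<in> {0..<int l} \<and> v \<in> {0..<int l} \<and>
              (\<forall>w. \<exists>m n. [m * u + n * v = w] (mod int l))}"

text \<open>\<open>(r, s, u, v)\<close> stands for the symbol \<open>x\<^sup>r y\<^sup>s (u, v)\<close>.\<close>

type_synonym symbol = "nat \<times> nat \<times> int \<times> int"

definition manin_generator :: "symbol \<Rightarrow> symbol \<Rightarrow> complex" where
  "manin_generator t = (\<lambda>t'. if t' = t then 1 else 0)"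

definition manin_free_space :: "nat \<Rightarrow> nat \<Rightarrow> (symbol \<Rightarrow> complex) set" where
  "manin_free_space l k =
     cfun.span {manin_generator (r, s, u, v) |r s u v.
                  r + s = k - 2 \<and> (u, v) \<in> unimodular_pairs l}"

text \<open>Polynomials in \<open>x\<close> and \<open>y\<close> are polynomials in \<open>y\<close> over the ring of polynomials in \<open>x\<close>:
  the coefficient of \<open>x\<^sup>r y\<^sup>s\<close> in \<open>P\<close> is \<open>coeff (coeff P s) r\<close>.\<close>

abbreviation polyX :: "complex poly poly" where "polyX \<equiv> [:[:0, 1:]:]"
abbreviation polyY :: "complex poly poly" where "polyY \<equiv> [:0, 1:]"

text \<open>\<open>P(x, y)(u, v)\<close> for \<open>P\<close> homogeneous of degree \<open>k - 2\<close>; here \<open>u\<close> and \<open>v\<close> may be any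
  integers representing the two residue classes.\<close>

definition manin_symbol ::
    "nat \<Rightarrow> nat \<Rightarrow> complex poly poly \<Rightarrow> int \<Rightarrow> int \<Rightarrow> (symbol \<Rightarrow> complex)" where
  "manin_symbol l k P u v =
     (\<Sum>r\<le>k - 2. cscale (coeff (coeff P (k - 2 - r)) r)
        (manin_generator (r, k - 2 - r, u mod int l, v mod int l)))"

definition manin_relations :: "nat \<Rightarrow> nat \<Rightarrow> (symbol \<Rightarrow> complex) set" where
  "manin_relations l k =
     {manin_symbol l k (polyX ^ r * polyY ^ s) u v
      + cscale ((-1) ^ r) (manin_symbol l k (polyX ^ s * polyY ^ r) v (- u))
        |r s u v. r + s = k - 2 \<and> (u, v) \<in> unimodular_pairs l} \<union>
     {manin_symbol l k (polyX ^ r * polyY ^ s) u v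
      + cscale ((-1) ^ r) (manin_symbol l k (polyY ^ r * (polyX - polyY) ^ s) v (- u - v))
      + cscale ((-1) ^ s) (manin_symbol l k ((polyY - polyX) ^ r * polyX ^ s) (- u - v) u)
        |r s u v. r + s = k - 2 \<and> (u, v) \<in> unimodular_pairs l}"

definition manin_space :: "nat \<Rightarrow> nat \<Rightarrow> (complex, (symbol \<Rightarrow> complex) set) module" where
  "manin_space l k = quotient_space (manin_free_space l k) (cfun.span (manin_relations l k))"

definition manin_class :: "nat \<Rightarrow> nat \<Rightarrow> nat \<Rightarrow> nat \<Rightarrow> int \<Rightarrow> int \<Rightarrow> (symbol \<Rightarrow> complex) set" where
  "manin_class l k r s u v = manin_generator (r, s, u, v) +o cfun.span (manin_relations l k)"


section \<open>Modular and quasimodular forms\<close>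

text \<open>Functions on the upper half-plane are represented by functions on the complex plane that vanish
  off it, so that equality of functions is equality on the upper half-plane.\<close>

definition upper_half_plane :: "complex set" where
  "upper_half_plane = {\<tau>. Im \<tau> > 0}"

definition SL2Z :: "(int \<times> int \<times> int \<times> int) set" where
  "SL2Z = {(a, b, c, d). a * d - b * c = 1}"

definition Gamma1 :: "nat \<Rightarrow> (int \<times> int \<times> int \<times> int) set" where
  "Gamma1 l = {(a, b, c, d) \<in> SL2Z.
     [a = 1] (mod int l) \<and> [c = 0] (mod int l) \<and> [d = 1] (mod int l)}"

fun slash :: "nat \<Rightarrow> (complex \<Rightarrow> complex) \<Rightarrow> int \<times> int \<times> int \<times> int \<Rightarrow> complex \<Rightarrow> complex" where
  "slash k f (a, b, c, d) \<tau> =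
     f ((of_int a * \<tau> + of_int b) / (of_int c * \<tau> + of_int d)) / (of_int c * \<tau> + of_int d) ^ k"

text \<open>Holomorphy at the cusps is boundedness of all translates under the full modular group as the
  imaginary part tends to infinity. There are no nonzero modular forms of negative weight, so
  weights are natural numbers.\<close>

definition modular_forms :: "nat \<Rightarrow> nat \<Rightarrow> (complex \<Rightarrow> complex) set" where
  "modular_forms l k =
     {f. f holomorphic_on upper_half_plane \<and>
         (\<forall>\<tau>. \<tau> \<notin> upper_half_plane \<longrightarrow> f \<tau> = 0) \<and>
         (\<forall>\<gamma>\<in>Gamma1 l. \<forall>\<tau>\<in>upper_half_plane. slash k f \<gamma> \<tau> = f \<tau>) \<and>
         (\<forall>\<gamma>\<in>SL2Z. \<exists>B Y. \<forall>\<tau>\<in>upper_half_plane. Im \<tau> \<ge> Y \<longrightarrow> norm (slash k f \<gamma> \<tau>) \<le> B)}"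

text \<open>The function \<open>C + (\<Sum>n>0. a n q\<^sup>n)\<close> of \<open>\<tau>\<close>, where \<open>q = e\<^bsup>2\<pi>i\<tau>\<^esup>\<close>.\<close>

definition q_series :: "complex \<Rightarrow> (nat \<Rightarrow> complex) \<Rightarrow> complex \<Rightarrow> complex" where
  "q_series C a = (\<lambda>\<tau>. if \<tau> \<in> upper_half_plane
     then C + (\<Sum>n. a (Suc n) * exp (2 * of_real pi * \<i> * \<tau>) ^ Suc n) else 0)"

definition E2 :: "complex \<Rightarrow> complex" where
  "E2 = q_series (- 1 / 24) (\<lambda>n. \<Sum>d | d dvd n. of_nat d)"

text \<open>\<open>quasimodular l k f\<close>: \<open>f\<close> is a homogeneous element of weight \<open>k\<close> of the ring generated by
  \<open>E2\<close> over the graded ring of modular forms. The constants are the modular forms of weight \<open>0\<close>.\<close>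

inductive quasimodular :: "nat \<Rightarrow> nat \<Rightarrow> (complex \<Rightarrow> complex) \<Rightarrow> bool" for l :: nat where
  modular: "f \<in> modular_forms l k \<Longrightarrow> quasimodular l k f"
| E2: "quasimodular l 2 E2"
| add: "quasimodular l k f \<Longrightarrow> quasimodular l k g \<Longrightarrow> quasimodular l k (f + g)"
| mult: "quasimodular l k f \<Longrightarrow> quasimodular l m g \<Longrightarrow> quasimodular l (k + m) (f * g)"

definition quasimodular_forms :: "nat \<Rightarrow> nat \<Rightarrow> (complex \<Rightarrow> complex) set" where
  "quasimodular_forms l k = {f. quasimodular l k f}"

definition eisenstein_coeff :: "nat \<Rightarrow> nat \<Rightarrow> int \<Rightarrow> nat \<Rightarrow> complex" where
  "eisenstein_coeff l j a n =
     (\<Sum>d | d dvd n. of_nat d ^ (j - 1) *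
        (of_bool ([int d = a] (mod int l)) + (-1) ^ j * of_bool ([int d = - a] (mod int l))))"

definition eisenstein_const :: "nat \<Rightarrow> nat \<Rightarrow> int \<Rightarrow> complex" where
  "eisenstein_const l j a =
     (if j = 2 \<and> [a = 0] (mod int l) then - of_nat l / 12
      else (THE C. q_series C (eisenstein_coeff l j a) \<in> modular_forms l j))"

definition stilde :: "nat \<Rightarrow> nat \<Rightarrow> int \<Rightarrow> complex \<Rightarrow> complex" where
  "stilde l j a = q_series (eisenstein_const l j a) (eisenstein_coeff l j a)"

definition dtau :: "(complex \<Rightarrow> complex) \<Rightarrow> complex \<Rightarrow> complex" where
  "dtau f = (\<lambda>\<tau>. if \<tau> \<in> upper_half_plane then deriv f \<tau> else 0)"

definition eisenstein_subspace :: "nat \<Rightarrow> nat \<Rightarrow> (complex \<Rightarrow> complex) set" where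
  "eisenstein_subspace l k =
     cfun.span ({stilde l k a |a. a \<in> {0..<int l}} \<union> {dtau (stilde l (k - 2) a) |a. a \<in> {0..<int l}})"

definition quasimodular_quotient :: "nat \<Rightarrow> nat \<Rightarrow> (complex, (complex \<Rightarrow> complex) set) module" where
  "quasimodular_quotient l k = quotient_space (quasimodular_forms l k) (eisenstein_subspace l k)"

end

theory Submission
  imports Defs
begin

text \<open>The relation of length two is the parity of the series \<open>stilde\<close>. For the relation of length three,
  expand the three products. A pair of frequencies \<open>(d\<^sub>1, d\<^sub>2)\<close> is completed to a triple with sum
  \<open>0\<close>, and the three products attach the same value to a triple with different signs, so that Euclid's
  algorithm on the cofactors cancels everything except the triples whose largest entry divides \<open>n\<close> and
  those with a zero entry. The products of a constant term with a Fourier coefficient cancel the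
  former: the constant terms are regularised sums over a residue class, and shifting such a sum
  produces a trapezoidal sum minus an integral. The integrals contribute the Eisenstein series of
  weight \<open>k\<close>, the zero entries the derivatives of those of weight \<open>k - 2\<close>. The remaining constant is
  quasimodular of positive weight and hence \<open>0\<close>.

  Modularity of the Eisenstein series, including weights one and two, comes from the Kronecker
  function \<open>coth (x / 2) / 2 - \<Sum> q\<^sup>n \<Sum> (e\<^bsup>dx\<^esup> - e\<^bsup>- dx\<^esup>)\<close>, whose transformation
  law under the modular group follows from Liouville's theorem; the series are its Taylor
  coefficients at torsion points.\<close>

section \<open>The Kronecker function\<close>

text \<open>The constant term of \<open>stilde\<close> is given by a definite description, so
  nothing can be computed before its existence and uniqueness are known. Existence comes from a
  finite Fourier transform over the torsion points \<open>b / l\<close>: in weight two every torsion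
  series has the same anomaly, which cancels when the Fourier weights sum to 0, that is, for every
  class except 0. For that class the transform yields the prescribed \<open>- l / 12\<close>, so
  that afterwards no weight or class is special. The relation of length three has a simple origin.
  In the frequencies x and y of the two factors, a polynomial P attached to (u, v) acts as P(y, -x).
  After this twist the three polynomials of the relation are one function on the plane x + y + z =
  0, read in the variables (x, y), (y, z) and (z, x), and the classes u, v, w sum to 0. The delicate
  point is a frequency 0. It has to be counted with weight 1 / 2, which happens by itself because -
  \<open>half_coth\<close> x is formally 1 / 2 plus the sum of e^(d x) over d > 0. Counting settles
  the coefficients with n > 0; the constant term of the three-term sum is never computed.\<close>

definition half_coth :: "complex \<Rightarrow> complex" where
  "half_coth x = (exp x + 1) / (2 * (exp x - 1))"

lemma half_coth_0 [simp]: "half_coth 0 = 0"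
  by (simp add: half_coth_def)

lemma half_coth_minus: "half_coth (- x) = - half_coth x"
proof (cases "exp x = 1")
  case False
  then have "exp x - 1 \<noteq> 0" "1 - exp x \<noteq> 0" by auto
  then show ?thesis
    by (simp add: half_coth_def exp_minus divide_simps) (auto simp: algebra_simps)
qed (simp add: half_coth_def exp_minus)

lemma half_coth_cong: "exp x = exp y \<Longrightarrow> half_coth x = half_coth y"
  by (simp add: half_coth_def)

lemma half_coth_add_half:
  assumes "exp x \<noteq> 1"
  shows "half_coth x + 1 / 2 = exp x / (exp x - 1)"
proof -
  have "exp x - 1 \<noteq> 0" using assms by auto
  then show ?thesis by (simp add: half_coth_def divide_simps algebra_simps)
qed

text \<open>Exponential approach to the limit - 1 / 2 as Re x tends to minus infinity. The
  convergence of the Kronecker series and the bounds at the cusps rest on it.\<close>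

lemma norm_half_coth_add_half_le:
  assumes "norm (exp x) \<le> 1 / 2"
  shows "norm (half_coth x + 1 / 2) \<le> 2 * norm (exp x)"
proof -
  have ne: "exp x \<noteq> 1"
  proof
    assume "exp x = 1"
    with assms show False by (simp del: norm_exp_eq_Re)
  qed
  have "1 / 2 \<le> norm (exp x - 1)"
    using norm_triangle_ineq2[of 1 "exp x"] assms by (simp add: norm_minus_commute)
  then have "norm (exp x) / norm (exp x - 1) \<le> norm (exp x) / (1 / 2)"
    by (intro divide_left_mono) (auto intro: mult_pos_pos)
  then show ?thesis
    using ne by (simp add: half_coth_add_half norm_divide)
qed

lemma half_coth_holomorphic: "half_coth holomorphic_on {x. exp x \<noteq> 1}"
  unfolding half_coth_def[abs_def] by (intro holomorphic_intros) auto

lemma exp_eq_1_small: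
  assumes "exp x = (1::complex)" "norm x < 2 * pi"
  shows "x = 0"
proof -
  from assms(1) obtain n :: int where n: "Re x = 0" "Im x = of_int (2 * n) * pi"
    by (auto simp: exp_eq_1)
  then have "norm x = 2 * pi * \<bar>of_int n\<bar>"
    by (simp add: cmod_eq_Im abs_mult)
  then have "\<bar>of_int n :: real\<bar> < 1" using assms(2) by simp
  then have "n = 0" by linarith
  with n show ?thesis by (simp add: complex_eq_iff)
qed

text \<open>The difference is the quotient f / g of the proof, whose numerator vanishes to order 3
  at 0 and whose denominator only to order 2.\<close>

lemma half_coth_diff_inverse_tendsto: "(\<lambda>x. half_coth x - 1 / x) \<midarrow>0\<rightarrow> 0"
proof -
  define f where "f = (\<lambda>x::complex. x * (exp x + 1) - 2 * (exp x - 1))"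
  define g where "g = (\<lambda>x::complex. 2 * x * (exp x - 1))"
  define F where "F = fps_X * (fps_exp 1 + 1) - fps_const 2 * (fps_exp (1::complex) - 1)"
  define G where "G = fps_const 2 * fps_X * (fps_exp (1::complex) - 1)"
  have F: "f has_fps_expansion F" and G: "g has_fps_expansion G"
    unfolding f_def F_def g_def G_def by (intro fps_expansion_intros)+
  have F_nth: "F $ 0 = 0" "F $ 1 = 0" "F $ 2 = 0" "F $ 3 \<noteq> 0"
    by (simp_all add: F_def numeral_2_eq_2 numeral_3_eq_3)
  have G_nth: "G $ 0 = 0" "G $ 1 = 0" "G $ 2 = 2"
    by (simp_all add: G_def numeral_2_eq_2 mult.assoc)
  have sd: "subdegree G = 2" "subdegree F = 3"
    using F_nth G_nth by (intro subdegreeI; force simp: less_Suc_eq numeral_2_eq_2 numeral_3_eq_3)+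
  have "(\<lambda>x. if x = 0 then 0 else f x / g x) has_fps_expansion F / G"
    using F G by (rule has_fps_expansion_divide) (use sd F_nth G_nth in auto)
  then have "continuous (at 0) (\<lambda>x. if x = 0 then 0 else f x / g x)"
    by (rule has_fps_expansion_imp_continuous)
  then have lim: "(\<lambda>x. if x = 0 then 0 else f x / g x) \<midarrow>0\<rightarrow> 0"
    by (simp add: continuous_at)
  have "\<forall>\<^sub>F x in at 0. x \<in> ball 0 1 - {0 :: complex}"
    using eventually_at_in_open[of "ball 0 1" "0 :: complex"] by simp
  then have "\<forall>\<^sub>F x in at 0. (if x = 0 then 0 else f x / g x) = half_coth x - 1 / x"
  proof eventually_elim
    case (elim x)
    have "exp x \<noteq> 1"
      using elim pi_gt3 exp_eq_1_small[of x] by auto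
    then show ?case
      using elim by (simp add: f_def g_def half_coth_def divide_simps algebra_simps)
  qed
  with lim show ?thesis
    by (rule Lim_transform_eventually)
qed

text \<open>Division by zero gives the function the value 0 at 0, which is also its limit there, so
  the singularity is removable without redefining anything.\<close>

lemma half_coth_diff_inverse_holomorphic: "(\<lambda>x. half_coth x - 1 / x) holomorphic_on ball 0 (2 * pi)"
proof (rule no_isolated_singularity'[where K = "{0}"])
  show "(\<lambda>x. half_coth x - 1 / x) holomorphic_on ball 0 (2 * pi) - {0}"
    by (intro holomorphic_intros holomorphic_on_subset[OF half_coth_holomorphic])
      (use exp_eq_1_small in auto)
qed (use half_coth_diff_inverse_tendsto in \<open>auto intro: tendsto_within_subset\<close>)

text \<open>With w = 2 pi i \<tau>, the terms at x + m w and x - m w tend to - 1 / 2 and 1 / 2, so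
  the series converges only if they are paired.\<close>

definition kron_tail :: "complex \<Rightarrow> complex \<Rightarrow> complex" where
  "kron_tail \<tau> x = (\<Sum>m. half_coth (x + of_nat (Suc m) * (2 * of_real pi * \<i> * \<tau>))
                      + half_coth (x - of_nat (Suc m) * (2 * of_real pi * \<i> * \<tau>)))"

text \<open>The logarithmic derivative of the odd Jacobi theta function: simple poles of residue 1
  at the points of 2 pi i (Z + Z \<tau>), the period 2 pi i, and the additive quasi-period 2 pi i
  \<tau>.\<close>

definition kron :: "complex \<Rightarrow> complex \<Rightarrow> complex" where
  "kron \<tau> x = half_coth x + kron_tail \<tau> x"

definition nome :: "complex \<Rightarrow> complex" where
  "nome \<tau> = exp (2 * of_real pi * \<i> * \<tau>)"

lemma norm_nome: "norm (nome \<tau>) = exp (- 2 * pi * Im \<tau>)"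
  by (simp add: nome_def)

lemma norm_nome_less_1: "\<tau> \<in> upper_half_plane \<Longrightarrow> norm (nome \<tau>) < 1"
  by (simp add: norm_nome upper_half_plane_def)

lemma nome_nonzero [simp]: "nome \<tau> \<noteq> 0"
  by (simp add: nome_def)

text \<open>Measured from their limits, the two terms lose opposite constants 1 / 2; oddness of
  \<open>half_coth\<close> reduces the second term to the same bound as the first.\<close>

lemma kron_term_le:
  assumes x: "norm (exp x * nome \<tau> ^ m) \<le> 1 / 2" and y: "norm (exp (- x) * nome \<tau> ^ m) \<le> 1 / 2"
  shows "norm (half_coth (x + of_nat m * (2 * of_real pi * \<i> * \<tau>)) + half_coth (x - of_nat m * (2 * of_real pi * \<i> * \<tau>)))
           \<le> 2 * (norm (exp x) + norm (exp (- x))) * norm (nome \<tau>) ^ m"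
proof -
  define w where "w = of_nat m * (2 * of_real pi * \<i> * \<tau>)"
  have w: "exp w = nome \<tau> ^ m" by (simp only: w_def nome_def exp_of_nat_mult)
  have 1: "norm (half_coth (x + w) + 1 / 2) \<le> 2 * norm (exp (x + w))"
    using x w by (intro norm_half_coth_add_half_le) (simp add: exp_add)
  have 2: "norm (half_coth (- x + w) + 1 / 2) \<le> 2 * norm (exp (- x + w))"
    using y w by (intro norm_half_coth_add_half_le) (simp only: exp_add)
  have "half_coth (x + w) + half_coth (x - w) = (half_coth (x + w) + 1 / 2) - (half_coth (- x + w) + 1 / 2)"
    using half_coth_minus[of "- x + w"] by (simp add: algebra_simps)
  also have "norm \<dots> \<le> 2 * norm (exp (x + w)) + 2 * norm (exp (- x + w))"
    using norm_triangle_ineq4 1 2 by (meson add_mono order_trans)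
  also have "\<dots> = 2 * (norm (exp x) + norm (exp (- x))) * norm (nome \<tau>) ^ m"
    unfolding exp_add w by (simp add: norm_mult norm_power algebra_simps del: norm_exp_eq_Re)
  finally show ?thesis unfolding w_def .
qed

lemma kron_summable:
  assumes "\<tau> \<in> upper_half_plane"
  shows "summable (\<lambda>m. half_coth (x + of_nat (Suc m) * (2 * of_real pi * \<i> * \<tau>))
                    + half_coth (x - of_nat (Suc m) * (2 * of_real pi * \<i> * \<tau>)))"
proof -
  have q: "norm (nome \<tau>) < 1" using assms by (rule norm_nome_less_1)
  have lim: "(\<lambda>m. c * nome \<tau> ^ Suc m) \<longlonglongrightarrow> 0" for c
    by (rule LIMSEQ_Suc) (intro tendsto_mult_right_zero LIMSEQ_power_zero q)
  have ev: "\<forall>\<^sub>F m in sequentially. norm (c * nome \<tau> ^ Suc m) \<le> 1 / 2" for c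
    using tendstoD[OF lim, of "1/2" c] by (auto elim!: eventually_mono)
  show ?thesis
  proof (rule summable_comparison_test_ev)
    show "\<forall>\<^sub>F m in sequentially. norm (half_coth (x + of_nat (Suc m) * (2 * of_real pi * \<i> * \<tau>))
            + half_coth (x - of_nat (Suc m) * (2 * of_real pi * \<i> * \<tau>)))
            \<le> 2 * (norm (exp x) + norm (exp (- x))) * norm (nome \<tau>) ^ Suc m"
      using ev[of "exp x"] ev[of "exp (- x)"] by eventually_elim (rule kron_term_le)
    show "summable (\<lambda>m. 2 * (norm (exp x) + norm (exp (- x))) * norm (nome \<tau>) ^ Suc m)"
      using q by (intro summable_mult) (simp add: summable_mult summable_geometric)
  qed
qed

text \<open>The bound is independent of \<tau> and x, as needed for boundedness at the
  cusps.\<close>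

lemma norm_kron_tail_le:
  assumes "norm (nome \<tau>) \<le> 1 / 2" "norm (exp x * nome \<tau>) \<le> 1 / 2" "norm (exp (- x) * nome \<tau>) \<le> 1 / 2"
  shows "norm (kron_tail \<tau> x) \<le> 4"
proof -
  define t where "t = (\<lambda>m. half_coth (x + of_nat (Suc m) * (2 * of_real pi * \<i> * \<tau>))
            + half_coth (x - of_nat (Suc m) * (2 * of_real pi * \<i> * \<tau>)))"
  have le: "norm (exp y * nome \<tau> ^ Suc m) \<le> 1 / 2 * (1 / 2) ^ m" if "norm (exp y * nome \<tau>) \<le> 1 / 2" for y m
    unfolding power_Suc mult.assoc[symmetric] norm_mult[of _ "nome \<tau> ^ m"] norm_power
    by (intro mult_mono power_mono that assms) auto
  have half: "1 / 2 * (1 / 2) ^ m \<le> (1 / 2 :: real)" for m by (simp add: power_le_one)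
  have t: "norm (t m) \<le> 2 * (1 / 2) ^ m" for m
  proof -
    have "norm (t m) \<le> 2 * (norm (exp x) + norm (exp (- x))) * norm (nome \<tau>) ^ Suc m"
      unfolding t_def using le[OF assms(2)] le[OF assms(3)] half by (intro kron_term_le) (meson order_trans)+
    also have "\<dots> = 2 * (norm (exp x * nome \<tau> ^ Suc m) + norm (exp (- x) * nome \<tau> ^ Suc m))"
      by (simp add: norm_mult norm_power algebra_simps del: norm_exp_eq_Re)
    also have "\<dots> \<le> 2 * (1 / 2 * (1 / 2) ^ m + 1 / 2 * (1 / 2) ^ m)"
      by (intro mult_left_mono add_mono le assms) auto
    finally show ?thesis by simp
  qed
  have s: "summable (\<lambda>m. 2 * (1 / 2 :: real) ^ m)" by (intro summable_mult summable_geometric) simp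
  have "norm (suminf t) \<le> (\<Sum>m. 2 * (1 / 2 :: real) ^ m)"
    by (rule norm_suminf_le[OF t s])
  also have "\<dots> = 4" by (simp add: suminf_mult suminf_geometric)
  finally show ?thesis by (simp add: kron_tail_def t_def)
qed

lemma kron_minus:
  assumes "\<tau> \<in> upper_half_plane"
  shows "kron \<tau> (- x) = - kron \<tau> x"
proof -
  have *: "half_coth (- x + w) + half_coth (- x - w) = - (half_coth (x + w) + half_coth (x - w))" for w
    using half_coth_minus[of "x + w"] half_coth_minus[of "x - w"] by simp
  show ?thesis
    unfolding kron_def kron_tail_def *
    by (subst suminf_minus[OF kron_summable[OF assms]]) (simp add: half_coth_minus)
qed

lemma kron_0: "\<tau> \<in> upper_half_plane \<Longrightarrow> kron \<tau> 0 = 0"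
  using kron_minus[of \<tau> 0] by simp

lemma half_coth_tendsto:
  assumes "f \<longlonglongrightarrow> 0" "\<And>n. exp (g n) = f n"
  shows "(\<lambda>n. half_coth (g n)) \<longlonglongrightarrow> - (1 / 2)"
proof -
  have "(\<lambda>n. (f n + 1) / (2 * (f n - 1))) \<longlonglongrightarrow> (0 + 1) / (2 * (0 - 1))"
    by (intro tendsto_intros assms) auto
  then show ?thesis by (simp add: half_coth_def assms(2))
qed

lemma kron_partial_sums:
  assumes "\<tau> \<in> upper_half_plane"
  shows "(\<lambda>n. half_coth x + (\<Sum>m<n. half_coth (x + of_nat (Suc m) * (2 * of_real pi * \<i> * \<tau>))
                    + half_coth (x - of_nat (Suc m) * (2 * of_real pi * \<i> * \<tau>)))) \<longlonglongrightarrow> kron \<tau> x"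
  unfolding kron_def kron_tail_def
  by (intro tendsto_intros summable_LIMSEQ kron_summable assms)

text \<open>This holds at the poles as well: there the junk value of \<^const>\<open>half_coth\<close> is the constant
  term of the Laurent expansion.\<close>

lemma kron_add_period:
  assumes \<tau>: "\<tau> \<in> upper_half_plane"
  shows "kron \<tau> (x + 2 * of_real pi * \<i> * \<tau>) = kron \<tau> x - 1"
proof -
  define w where "w = 2 * of_real pi * \<i> * \<tau>"
  define S where "S = (\<lambda>x n. half_coth x + (\<Sum>m<n. half_coth (x + of_nat (Suc m) * w)
                    + half_coth (x - of_nat (Suc m) * w)))"
  have S: "S y \<longlonglongrightarrow> kron \<tau> y" for y
    using kron_partial_sums[OF \<tau>, of y] by (simp add: S_def w_def)
  \<comment> \<open>S is a window of 2 n + 1 consecutive translates by multiples of w. Shifting x by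
    w gains one term at one end and loses one at the other; their limits - 1 / 2 and 1 / 2 make up
    the jump - 1.\<close>
  have tele: "S (x + w) n = S x n + half_coth (x + of_nat (Suc n) * w) - half_coth (x - of_nat n * w)" for n
    by (induction n) (simp_all add: S_def algebra_simps)
  have ew: "exp (of_nat n * w) = nome \<tau> ^ n" for n
    by (simp only: w_def nome_def exp_of_nat_mult)
  have z: "(\<lambda>n. c * nome \<tau> ^ n) \<longlonglongrightarrow> 0" for c
    by (intro tendsto_mult_right_zero LIMSEQ_power_zero norm_nome_less_1 \<tau>)
  have "(\<lambda>n. half_coth (x + of_nat (Suc n) * w)) \<longlonglongrightarrow> - (1 / 2)"
    by (rule LIMSEQ_Suc, rule half_coth_tendsto[OF z[of "exp x"]]) (simp only: exp_add ew)
  moreover have "(\<lambda>n. half_coth (- x + of_nat n * w)) \<longlonglongrightarrow> - (1 / 2)"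
    by (rule half_coth_tendsto[OF z[of "exp (- x)"]]) (simp only: exp_add ew)
  then have "(\<lambda>n. - half_coth (- x + of_nat n * w)) \<longlonglongrightarrow> - (- (1 / 2))"
    by (rule tendsto_minus)
  then have "(\<lambda>n. half_coth (x - of_nat n * w)) \<longlonglongrightarrow> 1 / 2"
    by (simp flip: half_coth_minus)
  ultimately have "S (x + w) \<longlonglongrightarrow> kron \<tau> x + - (1 / 2) - 1 / 2"
    unfolding tele[abs_def] by (intro tendsto_intros S)
  then show ?thesis
    using LIMSEQ_unique[OF S] by (simp add: w_def)
qed

lemma kron_cong:
  assumes "exp x = exp y"
  shows "kron \<tau> x = kron \<tau> y"
proof -
  have "half_coth (x + w) = half_coth (y + w)" "half_coth (x - w) = half_coth (y - w)" for w
    by (rule half_coth_cong, simp add: exp_add exp_diff assms)+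
  then show ?thesis
    using half_coth_cong[OF assms] by (simp add: kron_def kron_tail_def)
qed

lemma exp_add_period: "exp (x + 2 * of_real pi * \<i> * of_int m) = exp x"
  by (simp add: exp_eq)

lemma kron_add_lattice:
  assumes \<tau>: "\<tau> \<in> upper_half_plane"
  shows "kron \<tau> (x + 2 * of_real pi * \<i> * (of_int m + of_int n * \<tau>)) = kron \<tau> x - of_int n"
proof -
  define w where "w = 2 * of_real pi * \<i> * \<tau>"
  have nat: "kron \<tau> (x + of_nat k * w) = kron \<tau> x - of_nat k" for k x
  proof (induction k)
    case (Suc k)
    have "kron \<tau> (x + of_nat (Suc k) * w) = kron \<tau> (x + of_nat k * w + w)"
      by (simp add: algebra_simps)
    then show ?case using Suc kron_add_period[OF \<tau>] by (simp add: w_def)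
  qed simp
  have int: "kron \<tau> (x + of_int n * w) = kron \<tau> x - of_int n"
  proof (cases n)
    case (nonneg k)
    then show ?thesis using nat[of x k] by simp
  next
    case (neg k)
    then have n: "of_int n = - (of_nat (Suc k) :: complex)" by simp
    define y where "y = x + of_int n * w"
    have "y + of_nat (Suc k) * w = x" by (simp add: y_def n algebra_simps)
    then have "kron \<tau> y = kron \<tau> x - of_int n"
      using nat[of y "Suc k"] by (simp add: n)
    then show ?thesis by (simp only: y_def)
  qed
  have "kron \<tau> (x + 2 * of_real pi * \<i> * (of_int m + of_int n * \<tau>))
      = kron \<tau> (x + of_int n * w + 2 * of_real pi * \<i> * of_int m)"
    by (simp add: w_def algebra_simps)
  also have "\<dots> = kron \<tau> (x + of_int n * w)"
    by (intro kron_cong exp_add_period)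
  finally show ?thesis using int by simp
qed

text \<open>The poles of the m-th pair have real part plus or minus m times 2 pi Im \<tau>, with m
  at least 1, so the open strip avoids them all; there \<open>kron_term_le\<close> gives a geometric
  majorant.\<close>

lemma kron_tail_holomorphic:
  assumes \<tau>: "\<tau> \<in> upper_half_plane"
  shows "kron_tail \<tau> holomorphic_on {x. \<bar>Re x\<bar> < 2 * pi * Im \<tau>}"
proof -
  define \<rho> where "\<rho> = 2 * pi * Im \<tau>"
  define w where "w = 2 * of_real pi * \<i> * \<tau>"
  have \<rho>: "\<rho> > 0" using \<tau> by (simp add: \<rho>_def upper_half_plane_def)
  have Rew: "Re w = - \<rho>" by (simp add: w_def \<rho>_def)
  define t where "t = (\<lambda>m x. half_coth (x + of_nat (Suc m) * w) + half_coth (x - of_nat (Suc m) * w))"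
  have op: "open {x. \<bar>Re x\<bar> < \<rho>}"
    by (intro open_Collect_less continuous_intros)
  have ne: "exp (x + of_nat (Suc m) * w) \<noteq> 1" "exp (x - of_nat (Suc m) * w) \<noteq> 1" if "\<bar>Re x\<bar> < \<rho>" for x m
  proof -
    have "real (Suc m) * \<rho> \<ge> 1 * \<rho>" using \<rho> by (intro mult_right_mono) auto
    moreover have "Re (of_nat (Suc m) * w) = - (real (Suc m) * \<rho>)"
      using Rew by simp
    ultimately have "Re (x + of_nat (Suc m) * w) \<noteq> 0" "Re (x - of_nat (Suc m) * w) \<noteq> 0"
      using that unfolding plus_complex.sel minus_complex.sel by linarith+
    then show "exp (x + of_nat (Suc m) * w) \<noteq> 1" "exp (x - of_nat (Suc m) * w) \<noteq> 1"
      by (simp_all only: exp_eq_1 simp_thms)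
  qed
  have "(\<lambda>x. \<Sum>m. t m x) holomorphic_on {x. \<bar>Re x\<bar> < \<rho>}"
  proof (rule holomorphic_uniform_sequence[OF op])
    have "(half_coth \<circ> (\<lambda>x. x + of_nat (Suc m) * w)) holomorphic_on {x. \<bar>Re x\<bar> < \<rho>}"
         "(half_coth \<circ> (\<lambda>x. x - of_nat (Suc m) * w)) holomorphic_on {x. \<bar>Re x\<bar> < \<rho>}" for m
      by (rule holomorphic_on_compose_gen[OF _ half_coth_holomorphic];
          (intro holomorphic_intros)?; use ne in auto)+
    then show "(\<lambda>x. \<Sum>m<n. t m x) holomorphic_on {x. \<bar>Re x\<bar> < \<rho>}" for n
      by (intro holomorphic_intros) (simp add: t_def o_def holomorphic_on_add)
  next
    fix x assume "x \<in> {x. \<bar>Re x\<bar> < \<rho>}"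
    then obtain d where d: "d > 0" "cball x d \<subseteq> {x. \<bar>Re x\<bar> < \<rho>}"
      using op by (meson open_contains_cball)
    have "uniform_limit (cball x d) (\<lambda>n x. \<Sum>m<n. t m x) (\<lambda>x. \<Sum>m. t m x) sequentially"
    proof (rule Weierstrass_m_test_ev)
      have "(\<lambda>m. exp \<rho> * norm (nome \<tau>) ^ Suc m) \<longlonglongrightarrow> 0"
        by (rule LIMSEQ_Suc) (intro tendsto_mult_right_zero LIMSEQ_power_zero,
           simp add: norm_nome_less_1[OF \<tau>])
      from order_tendstoD(2)[OF this, of "1/2"]
      have "\<forall>\<^sub>F m in sequentially. exp \<rho> * norm (nome \<tau>) ^ Suc m < 1 / 2" by simp
      then show "\<forall>\<^sub>F m in sequentially. \<forall>y\<in>cball x d. norm (t m y) \<le> 2 * (exp \<rho> + exp \<rho>) * norm (nome \<tau>) ^ Suc m"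
      proof eventually_elim
        case (elim m)
        show ?case
        proof
          fix y assume "y \<in> cball x d"
          then have y: "\<bar>Re y\<bar> < \<rho>" using d by auto
          then have ey: "norm (exp y) \<le> exp \<rho>" "norm (exp (- y)) \<le> exp \<rho>" by auto
          have "norm (exp z * nome \<tau> ^ Suc m) \<le> 1 / 2" if "norm (exp z) \<le> exp \<rho>" for z
          proof -
            have "norm (exp z * nome \<tau> ^ Suc m) \<le> exp \<rho> * norm (nome \<tau>) ^ Suc m"
              unfolding norm_mult norm_power by (intro mult_right_mono that) simp
            then show ?thesis using elim by linarith
          qed
          then have "norm (t m y) \<le> 2 * (norm (exp y) + norm (exp (- y))) * norm (nome \<tau>) ^ Suc m"
            unfolding t_def w_def by (intro kron_term_le) (use ey in auto)
          also have "\<dots> \<le> 2 * (exp \<rho> + exp \<rho>) * norm (nome \<tau>) ^ Suc m"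
            by (intro mult_right_mono mult_left_mono add_mono ey) auto
          finally show "norm (t m y) \<le> 2 * (exp \<rho> + exp \<rho>) * norm (nome \<tau>) ^ Suc m" .
        qed
      qed
      show "summable (\<lambda>m. 2 * (exp \<rho> + exp \<rho>) * norm (nome \<tau>) ^ Suc m)"
        using norm_nome_less_1[OF \<tau>] by (intro summable_mult) (simp add: summable_mult summable_geometric)
    qed
    then show "\<exists>d>0. cball x d \<subseteq> {x. \<bar>Re x\<bar> < \<rho>} \<and>
       uniform_limit (cball x d) (\<lambda>n x. \<Sum>m<n. t m x) (\<lambda>x. \<Sum>m. t m x) sequentially"
      using d by blast
  qed
  then show ?thesis
    by (simp add: kron_tail_def[abs_def] t_def w_def \<rho>_def)
qed

section \<open>The transformation law under the full modular group\<close>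

definition mobius :: "int \<times> int \<times> int \<times> int \<Rightarrow> complex \<Rightarrow> complex" where
  "mobius = (\<lambda>(a, b, c, d) \<tau>. (of_int a * \<tau> + of_int b) / (of_int c * \<tau> + of_int d))"

lemma automorphy_nonzero:
  assumes "(a, b, c, d) \<in> SL2Z" "\<tau> \<in> upper_half_plane"
  shows "of_int c * \<tau> + of_int d \<noteq> 0"
proof
  assume *: "of_int c * \<tau> + of_int d = 0"
  then have "Im (of_int c * \<tau> + of_int d) = 0" by simp
  then have "c = 0" using assms(2) by (simp add: upper_half_plane_def)
  with * assms(1) show False by (simp add: SL2Z_def)
qed

lemma Im_mobius:
  assumes "(a, b, c, d) \<in> SL2Z" "\<tau> \<in> upper_half_plane"
  shows "Im (mobius (a, b, c, d) \<tau>) = Im \<tau> / (norm (of_int c * \<tau> + of_int d))\<^sup>2"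
proof -
  have det: "a * d - b * c = (1 :: int)" using assms(1) by (simp add: SL2Z_def)
  have "Im (mobius (a, b, c, d) \<tau>) = (of_int (a * d - b * c) * Im \<tau>) / (norm (of_int c * \<tau> + of_int d))\<^sup>2"
    unfolding mobius_def prod.case Im_divide cmod_power2
    by (rule arg_cong2[where f = "(/)"]) (simp_all add: algebra_simps)
  then show ?thesis by (simp only: det of_int_1 mult_1)
qed

lemma mobius_in_upper_half_plane:
  assumes "\<gamma> \<in> SL2Z" "\<tau> \<in> upper_half_plane"
  shows "mobius \<gamma> \<tau> \<in> upper_half_plane"
proof (cases \<gamma>)
  case (fields a b c d)
  then show ?thesis
    using assms Im_mobius[of a b c d \<tau>] automorphy_nonzero[of a b c d \<tau>]
    by (simp add: upper_half_plane_def)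
qed

lemma kron_diff_inverse_analytic_0:
  assumes \<tau>: "\<tau> \<in> upper_half_plane"
  shows "(\<lambda>x. kron \<tau> x - 1 / x) analytic_on {0}"
proof -
  have "(\<lambda>x. half_coth x - 1 / x) analytic_on {0}"
    using half_coth_diff_inverse_holomorphic by (intro analytic_at[THEN iffD2] exI[of _ "ball 0 (2 * pi)"]) auto
  moreover have "kron_tail \<tau> analytic_on {0}"
    using kron_tail_holomorphic[OF \<tau>] \<tau>
    by (intro analytic_at[THEN iffD2] exI[of _ "{x. \<bar>Re x\<bar> < 2 * pi * Im \<tau>}"])
       (auto simp: upper_half_plane_def intro!: open_Collect_less continuous_intros)
  ultimately have "(\<lambda>x. (half_coth x - 1 / x) + kron_tail \<tau> x) analytic_on {0}"
    by (rule analytic_on_add)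
  then show ?thesis by (simp add: kron_def algebra_simps)
qed

text \<open>A lattice translation brings x into the strip where the tail is holomorphic; the poles
  of \<open>half_coth\<close> are lattice points, excluded by the hypothesis.\<close>

lemma kron_analytic:
  assumes \<tau>: "\<tau> \<in> upper_half_plane"
      and x: "\<And>m n. x \<noteq> 2 * of_real pi * \<i> * (of_int m + of_int n * \<tau>)"
  shows "kron \<tau> analytic_on {x}"
proof -
  \<comment> \<open>Rounding to the nearest integer leaves a real part of modulus at most pi Im
    \<tau>, half of what the strip allows.\<close>
  define n where "n = round (Re x / (2 * pi * Im \<tau>))"
  define w where "w = 2 * of_real pi * \<i> * (of_int 0 + of_int n * \<tau>)"
  have im: "Im \<tau> > 0" using \<tau> by (simp add: upper_half_plane_def)
  have "\<bar>Re x / (2 * pi * Im \<tau>) - of_int n\<bar> \<le> 1 / 2"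
    unfolding n_def using of_int_round_abs_le[of "Re x / (2 * pi * Im \<tau>)"] by linarith
  moreover define r where "r = Re x / (2 * pi * Im \<tau>) - of_int n"
  ultimately have "\<bar>r\<bar> < 1" by simp
  moreover have "Re (x + w) = r * (2 * pi * Im \<tau>)"
    using im by (simp add: r_def w_def left_diff_distrib)
  ultimately have strip: "\<bar>Re (x + w)\<bar> < 2 * pi * Im \<tau>"
    using im by (simp add: abs_mult)
  have ne: "exp (x + w) \<noteq> 1"
  proof
    assume "exp (x + w) = 1"
    then obtain m :: int where "Re (x + w) = 0" "Im (x + w) = of_int (2 * m) * pi"
      unfolding exp_eq_1 by blast
    then have "x + w = 2 * of_real pi * \<i> * of_int m"
      by (intro complex_eqI) simp_all
    then have "x = 2 * of_real pi * \<i> * (of_int m + of_int (- n) * \<tau>)"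
      by (simp add: w_def algebra_simps)
    with x show False by blast
  qed
  have "half_coth analytic_on {x + w}"
    using half_coth_holomorphic ne
    by (intro analytic_at[THEN iffD2] exI[of _ "{x. exp x \<noteq> 1}"])
       (auto intro!: open_Collect_neq continuous_intros)
  moreover have "kron_tail \<tau> analytic_on {x + w}"
    using kron_tail_holomorphic[OF \<tau>] strip
    by (intro analytic_at[THEN iffD2] exI[of _ "{x. \<bar>Re x\<bar> < 2 * pi * Im \<tau>}"])
       (auto intro!: open_Collect_less continuous_intros)
  ultimately have "kron \<tau> analytic_on {x + w}"
    unfolding kron_def[abs_def] by (rule analytic_on_add)
  then have "(kron \<tau> \<circ> (\<lambda>y. y + w)) analytic_on {x}"
    by (intro analytic_on_compose) (auto intro!: analytic_intros)
  then have "(\<lambda>y. (kron \<tau> \<circ> (\<lambda>y. y + w)) y + of_int n) analytic_on {x}"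
    by (intro analytic_intros)
  moreover have "(kron \<tau> \<circ> (\<lambda>y. y + w)) y + of_int n = kron \<tau> y" for y
    unfolding w_def o_def kron_add_lattice[OF \<tau>] by simp
  ultimately show ?thesis by simp
qed

text \<open>The difference of the two sides is entire, doubly periodic and vanishes at \<open>0\<close>.\<close>

theorem kron_mobius:
  assumes \<gamma>: "(a, b, c, d) \<in> SL2Z" and \<tau>: "\<tau> \<in> upper_half_plane"
  defines "j \<equiv> of_int c * \<tau> + of_int d"
  shows "kron (mobius (a, b, c, d) \<tau>) (x / j) = j * kron \<tau> x + of_int c * x / (2 * of_real pi * \<i>)"
proof -
  define \<tau>' where "\<tau>' = mobius (a, b, c, d) \<tau>"
  \<comment> \<open>Division by j gives both Kronecker functions the same polar part 1 / x at
    0.\<close>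
  define D where "D = (\<lambda>x. kron \<tau>' (x / j) / j - kron \<tau> x - of_int c * x / (2 * of_real pi * \<i> * j))"
  have \<tau>': "\<tau>' \<in> upper_half_plane"
    unfolding \<tau>'_def by (rule mobius_in_upper_half_plane[OF \<gamma> \<tau>])
  have j: "j \<noteq> 0" unfolding j_def by (rule automorphy_nonzero[OF \<gamma> \<tau>])
  have det: "a * d - b * c = 1" using \<gamma> by (simp add: SL2Z_def)
  then have det': "of_int a * of_int d - of_int b * of_int c = (1 :: complex)"
    by (metis of_int_1 of_int_diff of_int_mult)
  have tau'j: "\<tau>' * j = of_int a * \<tau> + of_int b"
    using j by (simp add: \<tau>'_def mobius_def j_def)
  \<comment> \<open>Here and in \<open>inv2\<close>, 1 and \<tau> are expressed in the basis j,
    \<tau>' j of the same lattice, by the inverse matrix.\<close>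
  have inv1: "1 = (of_int a - of_int c * \<tau>') * j"
  proof -
    have "(of_int a - of_int c * \<tau>') * j = of_int a * j - of_int c * (\<tau>' * j)"
      by (simp add: algebra_simps)
    also have "\<dots> = of_int a * of_int d - of_int b * of_int c"
      unfolding tau'j by (simp add: j_def algebra_simps)
    finally show ?thesis using det' by simp
  qed
  have inv2: "\<tau> = (of_int d * \<tau>' - of_int b) * j"
  proof -
    have "(of_int d * \<tau>' - of_int b) * j = of_int d * (\<tau>' * j) - of_int b * j"
      by (simp add: algebra_simps)
    also have "\<dots> = (of_int a * of_int d - of_int b * of_int c) * \<tau>"
      unfolding tau'j by (simp add: j_def algebra_simps)
    finally show ?thesis using det' by simp
  qed
  have per: "D (x + 2 * of_real pi * \<i> * (of_int m + of_int n * \<tau>)) = D x" for x m n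
  proof -
    have "(x + 2 * of_real pi * \<i> * (of_int m + of_int n * \<tau>)) / j
       = x / j + 2 * of_real pi * \<i> * ((of_int m * 1 + of_int n * \<tau>) / j)"
      by (simp only: add_divide_distrib[of x] times_divide_eq_right mult_1_right)
    also have "(of_int m * 1 + of_int n * \<tau>) / j
        = of_int m * (of_int a - of_int c * \<tau>') + of_int n * (of_int d * \<tau>' - of_int b)"
      using j by (subst inv1, subst inv2) (simp add: add_divide_distrib)
    also have "\<dots> = of_int (m * a - n * b) + of_int (n * d - m * c) * \<tau>'"
      by (simp add: algebra_simps)
    finally have *: "(x + 2 * of_real pi * \<i> * (of_int m + of_int n * \<tau>)) / j
       = x / j + 2 * of_real pi * \<i> * (of_int (m * a - n * b) + of_int (n * d - m * c) * \<tau>')" .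
    \<comment> \<open>Both Kronecker functions jump by integers, and the linear term of D absorbs
      the mismatch because n d - m c + c (m + n \<tau>) = n j.\<close>
    have "D (x + 2 * of_real pi * \<i> * (of_int m + of_int n * \<tau>)) - D x
        = of_int n - (of_int (n * d - m * c) / j + of_int c * (of_int m + of_int n * \<tau>) / j)"
      unfolding D_def * kron_add_lattice[OF \<tau>] kron_add_lattice[OF \<tau>']
      using j by (simp add: field_simps)
    also have "of_int (n * d - m * c) / j + of_int c * (of_int m + of_int n * \<tau>) / j = of_int n * j / j"
      unfolding add_divide_distrib[symmetric] j_def by (simp add: algebra_simps)
    finally show ?thesis using j by simp
  qed
  have an0: "D analytic_on {0}"
  proof -
    have "((\<lambda>x. kron \<tau>' x - 1 / x) \<circ> (\<lambda>x. x / j)) analytic_on {0}"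
      by (rule analytic_on_compose) (use kron_diff_inverse_analytic_0[OF \<tau>'] j in \<open>auto intro!: analytic_intros\<close>)
    then have "(\<lambda>x. inverse j * ((\<lambda>x. kron \<tau>' x - 1 / x) \<circ> (\<lambda>x. x / j)) x - (kron \<tau> x - 1 / x)
                 - of_int c / (2 * of_real pi * \<i> * j) * x) analytic_on {0}"
      by (intro analytic_on_diff analytic_on_mult analytic_on_const analytic_on_ident
            kron_diff_inverse_analytic_0 \<tau>)
    moreover have "inverse j * ((\<lambda>x. kron \<tau>' x - 1 / x) \<circ> (\<lambda>x. x / j)) x - (kron \<tau> x - 1 / x)
                 - of_int c / (2 * of_real pi * \<i> * j) * x = D x" for x
    proof -
      \<comment> \<open>Valid at x = 0 too, where every quotient by zero is 0; hence D 0 as defined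
        is the value of the analytic continuation.\<close>
      have "inverse j * (K - 1 / (x / j)) - (L - 1 / x) - C / (P * j) * x = K / j - L - C * x / (P * j)" for K L C P
        using j by (cases "x = 0") (simp_all add: right_diff_distrib divide_inverse)
      then show ?thesis by (simp only: D_def o_def)
    qed
    ultimately show ?thesis by simp
  qed
  have an: "D analytic_on {x}" for x
  proof (cases "\<exists>m n. x = 2 * of_real pi * \<i> * (of_int m + of_int n * \<tau>)")
    case True
    then obtain m n where x: "x = 2 * of_real pi * \<i> * (of_int m + of_int n * \<tau>)" by blast
    have "(D \<circ> (\<lambda>y. y + 2 * of_real pi * \<i> * (of_int (- m) + of_int (- n) * \<tau>))) analytic_on {x}"
      by (rule analytic_on_compose) (use an0 x in \<open>auto intro!: analytic_intros simp: algebra_simps\<close>)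
    moreover have "D \<circ> (\<lambda>y. y + 2 * of_real pi * \<i> * (of_int (- m) + of_int (- n) * \<tau>)) = D"
      by (simp add: fun_eq_iff per del: of_int_minus)
    ultimately show ?thesis by simp
  next
    case False
    have "x / j \<noteq> 2 * of_real pi * \<i> * (of_int m + of_int n * \<tau>')" for m n
    proof
      assume "x / j = 2 * of_real pi * \<i> * (of_int m + of_int n * \<tau>')"
      then have "x = 2 * of_real pi * \<i> * (of_int m * j + of_int n * (\<tau>' * j))"
        using j by (simp add: field_simps)
      also have "\<dots> = 2 * of_real pi * \<i> * (of_int (m * d + n * b) + of_int (m * c + n * a) * \<tau>)"
        unfolding tau'j by (simp add: j_def algebra_simps)
      finally show False using False by blast
    qed
    then have "(kron \<tau>' \<circ> (\<lambda>x. x / j)) analytic_on {x}"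
      by (intro analytic_on_compose) (use kron_analytic[OF \<tau>', of "x / j"] j in \<open>auto intro!: analytic_intros\<close>)
    note * = this
    have "(\<lambda>x. inverse j * (kron \<tau>' \<circ> (\<lambda>x. x / j)) x - kron \<tau> x
                 - of_int c / (2 * of_real pi * \<i> * j) * x) analytic_on {x}"
      by (intro analytic_on_diff analytic_on_mult analytic_on_const analytic_on_ident
            kron_analytic \<tau> *) (use False in blast)
    moreover have "inverse j * K - L - C / P * x = K / j - L - C * x / P" for K L C P x
      by (simp add: divide_inverse)
    ultimately show ?thesis by (simp only: D_def o_def)
  qed
  then have "D analytic_on UNIV"
    unfolding analytic_on_def by blast
  then have hol: "D holomorphic_on UNIV" by (rule analytic_imp_holomorphic)
  \<comment> \<open>A closed fundamental parallelogram: periodicity makes D take all its values on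
    this compact set.\<close>
  define K where "K = (\<lambda>(s, t). 2 * of_real pi * \<i> * (of_real s + of_real t * \<tau>)) ` ({0..1} \<times> {0..1 :: real})"
  have "compact K"
    unfolding K_def by (intro compact_continuous_image compact_Times)
      (auto simp: case_prod_unfold intro!: continuous_intros)
  then have "compact (D ` K)"
    using hol by (intro compact_continuous_image) (auto intro: holomorphic_on_imp_continuous_on holomorphic_on_subset)
  moreover have "range D \<subseteq> D ` K"
  proof
    fix z assume "z \<in> range D"
    then obtain x where z: "z = D x" by blast
    have im: "Im \<tau> \<noteq> 0" using \<tau> by (simp add: upper_half_plane_def)
    define t where "t = Im (x / (2 * of_real pi * \<i>)) / Im \<tau>"
    define s where "s = Re (x / (2 * of_real pi * \<i>)) - t * Re \<tau>"
    have "x / (2 * of_real pi * \<i>) = of_real s + of_real t * \<tau>"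
      using im by (auto simp: complex_eq_iff s_def t_def)
    then have x: "x = 2 * of_real pi * \<i> * (of_real s + of_real t * \<tau>)"
      by (simp add: field_simps)
    have "z = D (x + 2 * of_real pi * \<i> * (of_int (- \<lfloor>s\<rfloor>) + of_int (- \<lfloor>t\<rfloor>) * \<tau>))"
      by (simp only: z per)
    also have "x + 2 * of_real pi * \<i> * (of_int (- \<lfloor>s\<rfloor>) + of_int (- \<lfloor>t\<rfloor>) * \<tau>)
      = 2 * of_real pi * \<i> * (of_real (frac s) + of_real (frac t) * \<tau>)"
      by (simp add: x frac_def algebra_simps)
    finally have "z = D (2 * of_real pi * \<i> * (of_real (frac s) + of_real (frac t) * \<tau>))" .
    moreover have "2 * of_real pi * \<i> * (of_real (frac s) + of_real (frac t) * \<tau>) \<in> K"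
      unfolding K_def by (rule image_eqI[of _ _ "(frac s, frac t)"]) (auto simp: frac_ge_0 less_imp_le[OF frac_lt_1])
    ultimately show "z \<in> D ` K" by blast
  qed
  ultimately have "bounded (range D)"
    by (meson bounded_subset compact_imp_bounded)
  then have "D constant_on UNIV"
    using Liouville_theorem[OF hol] by (auto simp: constant_on_def)
  moreover have "D 0 = 0" by (simp add: D_def kron_0 \<tau> \<tau>')
  ultimately have "D x = 0" by (auto simp: constant_on_def)
  then have "kron \<tau>' (x / j) / j = kron \<tau> x + of_int c * x / (2 * of_real pi * \<i> * j)"
    by (simp add: D_def diff_eq_eq add.commute)
  then have "j * (kron \<tau>' (x / j) / j) = j * (kron \<tau> x + of_int c * x / (2 * of_real pi * \<i> * j))"
    by simp
  then show ?thesis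
    using j by (simp add: \<tau>'_def distrib_left)
qed

section \<open>Fourier expansions\<close>

lemma summable_power_geometric:
  fixes r :: real
  assumes "0 \<le> r" "r < 1"
  shows "summable (\<lambda>n. real n ^ p * r ^ n)"
proof -
  have "(\<lambda>n. real (Suc n) / real (Suc (Suc n))) \<longlonglongrightarrow> 1"
    using LIMSEQ_n_over_Suc_n by (rule LIMSEQ_Suc)
  then have "(\<lambda>n. (real (Suc n) / real (Suc (Suc n))) ^ p) \<longlonglongrightarrow> 1 ^ p"
    by (rule tendsto_power)
  then have "(\<lambda>n. norm (real (Suc n) ^ p) / norm (real (Suc (Suc n)) ^ p)) \<longlonglongrightarrow> 1"
    by (simp add: power_divide)
  then have "conv_radius (\<lambda>n. real (Suc n) ^ p) = 1"
    by (intro conv_radius_ratio_limit_nonzero[of _ 1]) (auto simp: one_ereal_def)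
  then have "summable (\<lambda>n. norm (real (Suc n) ^ p * r ^ n))"
    using assms by (intro abs_summable_in_conv_radius) auto
  then have "summable (\<lambda>n. r * (real (Suc n) ^ p * r ^ n))"
    using assms by (intro summable_mult) (simp add: abs_mult)
  then have "summable (\<lambda>n. real (Suc n) ^ p * r ^ Suc n)"
    by (simp add: mult_ac)
  then show ?thesis by (subst (asm) summable_Suc_iff)
qed

lemma fps_conv_radius_ge_1:
  fixes F :: "complex fps"
  assumes "\<And>n. norm (fps_nth F (Suc n)) \<le> C * real (Suc n) ^ p"
  shows "fps_conv_radius F \<ge> 1"
  unfolding fps_conv_radius_def
proof (rule conv_radius_geI_ex')
  fix r :: real assume r: "0 < r" "ereal r < 1"
  have "summable (\<lambda>n. fps_nth F (Suc n) * of_real r ^ Suc n)"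
  proof (rule summable_comparison_test)
    show "\<exists>N. \<forall>n\<ge>N. norm (fps_nth F (Suc n) * of_real r ^ Suc n) \<le> C * (real (Suc n) ^ p * r ^ Suc n)"
    proof (intro exI allI impI)
      fix n
      have "norm (fps_nth F (Suc n) * of_real r ^ Suc n) = norm (fps_nth F (Suc n)) * r ^ Suc n"
        using r by (simp add: norm_mult norm_power)
      also have "\<dots> \<le> C * real (Suc n) ^ p * r ^ Suc n"
        using assms r by (intro mult_right_mono) auto
      finally show "norm (fps_nth F (Suc n) * of_real r ^ Suc n) \<le> C * (real (Suc n) ^ p * r ^ Suc n)"
        by (simp add: mult_ac)
    qed
    show "summable (\<lambda>n. C * (real (Suc n) ^ p * r ^ Suc n))"
      using summable_power_geometric[of r p] r
      by (intro summable_mult, subst summable_Suc_iff) auto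
  qed
  then show "summable (\<lambda>n. fps_nth F n * of_real r ^ n)"
    by (subst (asm) summable_Suc_iff)
qed

lemma q_series_eq_eval_fps:
  assumes "fps_conv_radius F \<ge> 1" "\<tau> \<in> upper_half_plane"
  shows "q_series (fps_nth F 0) (fps_nth F) \<tau> = eval_fps F (nome \<tau>)"
proof -
  have "ereal (norm (nome \<tau>)) < fps_conv_radius F"
    using norm_nome_less_1[OF assms(2)] assms(1) by (metis ereal_less(3) less_le_trans one_ereal_def)
  then have "summable (\<lambda>n. fps_nth F n * nome \<tau> ^ n)"
    by (rule summable_fps)
  then have "(\<Sum>n. fps_nth F n * nome \<tau> ^ n) = fps_nth F 0 + (\<Sum>n. fps_nth F (Suc n) * nome \<tau> ^ Suc n)"
    by (subst suminf_split_head) auto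
  then show ?thesis
    using assms(2) by (simp add: q_series_def eval_fps_def nome_def)
qed

text \<open>The value 0 off the upper half-plane matches \<open>q_series\<close>. Identities between
  forms thereby reduce to identities between formal power series.\<close>

definition from_q :: "complex fps \<Rightarrow> complex \<Rightarrow> complex" where
  "from_q F \<tau> = (if \<tau> \<in> upper_half_plane then eval_fps F (nome \<tau>) else 0)"

lemma q_series_eq_from_q:
  assumes "fps_conv_radius F \<ge> 1"
  shows "q_series (fps_nth F 0) (fps_nth F) = from_q F"
  using q_series_eq_eval_fps[OF assms] by (auto simp: from_q_def q_series_def)

lemma nome_in_conv_radius:
  assumes "fps_conv_radius F \<ge> 1" "\<tau> \<in> upper_half_plane"
  shows "ereal (norm (nome \<tau>)) < fps_conv_radius F"
  using norm_nome_less_1[OF assms(2)] assms(1) by (metis ereal_less(3) less_le_trans one_ereal_def)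

lemma from_q_add:
  assumes "fps_conv_radius F \<ge> 1" "fps_conv_radius G \<ge> 1"
  shows "from_q (F + G) = from_q F + from_q G"
  using assms by (auto simp: from_q_def fun_eq_iff intro!: eval_fps_add nome_in_conv_radius)

lemma from_q_mult:
  assumes "fps_conv_radius F \<ge> 1" "fps_conv_radius G \<ge> 1"
  shows "from_q (F * G) = from_q F * from_q G"
  using assms by (auto simp: from_q_def fun_eq_iff intro!: eval_fps_mult nome_in_conv_radius)

lemma from_q_cmult:
  assumes "fps_conv_radius F \<ge> 1"
  shows "from_q (fps_const c * F) = cscale c (from_q F)"
  using assms by (auto simp: from_q_def cscale_def fun_eq_iff eval_fps_mult nome_in_conv_radius)

lemma from_q_holomorphic:
  assumes "fps_conv_radius F \<ge> 1"
  shows "from_q F holomorphic_on upper_half_plane"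
proof -
  have "(eval_fps F \<circ> nome) holomorphic_on upper_half_plane"
    by (rule holomorphic_on_compose_gen[OF _ holomorphic_on_eval_fps[of "eball 0 (fps_conv_radius F)" F]])
       (use assms nome_in_conv_radius in \<open>auto simp: nome_def[abs_def] intro!: holomorphic_intros\<close>)
  then show ?thesis
    by (rule holomorphic_transform) (simp add: from_q_def)
qed

lemma open_upper_half_plane: "open upper_half_plane"
  unfolding upper_half_plane_def by (intro open_Collect_less continuous_intros)

text \<open>Chain rule for q = e^(2 pi i \<tau>). A factor n in the n-th Fourier coefficient is thus
  the mark of a derivative, which is how the derivatives enter the relation.\<close>

lemma dtau_from_q:
  assumes "fps_conv_radius F \<ge> 1"
  shows "dtau (from_q F) = cscale (2 * of_real pi * \<i>) (from_q (fps_X * fps_deriv F))"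
proof
  fix \<tau>
  show "dtau (from_q F) \<tau> = cscale (2 * of_real pi * \<i>) (from_q (fps_X * fps_deriv F)) \<tau>"
  proof (cases "\<tau> \<in> upper_half_plane")
    case True
    note r = nome_in_conv_radius[OF assms True]
    have "(nome has_field_derivative (2 * of_real pi * \<i>) * nome \<tau>) (at \<tau>)"
      unfolding nome_def[abs_def] by (auto intro!: derivative_eq_intros)
    with has_field_derivative_eval_fps[OF r]
    have "(eval_fps F \<circ> nome has_field_derivative
             eval_fps (fps_deriv F) (nome \<tau>) * ((2 * of_real pi * \<i>) * nome \<tau>)) (at \<tau>)"
      by (rule DERIV_chain)
    then have "(from_q F has_field_derivative
             eval_fps (fps_deriv F) (nome \<tau>) * ((2 * of_real pi * \<i>) * nome \<tau>)) (at \<tau>)"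
      by (rule has_field_derivative_transform_within_open[OF _ open_upper_half_plane True])
         (simp add: from_q_def)
    then have "deriv (from_q F) \<tau> = 2 * of_real pi * \<i> * (nome \<tau> * eval_fps (fps_deriv F) (nome \<tau>))"
      by (subst DERIV_imp_deriv) (simp_all add: mult_ac)
    also have "nome \<tau> * eval_fps (fps_deriv F) (nome \<tau>) = eval_fps (fps_X * fps_deriv F) (nome \<tau>)"
      using r fps_conv_radius_deriv[of F] by (subst eval_fps_mult) auto
    finally show ?thesis using True
      by (simp add: dtau_def cscale_def from_q_def[of "fps_X * fps_deriv F"])
  qed (simp add: dtau_def cscale_def from_q_def)
qed

section \<open>Divisor sums and the expansion of the Kronecker function\<close>

definition divisor_sum_fps :: "complex \<Rightarrow> (nat \<Rightarrow> complex) \<Rightarrow> complex fps" where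
  "divisor_sum_fps C f = Abs_fps (\<lambda>n. if n = 0 then C else \<Sum>d | d dvd n. f d)"

lemma divisor_sum_fps_nth [simp]:
  "fps_nth (divisor_sum_fps C f) 0 = C"
  "n > 0 \<Longrightarrow> fps_nth (divisor_sum_fps C f) n = (\<Sum>d | d dvd n. f d)"
  by (simp_all add: divisor_sum_fps_def)

lemma norm_divisor_sum_le:
  assumes "\<And>d. norm (f d :: complex) \<le> K * real d ^ p" "n > 0"
  shows "norm (\<Sum>d | d dvd n. f d) \<le> K * real n ^ Suc p"
proof -
  have K: "K \<ge> 0" using assms(1)[of 1] norm_ge_zero[of "f 1"] by (simp del: norm_ge_zero)
  have "{d. d dvd n} \<subseteq> {1..n}" using assms(2) by (auto simp: Suc_le_eq dvd_imp_le intro!: Nat.gr0I)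
  then have card: "card {d. d dvd n} \<le> n" using card_mono[of "{1..n}"] by fastforce
  have "norm (\<Sum>d | d dvd n. f d) \<le> (\<Sum>d | d dvd n. K * real n ^ p)"
    by (rule sum_norm_le, rule order_trans[OF assms(1)])
       (use assms(2) K in \<open>auto intro!: mult_left_mono power_mono dest: dvd_imp_le\<close>)
  also have "\<dots> = K * real n ^ p * real (card {d. d dvd n})" by simp
  also have "\<dots> \<le> K * real n ^ p * real n" using card K by (intro mult_left_mono) auto
  finally show ?thesis by (simp add: mult_ac)
qed

lemma divisor_sum_fps_conv_radius:
  assumes "\<And>d. norm (f d :: complex) \<le> K * real d ^ p"
  shows "fps_conv_radius (divisor_sum_fps C f) \<ge> 1"
  by (rule fps_conv_radius_ge_1[where C = K and p = "Suc p"])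
     (use norm_divisor_sum_le[OF assms, of "Suc _"] in \<open>simp del: power_Suc\<close>)

lemma half_coth_sums:
  assumes "norm (exp x) < 1"
  shows "(\<lambda>d. exp (of_nat (Suc d) * x)) sums - (half_coth x + 1 / 2)"
proof -
  have ne: "exp x \<noteq> 1" using assms by (metis norm_one order_less_irrefl)
  have "(\<lambda>d. exp x ^ d) sums (1 / (1 - exp x))"
    using assms by (rule geometric_sums)
  then have "(\<lambda>d. exp x * exp x ^ d) sums (exp x * (1 / (1 - exp x)))"
    by (rule sums_mult)
  moreover have "exp x * (1 / (1 - exp x)) = - (half_coth x + 1 / 2)"
    unfolding half_coth_add_half[OF ne] by (simp add: minus_divide_right)
  moreover have "exp x * exp x ^ d = exp (of_nat (Suc d) * x)" for d
    by (simp only: exp_of_nat_mult power_Suc)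
  ultimately show ?thesis by simp
qed

no_notation Infinite_Set_Sum.abs_summable_on (infix \<open>abs'_summable'_on\<close> 50)

text \<open>Two orders of summation of one double series, with terms q^(m d) (e^(d x) - e^(- d x)).
  For fixed m the sum over d is a difference of geometric series and gives one pair of the tail; for
  fixed n = m d it is a divisor sum.\<close>

lemma kron_tail_sums:
  assumes \<tau>: "\<tau> \<in> upper_half_plane" and x: "\<bar>Re x\<bar> < 2 * pi * Im \<tau>"
  shows "(\<lambda>n. nome \<tau> ^ Suc n * (\<Sum>d | d dvd Suc n. exp (of_nat d * x) - exp (- (of_nat d * x))))
            sums - kron_tail \<tau> x"
proof -
  define w where "w = 2 * of_real pi * \<i> * \<tau>"
  define q where "q = norm (nome \<tau>)"
  define R where "R = exp \<bar>Re x\<bar>"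
  define f where "f = (\<lambda>(m, d). nome \<tau> ^ (m * d) * (exp (of_nat d * x) - exp (- (of_nat d * x))))"
  define N where "N = {1 :: nat..}"
  have q: "0 < q" "q < 1" using norm_nome_less_1[OF \<tau>] by (auto simp: q_def)
  have Rq: "R * q < 1" "R \<ge> 1" using x by (auto simp: R_def q_def norm_nome simp flip: exp_add)
  \<comment> \<open>The inequality m d \<ge> d + (m - 1) separates the variables. One factor q^d
    absorbs the growth R^d of the exponentials, and x in the strip means precisely R q < 1.\<close>
  have bound: "norm (f (m, d)) \<le> 2 * (R * q) ^ d * q ^ (m - 1)" if "m \<in> N" "d \<in> N" for m d
  proof -
    have e: "norm (exp y) \<le> R" if "\<bar>Re y\<bar> \<le> \<bar>Re x\<bar>" for y using that by (auto simp: R_def)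
    have "norm (exp (of_nat d * x) - exp (of_nat d * (- x))) \<le> R ^ d + R ^ d"
      unfolding exp_of_nat_mult by (rule order_trans[OF norm_triangle_ineq4], unfold norm_power)
        (intro add_mono power_mono e; simp)
    then have "norm (f (m, d)) \<le> q ^ (m * d) * (2 * R ^ d)"
      by (simp add: f_def norm_mult norm_power q_def mult_left_mono)
    also have "m * d = d + (m - 1) * d" using that(1) by (cases m) (auto simp: N_def)
    also have "q ^ (d + (m - 1) * d) * (2 * R ^ d) \<le> q ^ (d + (m - 1)) * (2 * R ^ d)"
    proof (intro mult_right_mono power_decreasing add_left_mono)
      show "m - 1 \<le> (m - 1) * d" using that by (simp add: N_def)
    qed (use q Rq in auto)
    finally show ?thesis by (simp add: power_add power_mult_distrib mult_ac)
  qed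
  have geo: "(\<lambda>d. c * r ^ (d - k)) abs_summable_on N" if "0 \<le> r" "r < 1" for c r :: real and k
  proof -
    have "summable (\<lambda>d. norm (c * r ^ d))"
      using that by (simp add: abs_mult summable_mult summable_geometric)
    then have "summable (\<lambda>d. norm (c * r ^ (d + k - k)))" by simp
    then have "summable (\<lambda>d. norm (c * r ^ (d - k)))"
      using summable_iff_shift[of "\<lambda>d. norm (c * r ^ (d - k))" k] by simp
    then show ?thesis
      using norm_summable_imp_summable_on[of "\<lambda>d. norm (c * r ^ (d - k))"]
      by (auto intro: summable_on_subset_banach)
  qed
  have abs: "f abs_summable_on N \<times> N"
  proof (rule Infinite_Sum.abs_summable_on_comparison_test)
    show "(\<lambda>(m, d). 2 * (R * q) ^ d * q ^ (m - 1)) abs_summable_on N \<times> N"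
      unfolding Infinite_Sum.abs_summable_on_Sigma_iff
    proof (intro conjI ballI)
      fix m assume "m \<in> N"
      show "(\<lambda>d. case (m, d) of (m, d) \<Rightarrow> 2 * (R * q) ^ d * q ^ (m - 1)) abs_summable_on N"
        using geo[of "R * q" "2 * q ^ (m - 1)" 0] q Rq by (simp add: mult_ac)
    next
      have "(\<lambda>m. (\<Sum>\<^sub>\<infinity>d\<in>N. 2 * (R * q) ^ d) * q ^ (m - 1)) abs_summable_on N"
        using q by (intro geo) auto
      moreover have "(\<Sum>\<^sub>\<infinity>d\<in>N. norm (case (m, d) of (m, d) \<Rightarrow> 2 * (R * q) ^ d * q ^ (m - 1)))
          = (\<Sum>\<^sub>\<infinity>d\<in>N. 2 * (R * q) ^ d) * q ^ (m - 1)" for m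
        using q Rq by (simp add: abs_mult infsum_cmult_left')
      ultimately show "(\<lambda>m. \<Sum>\<^sub>\<infinity>d\<in>N. norm (case (m, d) of (m, d) \<Rightarrow> 2 * (R * q) ^ d * q ^ (m - 1)))
          abs_summable_on N" by simp
    qed
    fix z assume "z \<in> N \<times> N"
    then show "norm (f z) \<le> norm (case z of (m, d) \<Rightarrow> 2 * (R * q) ^ d * q ^ (m - 1))"
      using bound q Rq by (cases z) auto
  qed
  then have "f summable_on N \<times> N" by (rule abs_summable_summable)
  then obtain S where S: "(f has_sum S) (N \<times> N)" by (auto simp: summable_on_def)
  have bij: "bij_betw Suc UNIV N"
    unfolding N_def by (rule bij_betwI[of _ _ _ "\<lambda>n. n - 1"]) auto
  define t where "t = (\<lambda>m. half_coth (x + of_nat m * w) + half_coth (x - of_nat m * w))"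
  have w: "exp (of_nat m * w) = nome \<tau> ^ m" for m
    by (simp only: w_def nome_def exp_of_nat_mult)
  have Rew: "Re (of_nat m * w) = - (real m * (2 * pi * Im \<tau>))" for m
    by (simp add: w_def)
  have inner: "((\<lambda>d. f (m, d)) has_sum (- t m)) N" if "m \<in> N" for m
  proof -
    have "1 * (2 * pi * Im \<tau>) \<le> real m * (2 * pi * Im \<tau>)"
      using that \<tau> by (intro mult_right_mono) (auto simp: N_def upper_half_plane_def)
    then have neg: "norm (exp (x + of_nat m * w)) < 1" "norm (exp (- x + of_nat m * w)) < 1"
      unfolding norm_exp_eq_Re plus_complex.sel uminus_complex.sel Rew exp_less_one_iff using x by linarith+
    have "- (half_coth (x + of_nat m * w) + 1 / 2) - - (half_coth (- x + of_nat m * w) + 1 / 2) = - t m"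
      using half_coth_minus[of "x - of_nat m * w"] by (simp add: t_def)
    with sums_diff[OF half_coth_sums[OF neg(1)] half_coth_sums[OF neg(2)]]
    have "(\<lambda>d. exp (of_nat (Suc d) * (x + of_nat m * w)) - exp (of_nat (Suc d) * (- x + of_nat m * w))) sums (- t m)"
      by simp
    moreover have "exp (of_nat d * (x + of_nat m * w)) - exp (of_nat d * (- x + of_nat m * w)) = f (m, d)" for d
    proof -
      have "exp (of_nat d * (y + of_nat m * w)) = nome \<tau> ^ (m * d) * exp (of_nat d * y)" for y
        by (simp add: distrib_left exp_add power_mult mult.commute[of _ "exp (of_nat d * y)"]
              flip: w exp_of_nat_mult)
      from this[of x] this[of "- x"] show ?thesis by (simp add: f_def right_diff_distrib)
    qed
    ultimately have sums: "(\<lambda>d. f (m, Suc d)) sums (- t m)" by (simp only:)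
    have "(\<lambda>d. f (m, d)) abs_summable_on N"
      using abs that unfolding Infinite_Sum.abs_summable_on_Sigma_iff by blast
    then have "(\<lambda>d. f (m, d)) summable_on N" by (rule abs_summable_summable)
    then obtain s where s: "((\<lambda>d. f (m, d)) has_sum s) N" by (auto simp: summable_on_def)
    then have "((\<lambda>d. f (m, Suc d)) has_sum s) UNIV"
      using has_sum_reindex_bij_betw[OF bij, of "\<lambda>d. f (m, d)"] by simp
    then have "s = - t m" using sums has_sum_imp_sums sums_unique2 by blast
    with s show ?thesis by simp
  qed
  have "((\<lambda>m. - t m) has_sum S) N"
    by (rule has_sum_SigmaD[OF S inner])
  then have "((\<lambda>m. - t (Suc m)) has_sum S) UNIV"
    using has_sum_reindex_bij_betw[OF bij, of "\<lambda>m. - t m"] by simp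
  then have "(\<lambda>m. - t (Suc m)) sums S" by (rule has_sum_imp_sums)
  moreover have "(\<lambda>m. - t (Suc m)) sums (- kron_tail \<tau> x)"
    unfolding kron_tail_def t_def w_def by (intro sums_minus summable_sums kron_summable \<tau>)
  ultimately have S_eq: "S = - kron_tail \<tau> x" by (rule sums_unique2)
  define D where "D = Sigma N (\<lambda>n. {d. d dvd n})"
  have "((\<lambda>(n, d). nome \<tau> ^ n * (exp (of_nat d * x) - exp (- (of_nat d * x)))) has_sum S) D"
    using S
    by (subst has_sum_reindex_bij_witness[of D "\<lambda>(m, d). (m * d, d)" "\<lambda>(n, d). (n div d, d)" "N \<times> N" f])
       (auto simp: D_def N_def f_def Suc_le_eq dvd_div_mult_self intro!: Nat.gr0I)
  then have "((\<lambda>n. \<Sum>d | d dvd n. nome \<tau> ^ n * (exp (of_nat d * x) - exp (- (of_nat d * x)))) has_sum S) N"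
    unfolding D_def by (rule has_sum_SigmaD) (use N_def in \<open>auto intro!: has_sum_finite\<close>)
  then have "((\<lambda>n. \<Sum>d | d dvd Suc n. nome \<tau> ^ Suc n * (exp (of_nat d * x) - exp (- (of_nat d * x)))) has_sum S) UNIV"
    using has_sum_reindex_bij_betw[OF bij,
      of "\<lambda>n. \<Sum>d | d dvd n. nome \<tau> ^ n * (exp (of_nat d * x) - exp (- (of_nat d * x)))"] by simp
  then show ?thesis
    using has_sum_imp_sums by (simp add: S_eq sum_distrib_left)
qed

section \<open>Eisenstein series at torsion points\<close>

lemma higher_deriv_sum_at:
  fixes f :: "'a \<Rightarrow> complex \<Rightarrow> complex"
  assumes "\<And>i. i \<in> I \<Longrightarrow> f i analytic_on {z}"
  shows "(deriv ^^ n) (\<lambda>w. \<Sum>i\<in>I. f i w) z = (\<Sum>i\<in>I. (deriv ^^ n) (f i) z)"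
  using assms
proof (induction I rule: infinite_finite_induct)
  case (insert i I)
  have "(\<lambda>w. \<Sum>i\<in>I. f i w) analytic_on {z}"
    using insert by (intro analytic_on_sum) auto
  then show ?case using insert by (simp add: higher_deriv_add_at)
qed simp_all

lemma higher_deriv_compose_scale_at:
  fixes f :: "complex \<Rightarrow> complex"
  assumes "f analytic_on {0}"
  shows "(deriv ^^ n) (\<lambda>w. f (u * w)) 0 = u ^ n * (deriv ^^ n) f 0"
proof -
  obtain T where T: "open T" "0 \<in> T" "f holomorphic_on T"
    using assms by (auto simp: analytic_at)
  have "open ((\<lambda>w. u * w) -` T)" using T(1) by (intro open_vimage) (auto intro!: continuous_intros)
  then show ?thesis
    using higher_deriv_compose_linear[OF T(3) _ T(1), of "(\<lambda>w. u * w) -` T" 0 u n] T(2) by auto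
qed

lemma higher_deriv_translate_at:
  fixes f :: "complex \<Rightarrow> complex"
  assumes "f analytic_on {y}"
  shows "(deriv ^^ n) (\<lambda>w. f (y + w)) 0 = (deriv ^^ n) f y"
proof -
  obtain T where T: "open T" "y \<in> T" "f holomorphic_on T"
    using assms by (auto simp: analytic_at)
  have "open ((\<lambda>w. 1 * w + y) -` T)" using T(1) by (intro open_vimage) (auto intro!: continuous_intros)
  then show ?thesis
    using higher_deriv_compose_linear'[OF T(3) _ T(1), of "(\<lambda>w. 1 * w + y) -` T" 0 1 y n] T(2)
    by (auto simp: add.commute)
qed

lemma analytic_on_translate:
  fixes f :: "complex \<Rightarrow> complex"
  assumes "f analytic_on {y}"
  shows "(\<lambda>x. f (y + x)) analytic_on {0}"
proof -
  have "(f \<circ> (\<lambda>x. y + x)) analytic_on {0}"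
    by (rule analytic_on_compose) (use assms in \<open>auto intro!: analytic_intros\<close>)
  then show ?thesis by (simp add: o_def)
qed

lemma higher_deriv_exp_scale: "(deriv ^^ n) (\<lambda>x. exp (c * x)) = (\<lambda>x::complex. c ^ n * exp (c * x))"
proof (induction n)
  case (Suc n)
  have "deriv (\<lambda>x. c ^ n * exp (c * x)) x = c ^ Suc n * exp (c * x)" for x
    by (rule DERIV_imp_deriv) (auto intro!: derivative_eq_intros)
  then show ?case by (simp add: Suc fun_eq_iff)
qed simp

definition torsion :: "nat \<Rightarrow> nat \<Rightarrow> complex" where
  "torsion l b = 2 * of_real pi * \<i> * (of_nat b / of_nat l)"

text \<open>The generating function of the Eisenstein series at the torsion point \<open>b / l\<close>. Subtracting the
  pole at \<open>0\<close> leaves the junk value \<open>0\<close> there, which is the correct continuation.\<close>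

definition kron_reg :: "nat \<Rightarrow> nat \<Rightarrow> complex \<Rightarrow> complex \<Rightarrow> complex" where
  "kron_reg l b \<tau> x = kron \<tau> (torsion l b + x) - (if b = 0 then 1 / x else 0)"

definition half_coth_reg :: "nat \<Rightarrow> nat \<Rightarrow> complex \<Rightarrow> complex" where
  "half_coth_reg l b x = half_coth (torsion l b + x) - (if b = 0 then 1 / x else 0)"

text \<open>A derivative rather than a Taylor coefficient, so that d^(j - 1) appears in the Fourier
  coefficients without a factorial.\<close>

definition eis :: "nat \<Rightarrow> nat \<Rightarrow> nat \<Rightarrow> complex \<Rightarrow> complex" where
  "eis l j b \<tau> = (deriv ^^ (j - 1)) (kron_reg l b \<tau>) 0"

lemma torsion_0 [simp]: "torsion l 0 = 0"
  by (simp add: torsion_def)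

lemma Re_torsion [simp]: "Re (torsion l b) = 0"
  by (simp add: torsion_def)

lemma kron_reg_eq: "kron_reg l b \<tau> x = half_coth_reg l b x + kron_tail \<tau> (torsion l b + x)"
  by (simp add: kron_reg_def half_coth_reg_def kron_def)

text \<open>For every m, m l - f is a nonzero integer, so every pole of \<open>half_coth\<close> is
  at distance at least 2 pi / l from the torsion point.\<close>

lemma exp_torsion_ne_1:
  assumes l: "l > 0" and "\<not> int l dvd f" "norm x < 2 * pi / l"
  shows "exp (2 * of_real pi * \<i> * (of_int f / of_nat l) + x) \<noteq> 1"
proof
  assume "exp (2 * of_real pi * \<i> * (of_int f / of_nat l) + x) = 1"
  then obtain m :: int where "Re (2 * of_real pi * \<i> * (of_int f / of_nat l) + x) = 0"
     "Im (2 * of_real pi * \<i> * (of_int f / of_nat l) + x) = of_int (2 * m) * pi"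
    unfolding exp_eq_1 by blast
  then have x: "Re x = 0" "Im x = 2 * pi * (of_int m - of_int f / real l)"
    by (simp_all add: algebra_simps)
  have "m * int l - f \<noteq> 0" using assms(2) by auto
  then have "1 \<le> \<bar>m * int l - f\<bar>" by linarith
  then have "1 \<le> \<bar>of_int (m * int l - f) :: real\<bar>"
    by (metis of_int_1_le_iff of_int_abs)
  then have "1 / l \<le> \<bar>of_int (m * int l - f)\<bar> / real l"
    using l by (intro divide_right_mono) auto
  also have "\<dots> = \<bar>of_int (m * int l - f) / real l\<bar>" by simp
  also have "of_int (m * int l - f) / real l = of_int m - of_int f / real l"
    using l by (simp add: diff_divide_distrib)
  finally have "2 * pi * (1 / l) \<le> 2 * pi * \<bar>of_int m - of_int f / real l\<bar>"
    by (intro mult_left_mono) auto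
  also have "\<dots> = norm x" using x by (simp add: cmod_eq_Im abs_mult)
  finally show False using assms(3) by simp
qed

lemma half_coth_translate_holomorphic:
  assumes "l > 0" "\<not> int l dvd f"
  shows "(\<lambda>x. half_coth (2 * of_real pi * \<i> * (of_int f / of_nat l) + x)) holomorphic_on ball 0 (2 * pi / l)"
proof -
  have "(half_coth \<circ> (\<lambda>x. 2 * of_real pi * \<i> * (of_int f / of_nat l) + x)) holomorphic_on ball 0 (2 * pi / l)"
  proof (rule holomorphic_on_compose_gen[OF _ half_coth_holomorphic])
    show "(\<lambda>x. 2 * of_real pi * \<i> * (of_int f / of_nat l) + x) ` ball 0 (2 * pi / l) \<subseteq> {x. exp x \<noteq> 1}"
      unfolding image_subset_iff mem_Collect_eq using exp_torsion_ne_1[OF assms] by simp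
  qed (intro holomorphic_intros)
  then show ?thesis by (simp add: o_def)
qed

lemma half_coth_reg_holomorphic:
  assumes "b < l"
  shows "half_coth_reg l b holomorphic_on ball 0 (2 * pi / l)"
proof (cases "b = 0")
  case True
  have "2 * pi / l \<le> 2 * pi / 1" using assms by (intro divide_left_mono) auto
  then show ?thesis
    using True half_coth_diff_inverse_holomorphic
    by (auto simp: half_coth_reg_def[abs_def] intro: holomorphic_on_subset)
next
  case False
  then have "\<not> int l dvd int b" using assms by (simp add: nat_dvd_not_less)
  from half_coth_translate_holomorphic[OF _ this] assms False show ?thesis
    by (simp add: half_coth_reg_def[abs_def] torsion_def)
qed

lemma half_coth_reg_analytic: "b < l \<Longrightarrow> half_coth_reg l b analytic_on {0}"
  using half_coth_reg_holomorphic by (intro analytic_at[THEN iffD2] exI[of _ "ball 0 (2 * pi / l)"]) auto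

lemma kron_tail_analytic:
  assumes \<tau>: "\<tau> \<in> upper_half_plane" and "\<bar>Re y\<bar> < 2 * pi * Im \<tau>"
  shows "kron_tail \<tau> analytic_on {y}"
  using kron_tail_holomorphic[OF \<tau>] assms
  by (intro analytic_at[THEN iffD2] exI[of _ "{x. \<bar>Re x\<bar> < 2 * pi * Im \<tau>}"])
     (auto intro!: open_Collect_less continuous_intros)

lemma kron_tail_torsion_analytic:
  "\<tau> \<in> upper_half_plane \<Longrightarrow> kron_tail \<tau> analytic_on {torsion l b}"
  by (rule kron_tail_analytic) (auto simp: upper_half_plane_def)

lemma kron_reg_analytic:
  assumes "b < l" "\<tau> \<in> upper_half_plane"
  shows "kron_reg l b \<tau> analytic_on {0}"
  unfolding kron_reg_eq[abs_def] using assms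
  by (intro analytic_on_add half_coth_reg_analytic analytic_on_translate kron_tail_torsion_analytic)

text \<open>\<open>kron_mobius\<close> is applied at the torsion point plus x / J. The linear term
  there splits in two: its value at the torsion point is the constant b c / l, kept in K, while the
  part in x contributes to the first derivative only. Hence weight two alone has an anomaly.\<close>

lemma eis_mobius:
  assumes \<gamma>: "(a, b', c, d) \<in> SL2Z" and \<tau>: "\<tau> \<in> upper_half_plane" and j: "j \<ge> 1" and b: "b < l"
  defines "J \<equiv> of_int c * \<tau> + of_int d"
  defines "K \<equiv> (\<lambda>x. kron \<tau> (x + torsion l b * J) + of_nat b * of_int c / of_nat l - (if b = 0 then 1 / x else 0))"
  shows "K analytic_on {0}"
    and "eis l j b (mobius (a, b', c, d) \<tau>) / J ^ j
       = (deriv ^^ (j - 1)) K 0 + (if j = 2 then of_int c / (2 * of_real pi * \<i> * J) else 0)"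
proof -
  define \<tau>' where "\<tau>' = mobius (a, b', c, d) \<tau>"
  define \<kappa> :: complex where "\<kappa> = of_int c / (2 * of_real pi * \<i>)"
  have J: "J \<noteq> 0" unfolding J_def by (rule automorphy_nonzero[OF \<gamma> \<tau>])
  have \<tau>': "\<tau>' \<in> upper_half_plane"
    unfolding \<tau>'_def by (rule mobius_in_upper_half_plane[OF \<gamma> \<tau>])
  have an: "kron_reg l b \<tau>' analytic_on {0}" by (rule kron_reg_analytic[OF b \<tau>'])
  have eq: "kron_reg l b \<tau>' (inverse J * x) = J * K x + \<kappa> * x" for x
  proof -
    have "kron_reg l b \<tau>' (inverse J * x) = kron \<tau>' ((x + torsion l b * J) / J) - (if b = 0 then J / x else 0)"
    proof -
      have "torsion l b + inverse J * x = (x + torsion l b * J) / J"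
        using J by (simp add: field_simps)
      moreover have "1 / (inverse J * x) = J / x" by (simp add: divide_inverse)
      ultimately show ?thesis by (simp only: kron_reg_def)
    qed
    also have "kron \<tau>' ((x + torsion l b * J) / J) = J * kron \<tau> (x + torsion l b * J) + \<kappa> * (x + torsion l b * J)"
      unfolding \<tau>'_def J_def by (subst kron_mobius[OF \<gamma> \<tau>]) (simp add: \<kappa>_def)
    also have "\<kappa> * (x + torsion l b * J) = \<kappa> * x + J * (of_nat b * of_int c / of_nat l)"
    proof -
      have "\<kappa> * (torsion l b * J) = (\<kappa> * (2 * of_real pi * \<i>)) * (of_nat b / of_nat l) * J"
        by (simp only: torsion_def mult.assoc)
      also have "\<kappa> * (2 * of_real pi * \<i>) = of_int c" by (simp add: \<kappa>_def)
      finally show ?thesis by (simp add: distrib_left mult_ac)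
    qed
    finally show ?thesis
      by (cases "b = 0") (simp_all add: K_def algebra_simps)
  qed
  have an': "(\<lambda>x. kron_reg l b \<tau>' (inverse J * x)) analytic_on {0}"
  proof -
    have "(kron_reg l b \<tau>' \<circ> (\<lambda>x. inverse J * x)) analytic_on {0}"
      by (rule analytic_on_compose) (use an in \<open>auto intro!: analytic_intros\<close>)
    then show ?thesis by (simp add: o_def)
  qed
  then have "(\<lambda>x. inverse J * (kron_reg l b \<tau>' (inverse J * x) - \<kappa> * x)) analytic_on {0}"
    by (intro analytic_on_diff analytic_on_mult analytic_on_const analytic_on_ident)
  moreover have "inverse J * (kron_reg l b \<tau>' (inverse J * x) - \<kappa> * x) = K x" for x
    using J by (simp add: eq)
  ultimately show K: "K analytic_on {0}" by simp
  have "inverse J ^ (j - 1) * eis l j b \<tau>' = (deriv ^^ (j - 1)) (\<lambda>x. kron_reg l b \<tau>' (inverse J * x)) 0"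
    unfolding eis_def by (rule higher_deriv_compose_scale_at[OF an, symmetric])
  also have "\<dots> = (deriv ^^ (j - 1)) (\<lambda>x. J * K x + \<kappa> * x) 0"
    by (simp only: eq)
  also have "\<dots> = J * (deriv ^^ (j - 1)) K 0 + \<kappa> * (deriv ^^ (j - 1)) (\<lambda>x. x) 0"
    using K by (simp add: higher_deriv_add_at higher_deriv_cmult' analytic_on_mult analytic_on_const
        analytic_on_ident del: higher_deriv_linear)
  also have "(deriv ^^ (j - 1)) (\<lambda>x::complex. x) 0 = (if j = 2 then 1 else 0)"
    using j by auto
  finally have *: "inverse J ^ (j - 1) * eis l j b \<tau>' = J * (deriv ^^ (j - 1)) K 0 + (if j = 2 then \<kappa> else 0)"
    by simp
  have "eis l j b \<tau>' / J ^ j = (inverse J ^ (j - 1) * eis l j b \<tau>') / J"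
    using j by (cases j) (simp_all add: divide_inverse power_inverse mult_ac)
  also have "\<dots> = (deriv ^^ (j - 1)) K 0 + (if j = 2 then \<kappa> / J else 0)"
    unfolding * using J by (simp add: add_divide_distrib)
  finally show "eis l j b (mobius (a, b', c, d) \<tau>) / J ^ j
       = (deriv ^^ (j - 1)) K 0 + (if j = 2 then of_int c / (2 * of_real pi * \<i> * J) else 0)"
    by (simp add: \<tau>'_def \<kappa>_def)
qed

text \<open>With c = l c' and d = 1 + l d', the point b (c \<tau> + d) / l is b / l plus the lattice
  vector b d' + b c' \<tau>, and the jump - b c' of \<open>kron\<close> cancels the constant b c /
  l.\<close>

lemma eis_Gamma1:
  assumes \<gamma>: "(a, b', c, d) \<in> Gamma1 l" and \<tau>: "\<tau> \<in> upper_half_plane" and j: "j \<ge> 1" and b: "b < l"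
  defines "J \<equiv> of_int c * \<tau> + of_int d"
  shows "eis l j b (mobius (a, b', c, d) \<tau>) / J ^ j
       = eis l j b \<tau> + (if j = 2 then of_int c / (2 * of_real pi * \<i> * J) else 0)"
proof -
  have SL: "(a, b', c, d) \<in> SL2Z" using \<gamma> by (simp add: Gamma1_def)
  obtain c' where c: "c = int l * c'" using \<gamma> by (auto simp: Gamma1_def cong_0_iff)
  obtain d' where "d - 1 = int l * d'" using \<gamma> by (auto simp: Gamma1_def cong_iff_dvd_diff)
  then have d: "d = 1 + int l * d'" by simp
  have "kron \<tau> (x + torsion l b * J) + of_nat b * of_int c / of_nat l = kron \<tau> (torsion l b + x)" for x
  proof -
    have "x + torsion l b * J = (torsion l b + x)
        + 2 * of_real pi * \<i> * (of_int (int b * d') + of_int (int b * c') * \<tau>)"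
      using b by (simp add: torsion_def J_def c d field_simps)
    then show ?thesis
      using b by (simp only: kron_add_lattice[OF \<tau>]) (simp add: c)
  qed
  then have "(\<lambda>x. kron \<tau> (x + torsion l b * J) + of_nat b * of_int c / of_nat l - (if b = 0 then 1 / x else 0))
     = kron_reg l b \<tau>"
    by (simp add: kron_reg_def fun_eq_iff)
  then show ?thesis
    using eis_mobius(2)[OF SL \<tau> j b] by (simp add: J_def eis_def)
qed

section \<open>Boundedness at the cusps\<close>

lemma norm_half_coth_le:
  assumes "norm (exp x) \<le> 1 / 2"
  shows "norm (half_coth x) \<le> 3 / 2"
proof -
  have "norm (half_coth x) \<le> norm (half_coth x + 1 / 2) + norm (1 / 2 :: complex)"
    using norm_triangle_ineq4[of "half_coth x + 1 / 2" "1 / 2"] by simp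
  also have "\<dots> \<le> 2 * (1 / 2) + 1 / 2"
    using norm_half_coth_add_half_le[OF assms] assms by (intro add_mono) auto
  finally show ?thesis by simp
qed

lemma exp_minus_one_le_half: "exp (- 1 :: real) \<le> 1 / 2"
proof -
  have "2 \<le> exp (1 :: real)" using exp_ge_add_one_self[of 1] by simp
  then show ?thesis by (simp add: exp_minus divide_simps)
qed

lemma bounded_higher_deriv:
  assumes "f holomorphic_on ball 0 R" "0 < r" "r < R" "\<And>x. norm x = r \<Longrightarrow> norm (f x) \<le> B"
  shows "norm ((deriv ^^ n) f 0) \<le> fact n * B / r ^ n"
proof (rule Cauchy_inequality)
  have sub: "cball 0 r \<subseteq> ball (0 :: complex) R" using assms by auto
  show "continuous_on (cball 0 r) f"
    using holomorphic_on_subset[OF assms(1) sub] by (rule holomorphic_on_imp_continuous_on)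
  show "f holomorphic_on ball 0 r"
    using assms by (auto intro: holomorphic_on_subset)
qed (use assms in auto)

text \<open>Reduction of b c modulo l moves the argument into the strip of the tail. If the
  remainder e is positive, the real part of the argument is at most - 1 and \<open>half_coth\<close>
  is bounded; if e = 0, the argument does not depend on \<tau>. Cauchy's inequality on a fixed
  circle turns this into bounds for derivatives.\<close>

lemma eis_cusp_bounded:
  assumes \<gamma>: "(a, b', c, d) \<in> SL2Z" and b: "b < l"
  shows "\<exists>B Y. \<forall>\<tau>\<in>upper_half_plane. Im \<tau> \<ge> Y \<longrightarrow>
     norm ((deriv ^^ n) (\<lambda>x. kron \<tau> (x + torsion l b * (of_int c * \<tau> + of_int d))
        + of_nat b * of_int c / of_nat l - (if b = 0 then 1 / x else 0)) 0) \<le> B"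
proof -
  define e where "e = (int b * c) mod int l"
  define m where "m = (int b * c) div int l"
  define f where "f = int b * d"
  define z where "z = (\<lambda>\<tau>. 2 * of_real pi * \<i> * ((of_int e * \<tau> + of_int f) / of_nat l))"
  have l: "l > 0" using b by simp
  have e: "0 \<le> e" "e \<le> int l - 1" using l by (simp_all add: e_def)
  have bc: "int b * c = int l * m + e" by (simp add: e_def m_def)
  define K where "K = (\<lambda>\<tau> x. (half_coth (x + z \<tau>) - (if b = 0 then 1 / x else 0)) + kron_tail \<tau> (x + z \<tau>) + of_int e / of_nat l)"
  have K: "kron \<tau> (x + torsion l b * (of_int c * \<tau> + of_int d)) + of_nat b * of_int c / of_nat l - (if b = 0 then 1 / x else 0)
      = K \<tau> x" if "\<tau> \<in> upper_half_plane" for \<tau> x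
  proof -
    have bc': "of_nat b * of_int c = of_nat l * of_int m + (of_int e :: complex)"
      using arg_cong[OF bc, of "of_int :: int \<Rightarrow> complex"] by simp
    have "of_nat b * (of_int c * \<tau> + of_int d) = (of_nat b * of_int c) * \<tau> + of_int f"
      by (simp add: f_def algebra_simps)
    also have "\<dots> = of_nat l * (of_int m * \<tau>) + (of_int e * \<tau> + of_int f)"
      unfolding bc' by (simp add: algebra_simps)
    finally have "torsion l b * (of_int c * \<tau> + of_int d) = z \<tau> + 2 * of_real pi * \<i> * (of_int 0 + of_int m * \<tau>)"
      using l by (simp only: torsion_def z_def times_divide_eq_left mult.assoc[of "2 * of_real pi * \<i>"])
        (simp add: add_divide_distrib distrib_left)
    then have "kron \<tau> (x + torsion l b * (of_int c * \<tau> + of_int d)) = kron \<tau> (x + z \<tau>) - of_int m"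
      by (simp only: add.assoc[symmetric] kron_add_lattice[OF that])
    moreover have "of_nat b * of_int c / of_nat l = of_int m + (of_int e / of_nat l :: complex)"
      unfolding bc' using l by (simp add: add_divide_distrib)
    ultimately show ?thesis by (simp add: K_def kron_def)
  qed
  \<comment> \<open>2 r is below 2 pi / l, the radius of the disc on which the translates of
    \<open>half_coth\<close> by torsion points are holomorphic.\<close>
  define r where "r = 1 / real l"
  have r: "0 < r" "2 * r \<le> 2 * pi / l" "r \<le> 1"
    using l pi_gt3 by (auto simp: r_def field_simps)
  have strip: "exp (Re y) * norm (nome \<tau>) \<le> exp (- 1)" "exp (- Re y) * norm (nome \<tau>) \<le> exp (- 1)"
     "\<bar>Re y\<bar> < 2 * pi * Im \<tau>" "e > 0 \<Longrightarrow> Re y \<le> - 1" "norm (nome \<tau>) \<le> exp (- 1)"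
    if "Im \<tau> \<ge> real l" "norm x < 2 * r" "y = x + z \<tau>" for \<tau> x y
  proof -
    define t where "t = Im \<tau> / l"
    have t: "t \<ge> 1" using that l by (simp add: t_def)
    have im: "Im \<tau> = l * t" using l by (simp add: t_def)
    have Re: "Re y = Re x - 2 * pi * (e * t)"
      using that l by (simp add: z_def t_def)
    have x: "\<bar>Re x\<bar> < 2" using that(2) r(3) abs_Re_le_cmod[of x] by linarith
    \<comment> \<open>Since e \<le> l - 1, a margin of at least 2 pi t \<ge> 6 is left in the strip;
      it pays for a perturbation below 2 and for the decay exp (- 1).\<close>
    have pt: "2 * pi * t \<ge> 2 * 3 * 1"
      using t pi_gt3 by (intro mult_mono) auto
    have et: "0 \<le> 2 * pi * (e * t)" "2 * pi * (e * t) \<le> 2 * pi * ((real l - 1) * t)"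
    proof -
      have "real_of_int e \<le> real l - 1" using e by linarith
      then show "0 \<le> 2 * pi * (e * t)" "2 * pi * (e * t) \<le> 2 * pi * ((real l - 1) * t)"
        using e t by (auto intro!: mult_nonneg_nonneg mult_left_mono mult_right_mono)
    qed
    have lt: "2 * pi * (l * t) = 2 * pi * ((real l - 1) * t) + 2 * pi * t" by (simp add: algebra_simps)
    have lt1: "2 * pi * ((real l - 1) * t) \<ge> 0" using l t by (intro mult_nonneg_nonneg) auto
    have nn: "norm (nome \<tau>) = exp (- (2 * pi * (l * t)))" by (simp add: norm_nome im)
    show "exp (Re y) * norm (nome \<tau>) \<le> exp (- 1)" "exp (- Re y) * norm (nome \<tau>) \<le> exp (- 1)"
      "norm (nome \<tau>) \<le> exp (- 1)"
      unfolding nn Re exp_add[symmetric] exp_le_cancel_iff using x pt et lt lt1 by linarith+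
    show "\<bar>Re y\<bar> < 2 * pi * Im \<tau>"
      unfolding im Re using x pt et lt lt1 by linarith
    show "Re y \<le> - 1" if "e > 0"
    proof -
      have "2 * pi * (1 * t) \<le> 2 * pi * (e * t)"
        using that t by (intro mult_left_mono mult_right_mono) auto
      then show ?thesis unfolding Re using x pt by linarith
    qed
  qed
  have tail: "norm (kron_tail \<tau> (x + z \<tau>)) \<le> 4" if "Im \<tau> \<ge> real l" "norm x < 2 * r" for \<tau> x
  proof (rule norm_kron_tail_le)
    note s = strip[OF that refl]
    show "norm (nome \<tau>) \<le> 1 / 2" using s(5) exp_minus_one_le_half by (rule order_trans)
    show "norm (exp (x + z \<tau>) * nome \<tau>) \<le> 1 / 2"
      unfolding norm_mult norm_exp_eq_Re using s(1) exp_minus_one_le_half by (rule order_trans)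
    show "norm (exp (- (x + z \<tau>)) * nome \<tau>) \<le> 1 / 2"
      unfolding norm_mult norm_exp_eq_Re uminus_complex.sel using s(2) exp_minus_one_le_half by (rule order_trans)
  qed
  have e_le: "norm (of_int e / of_nat l :: complex) \<le> 1"
  proof -
    have "norm (of_int e / of_nat l :: complex) = \<bar>of_int e / real l\<bar>"
      by (metis norm_of_real of_real_divide of_real_of_int_eq of_real_of_nat_eq)
    also have "\<dots> \<le> 1" using e l by (simp add: field_simps)
    finally show ?thesis .
  qed
  have "\<exists>B. \<forall>\<tau>\<in>upper_half_plane. Im \<tau> \<ge> real l \<longrightarrow>
      (\<lambda>x. half_coth (x + z \<tau>) - (if b = 0 then 1 / x else 0)) holomorphic_on ball 0 (2 * r) \<and>
      (\<forall>x. norm x = r \<longrightarrow> norm (half_coth (x + z \<tau>) - (if b = 0 then 1 / x else 0)) \<le> B)"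
  proof (cases "e = 0")
    case False
    then have b0: "b \<noteq> 0" by (cases "b = 0") (simp_all add: e_def)
    have ex: "norm (exp (x + z \<tau>)) \<le> 1 / 2" if "Im \<tau> \<ge> real l" "norm x < 2 * r" for \<tau> x
    proof -
      have "Re (x + z \<tau>) \<le> - 1" using strip(4)[OF that refl] False e by simp
      then have "exp (Re (x + z \<tau>)) \<le> exp (- 1)" by (simp only: exp_le_cancel_iff)
      also note exp_minus_one_le_half
      finally show ?thesis by (simp only: norm_exp_eq_Re)
    qed
    show ?thesis
    proof (intro exI[of _ "3 / 2"] ballI impI conjI allI)
      fix \<tau> assume \<tau>: "Im \<tau> \<ge> real l"
      have "exp (x + z \<tau>) \<noteq> 1" if "norm x < 2 * r" for x
      proof
        assume "exp (x + z \<tau>) = 1"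
        with ex[OF \<tau> that] show False by (simp del: norm_exp_eq_Re)
      qed
      then have "(half_coth \<circ> (\<lambda>x. x + z \<tau>)) holomorphic_on ball 0 (2 * r)"
        by (intro holomorphic_on_compose_gen[OF _ half_coth_holomorphic] holomorphic_intros) auto
      then show "(\<lambda>x. half_coth (x + z \<tau>) - (if b = 0 then 1 / x else 0)) holomorphic_on ball 0 (2 * r)"
        using b0 by (simp add: o_def)
      show "norm (half_coth (x + z \<tau>) - (if b = 0 then 1 / x else 0)) \<le> 3 / 2" if "norm x = r" for x
        using norm_half_coth_le[OF ex[OF \<tau>, of x]] that r b0 by simp
    qed
  next
    case True
    have hol: "(\<lambda>x. half_coth (2 * of_real pi * \<i> * (of_int f / of_nat l) + x) - (if b = 0 then 1 / x else 0))
       holomorphic_on ball 0 (2 * pi / l)"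
    proof (cases "b = 0")
      case True
      then show ?thesis
        using half_coth_reg_holomorphic[OF b] by (simp add: half_coth_reg_def[abs_def] f_def)
    next
      case False
      have "int l dvd int b * c" using True by (auto simp: e_def)
      \<comment> \<open>l divides b c because e = 0. If it divided f = b d as well, then a d - b' c
        = 1 would force it to divide b.\<close>
      have "\<not> int l dvd f"
      proof
        assume "int l dvd f"
        then have "int l dvd a * f - b' * (int b * c)"
          using \<open>int l dvd int b * c\<close> by (rule dvd_diff[OF dvd_mult dvd_mult])
        also have "a * f - b' * (int b * c) = int b * (a * d - b' * c)" by (simp add: f_def algebra_simps)
        finally have "int l dvd int b" using \<gamma> by (simp add: SL2Z_def)
        then show False using b False by (simp add: nat_dvd_not_less)
      qed
      from half_coth_translate_holomorphic[OF l this] False show ?thesis by simp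
    qed
    define h where "h = (\<lambda>x. half_coth (2 * of_real pi * \<i> * (of_int f / of_nat l) + x) - (if b = 0 then 1 / x else 0))"
    have h: "half_coth (x + z \<tau>) - (if b = 0 then 1 / x else 0) = h x" for x \<tau>
      using True by (simp add: h_def z_def add.commute)
    have hol: "h holomorphic_on ball 0 (2 * r)"
      using hol r by (auto simp: h_def intro: holomorphic_on_subset)
    then have "compact (h ` cball 0 r)"
      using r by (intro compact_continuous_image holomorphic_on_imp_continuous_on)
        (auto intro: holomorphic_on_subset)
    then obtain B where "\<And>x. x \<in> cball 0 r \<Longrightarrow> norm (h x) \<le> B"
      by (meson bounded_iff compact_imp_bounded imageI)
    with hol show ?thesis unfolding h by (intro exI[of _ B]) auto
  qed
  then obtain B where B: "\<And>\<tau>. \<lbrakk>\<tau> \<in> upper_half_plane; Im \<tau> \<ge> real l\<rbrakk> \<Longrightarrow>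
      (\<lambda>x. half_coth (x + z \<tau>) - (if b = 0 then 1 / x else 0)) holomorphic_on ball 0 (2 * r)"
    "\<And>\<tau> x. \<lbrakk>\<tau> \<in> upper_half_plane; Im \<tau> \<ge> real l; norm x = r\<rbrakk> \<Longrightarrow>
      norm (half_coth (x + z \<tau>) - (if b = 0 then 1 / x else 0)) \<le> B"
    by meson
  show ?thesis
  proof (intro exI ballI impI)
    fix \<tau> assume \<tau>: "\<tau> \<in> upper_half_plane" and im: "real l \<le> Im \<tau>"
    have "(kron_tail \<tau> \<circ> (\<lambda>x. x + z \<tau>)) holomorphic_on ball 0 (2 * r)"
      by (rule holomorphic_on_compose_gen[OF _ kron_tail_holomorphic[OF \<tau>]])
         (use strip(3)[OF im _ refl] in \<open>auto intro!: holomorphic_intros simp del: plus_complex.sel\<close>)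
    then have hol: "K \<tau> holomorphic_on ball 0 (2 * r)"
      unfolding K_def by (intro holomorphic_on_add B(1) \<tau> im holomorphic_on_const) (simp add: o_def)
    have "norm (K \<tau> x) \<le> B + 4 + 1" if "norm x = r" for x
      unfolding K_def using that r im
      by (intro norm_triangle_mono B(2)[OF \<tau>] e_le tail) auto
    then have "norm ((deriv ^^ n) (K \<tau>) 0) \<le> fact n * (B + 4 + 1) / r ^ n"
      using r by (intro bounded_higher_deriv[OF hol]) auto
    then show "norm ((deriv ^^ n) (\<lambda>x. kron \<tau> (x + torsion l b * (of_int c * \<tau> + of_int d))
        + of_nat b * of_int c / of_nat l - (if b = 0 then 1 / x else 0)) 0) \<le> fact n * (B + 4 + 1) / r ^ n"
      by (simp only: K[OF \<tau>])
  qed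
qed

section \<open>The q-expansions at torsion points\<close>

definition eis_const :: "nat \<Rightarrow> nat \<Rightarrow> nat \<Rightarrow> complex" where
  "eis_const l j b = (deriv ^^ (j - 1)) (half_coth_reg l b) 0"

text \<open>The leading minus sign is that of \<open>kron_tail_sums\<close>. Differentiating - e^(-
  d x) j - 1 times gives the sign - (-1)^(j - 1) = (-1)^j.\<close>

definition eis_coeff :: "nat \<Rightarrow> nat \<Rightarrow> nat \<Rightarrow> nat \<Rightarrow> complex" where
  "eis_coeff l j b d = - (of_nat d ^ (j - 1) *
     (exp (of_nat d * torsion l b) + (-1) ^ j * exp (- (of_nat d * torsion l b))))"

text \<open>Termwise differentiation needs uniform convergence near y. On the strip of half the
  width the exponentials consume only half of the decay of q^n, and the rest beats the number of
  divisors.\<close>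

lemma kron_tail_deriv_sums:
  assumes \<tau>: "\<tau> \<in> upper_half_plane" and y: "Re y = 0"
  shows "(\<lambda>n. nome \<tau> ^ Suc n * (\<Sum>d | d dvd Suc n. of_nat d ^ i * (exp (of_nat d * y) - (-1) ^ i * exp (- (of_nat d * y)))))
            sums - (deriv ^^ i) (kron_tail \<tau>) y"
proof -
  define \<rho> where "\<rho> = 2 * pi * Im \<tau>"
  have \<rho>: "\<rho> > 0" using \<tau> by (simp add: \<rho>_def upper_half_plane_def)
  define A where "A = {x. \<bar>Re x\<bar> < \<rho> / 2}"
  define t where "t = (\<lambda>n x. nome \<tau> ^ Suc n * (\<Sum>d | d dvd Suc n. exp (of_nat d * x) - exp (- (of_nat d * x))))"
  have op: "open A" unfolding A_def by (intro open_Collect_less continuous_intros)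
  have yA: "y \<in> A" using y \<rho> by (simp add: A_def)
  have t_suminf: "- kron_tail \<tau> x = (\<Sum>n. t n x)" if "x \<in> A" for x
    unfolding t_def by (rule sums_unique, rule kron_tail_sums[OF \<tau>]) (use that \<rho> in \<open>auto simp: A_def \<rho>_def\<close>)
  have "uniform_limit A (\<lambda>N x. \<Sum>n<N. t n x) (\<lambda>x. \<Sum>n. t n x) sequentially"
  proof (rule Weierstrass_m_test)
    fix n x assume x: "x \<in> A"
    have "norm (exp (of_nat d * x) - exp (- (of_nat d * x))) \<le> 2 * exp (\<rho> / 2) ^ Suc n" if "d dvd Suc n" for d
    proof -
      have d: "d \<le> Suc n" using that by (simp add: dvd_imp_le)
      have *: "norm (exp (of_nat d * z)) \<le> exp (\<rho> / 2) ^ Suc n" if "\<bar>Re z\<bar> < \<rho> / 2" for z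
      proof -
        have "norm (exp (of_nat d * z)) = exp (Re z) ^ d" by (simp add: norm_power exp_of_nat_mult)
        also have "\<dots> \<le> exp (\<rho> / 2) ^ d" using that by (intro power_mono) auto
        also have "\<dots> \<le> exp (\<rho> / 2) ^ Suc n" using d \<rho> by (intro power_increasing) auto
        finally show ?thesis .
      qed
      have "norm (exp (of_nat d * x) - exp (of_nat d * (- x))) \<le> exp (\<rho> / 2) ^ Suc n + exp (\<rho> / 2) ^ Suc n"
        by (rule order_trans[OF norm_triangle_ineq4], intro add_mono *) (use x in \<open>auto simp: A_def\<close>)
      then show ?thesis by simp
    qed
    then have "norm (\<Sum>d | d dvd Suc n. exp (of_nat d * x) - exp (- (of_nat d * x)))
        \<le> (\<Sum>d | d dvd Suc n. 2 * exp (\<rho> / 2) ^ Suc n)"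
      by (intro sum_norm_le) auto
    also have "\<dots> \<le> real (Suc n) * (2 * exp (\<rho> / 2) ^ Suc n)"
    proof -
      have "card {d. d dvd Suc n} \<le> card {1..Suc n}"
        by (intro card_mono) (auto dest: dvd_imp_le simp: Suc_le_eq intro!: Nat.gr0I)
      then have "real (card {d. d dvd Suc n}) \<le> real (Suc n)" by simp
      then show ?thesis by (simp only: sum_constant) (intro mult_right_mono, auto)
    qed
    finally have "norm (t n x) \<le> norm (nome \<tau>) ^ Suc n * (real (Suc n) * (2 * exp (\<rho> / 2) ^ Suc n))"
      unfolding t_def norm_mult norm_power by (intro mult_left_mono) auto
    also have "norm (nome \<tau>) = exp (- (\<rho> / 2)) * exp (- (\<rho> / 2))"
      by (simp add: norm_nome \<rho>_def flip: exp_add)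
    also have "(exp (- (\<rho> / 2)) * exp (- (\<rho> / 2))) ^ Suc n * (real (Suc n) * (2 * exp (\<rho> / 2) ^ Suc n))
        = 2 * (real (Suc n) * exp (- (\<rho> / 2)) ^ Suc n) * (exp (- (\<rho> / 2)) * exp (\<rho> / 2)) ^ Suc n"
      unfolding power_mult_distrib by (simp only: mult_ac)
    finally show "norm (t n x) \<le> 2 * (real (Suc n) ^ 1 * exp (- (\<rho> / 2)) ^ Suc n)"
      by (simp flip: exp_add)
  next
    show "summable (\<lambda>n. 2 * (real (Suc n) ^ 1 * exp (- (\<rho> / 2)) ^ Suc n))"
      using summable_power_geometric[of "exp (- (\<rho> / 2))" 1] \<rho>
      by (intro summable_mult, subst summable_Suc_iff) auto
  qed
  then have "uniform_limit A (\<lambda>N x. \<Sum>n<N. t n x) (\<lambda>x. - kron_tail \<tau> x) sequentially"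
    by (rule uniform_limit_cong'[THEN iffD1, rotated -1]) (auto simp: t_suminf)
  then have "(\<lambda>N. (deriv ^^ i) (\<lambda>x. \<Sum>n<N. t n x) y) \<longlonglongrightarrow> (deriv ^^ i) (\<lambda>x. - kron_tail \<tau> x) y"
    by (rule higher_deriv_complex_uniform_limit[OF _ _ _ op yA])
       (auto simp: t_def intro!: holomorphic_intros always_eventually)
  moreover have "(deriv ^^ i) (\<lambda>x. - kron_tail \<tau> x) y = - (deriv ^^ i) (kron_tail \<tau>) y"
    by (rule higher_deriv_uminus_at, rule kron_tail_analytic[OF \<tau>]) (use y \<rho> in \<open>auto simp: \<rho>_def\<close>)
  moreover have "(deriv ^^ i) (\<lambda>x. \<Sum>n<N. t n x) y = (\<Sum>n<N. nome \<tau> ^ Suc n * (\<Sum>d | d dvd Suc n.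
      of_nat d ^ i * (exp (of_nat d * y) - (-1) ^ i * exp (- (of_nat d * y)))))" for N
  proof -
    have E: "(\<lambda>x. exp (c * x)) analytic_on {y}" for c by (intro analytic_intros)
    have d: "(deriv ^^ i) (\<lambda>x. exp (of_nat d * x) - exp (- (of_nat d * x))) y
        = of_nat d ^ i * (exp (of_nat d * y) - (-1) ^ i * exp (- (of_nat d * y)))" for d
      using higher_deriv_diff_at[OF E[of "of_nat d"] E[of "- of_nat d"], of i]
      unfolding higher_deriv_exp_scale
      by (simp add: power_minus[of "of_nat d :: complex"] right_diff_distrib mult.left_commute)
    have "(deriv ^^ i) (t n) y = nome \<tau> ^ Suc n * (\<Sum>d | d dvd Suc n.
      of_nat d ^ i * (exp (of_nat d * y) - (-1) ^ i * exp (- (of_nat d * y))))" for n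
      unfolding t_def
      by (subst higher_deriv_cmult', intro analytic_intros, subst higher_deriv_sum_at)
         (auto simp: d intro!: analytic_intros)
    moreover have "(deriv ^^ i) (\<lambda>x. \<Sum>n<N. t n x) y = (\<Sum>n<N. (deriv ^^ i) (t n) y)"
      unfolding t_def by (intro higher_deriv_sum_at) (intro analytic_intros)
    ultimately show ?thesis by (simp only:)
  qed
  ultimately show ?thesis by (simp add: sums_def)
qed

definition eis_fps :: "nat \<Rightarrow> nat \<Rightarrow> nat \<Rightarrow> complex fps" where
  "eis_fps l j b = divisor_sum_fps (eis_const l j b) (eis_coeff l j b)"

lemma eis_fps_conv_radius: "fps_conv_radius (eis_fps l j b) \<ge> 1"
  unfolding eis_fps_def
proof (rule divisor_sum_fps_conv_radius)
  fix d
  have "norm (exp (of_nat d * torsion l b) + (-1) ^ j * exp (- (of_nat d * torsion l b))) \<le> 1 + 1"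
    by (rule order_trans[OF norm_triangle_ineq]) (simp add: norm_mult norm_power)
  then show "norm (eis_coeff l j b d) \<le> 2 * real d ^ (j - 1)"
    by (simp add: eis_coeff_def norm_mult norm_power mult.commute[of 2] mult_left_mono)
qed

lemma eis_eq_from_q:
  assumes b: "b < l" and j: "j \<ge> 1" and \<tau>: "\<tau> \<in> upper_half_plane"
  shows "eis l j b \<tau> = from_q (eis_fps l j b) \<tau>"
proof -
  define y where "y = torsion l b"
  have "eis l j b \<tau> = eis_const l j b + (deriv ^^ (j - 1)) (\<lambda>x. kron_tail \<tau> (torsion l b + x)) 0"
    unfolding eis_def eis_const_def kron_reg_eq[abs_def] using b \<tau>
    by (intro higher_deriv_add_at half_coth_reg_analytic analytic_on_translate kron_tail_torsion_analytic)
  also have "(deriv ^^ (j - 1)) (\<lambda>x. kron_tail \<tau> (torsion l b + x)) 0 = (deriv ^^ (j - 1)) (kron_tail \<tau>) y"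
    unfolding y_def using \<tau> by (intro higher_deriv_translate_at kron_tail_torsion_analytic)
  also have "(deriv ^^ (j - 1)) (kron_tail \<tau>) y = (\<Sum>n. - (nome \<tau> ^ Suc n * (\<Sum>d | d dvd Suc n.
      of_nat d ^ (j - 1) * (exp (of_nat d * y) - (-1) ^ (j - 1) * exp (- (of_nat d * y))))))"
    using sums_minus[OF kron_tail_deriv_sums[OF \<tau>, of y "j - 1"]] by (simp add: y_def sums_iff)
  also have "\<dots> = (\<Sum>n. fps_nth (eis_fps l j b) (Suc n) * nome \<tau> ^ Suc n)"
    using j by (cases j) (simp_all add: eis_fps_def eis_coeff_def y_def sum_negf mult.commute[of "nome \<tau> ^ _"] del: power_Suc, simp)
  also have "eis_const l j b + \<dots> = q_series (fps_nth (eis_fps l j b) 0) (fps_nth (eis_fps l j b)) \<tau>"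
    using \<tau> by (simp add: q_series_def eis_fps_def nome_def)
  finally show ?thesis
    by (simp only: q_series_eq_from_q[OF eis_fps_conv_radius])
qed

lemma from_q_sum:
  assumes "\<And>i. i \<in> I \<Longrightarrow> fps_conv_radius (F i) \<ge> 1"
  shows "fps_conv_radius (\<Sum>i\<in>I. F i) \<ge> 1 \<and> from_q (\<Sum>i\<in>I. F i) = (\<Sum>i\<in>I. from_q (F i))"
  using assms
proof (induction I rule: infinite_finite_induct)
  case (insert i I)
  then have "fps_conv_radius (F i) \<ge> 1" "fps_conv_radius (\<Sum>i\<in>I. F i) \<ge> 1" by auto
  moreover from this have "fps_conv_radius (F i + (\<Sum>i\<in>I. F i)) \<ge> 1"
    using fps_conv_radius_add[of "F i" "\<Sum>i\<in>I. F i"] by (metis min.bounded_iff order_trans)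
  ultimately show ?case using insert by (simp add: from_q_add)
qed (auto simp: from_q_def fun_eq_iff)

lemma fps_conv_radius_cmult_ge:
  "fps_conv_radius F \<ge> 1 \<Longrightarrow> fps_conv_radius (fps_const (c::complex) * F) \<ge> 1"
  by (cases "c = 0") (simp_all add: fps_conv_radius_cmult_left)

lemma sum_fun_apply: "(\<Sum>i\<in>I. f i) x = (\<Sum>i\<in>I. f i x :: complex)"
  by (induction I rule: infinite_finite_induct) auto

text \<open>The anomaly of weight two does not depend on b, so it disappears from combinations whose
  coefficients sum to 0.\<close>

theorem eis_combination_modular:
  assumes j: "j \<ge> 1" and c: "j = 2 \<Longrightarrow> (\<Sum>b<l. c b) = 0"
  shows "from_q (\<Sum>b<l. fps_const (c b) * eis_fps l j b) \<in> modular_forms l j"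
proof -
  define f where "f = from_q (\<Sum>b<l. fps_const (c b) * eis_fps l j b)"
  note r = fps_conv_radius_cmult_ge[OF eis_fps_conv_radius]
  have f: "f \<tau> = (\<Sum>b<l. c b * eis l j b \<tau>)" if "\<tau> \<in> upper_half_plane" for \<tau>
    using j that
    by (simp add: f_def conjunct2[OF from_q_sum[OF r]] from_q_cmult eis_fps_conv_radius cscale_def eis_eq_from_q sum_fun_apply)
  have hol: "f holomorphic_on upper_half_plane"
    unfolding f_def by (rule from_q_holomorphic[OF conjunct1[OF from_q_sum[OF r]]])
  have slash: "slash j f (a, b', c', d) \<tau> = (\<Sum>b<l. c b * (eis l j b (mobius (a, b', c', d) \<tau>) / (of_int c' * \<tau> + of_int d) ^ j))"
    if "(a, b', c', d) \<in> SL2Z" "\<tau> \<in> upper_half_plane" for a b' c' d \<tau>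
  proof -
    have "slash j f (a, b', c', d) \<tau> = f (mobius (a, b', c', d) \<tau>) / (of_int c' * \<tau> + of_int d) ^ j"
      by (simp add: mobius_def)
    then show ?thesis
      by (simp only: f[OF mobius_in_upper_half_plane[OF that]] sum_divide_distrib times_divide_eq_right)
  qed
  have anomaly: "(\<Sum>b<l. c b * (E b + (if j = 2 then A else 0))) = (\<Sum>b<l. c b * E b)" for E and A :: complex
    using c by (cases "j = 2") (simp_all add: distrib_left sum.distrib flip: sum_distrib_right)
  have "slash j f \<gamma> \<tau> = f \<tau>" if \<gamma>: "\<gamma> \<in> Gamma1 l" and \<tau>: "\<tau> \<in> upper_half_plane" for \<gamma> \<tau>
  proof (cases \<gamma>)
    case (fields a b' c' d)
    then show ?thesis
      using \<gamma> \<tau> j by (simp add: slash Gamma1_def f eis_Gamma1 anomaly del: slash.simps)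
  qed
  moreover have "\<exists>B Y. \<forall>\<tau>\<in>upper_half_plane. Im \<tau> \<ge> Y \<longrightarrow> norm (slash j f \<gamma> \<tau>) \<le> B" if \<gamma>: "\<gamma> \<in> SL2Z" for \<gamma>
  proof (cases \<gamma>)
    case (fields a b' c' d)
    define K where "K = (\<lambda>b \<tau>. (deriv ^^ (j - 1)) (\<lambda>x. kron \<tau> (x + torsion l b * (of_int c' * \<tau> + of_int d))
        + of_nat b * of_int c' / of_nat l - (if b = 0 then 1 / x else 0)) 0)"
    have "\<forall>b\<in>{..<l}. \<exists>B Y. \<forall>\<tau>\<in>upper_half_plane. Im \<tau> \<ge> Y \<longrightarrow> norm (K b \<tau>) \<le> B"
      unfolding K_def using eis_cusp_bounded \<gamma> fields by blast
    then obtain B Y where BY: "\<And>b \<tau>. \<lbrakk>b < l; \<tau> \<in> upper_half_plane; Im \<tau> \<ge> Y b\<rbrakk> \<Longrightarrow> norm (K b \<tau>) \<le> B b"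
      by (metis lessThan_iff)
    show ?thesis
    proof (intro exI ballI impI)
      fix \<tau> assume \<tau>: "\<tau> \<in> upper_half_plane" and im: "(\<Sum>b<l. \<bar>Y b\<bar>) \<le> Im \<tau>"
      have "slash j f \<gamma> \<tau> = (\<Sum>b<l. c b * K b \<tau>)"
        using \<gamma> \<tau> j fields eis_mobius(2) by (simp add: slash anomaly K_def del: slash.simps)
      also have "norm \<dots> \<le> (\<Sum>b<l. norm (c b) * B b)"
      proof (rule sum_norm_le)
        fix b assume b: "b \<in> {..<l}"
        have "Y b \<le> \<bar>Y b\<bar>" by simp
        also have "\<dots> \<le> (\<Sum>b<l. \<bar>Y b\<bar>)" using b by (intro member_le_sum) auto
        finally show "norm (c b * K b \<tau>) \<le> norm (c b) * B b"
          unfolding norm_mult using b im by (intro mult_left_mono BY[OF _ \<tau>]) auto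
      qed
      finally show "norm (slash j f \<gamma> \<tau>) \<le> (\<Sum>b<l. norm (c b) * B b)" .
    qed
  qed
  ultimately show ?thesis
    using hol unfolding f_def[symmetric] modular_forms_def by (auto simp: f_def from_q_def)
qed

section \<open>Eisenstein series of a residue class\<close>

lemma exp_torsion_eq_1_iff:
  assumes "l > 0"
  shows "exp (of_int a * torsion l 1) = 1 \<longleftrightarrow> int l dvd a"
proof
  assume "int l dvd a"
  then obtain m where "a = int l * m" by blast
  then have "of_int a * torsion l 1 = 2 * of_real pi * \<i> * of_int m"
    using assms by (simp add: torsion_def)
  then show "exp (of_int a * torsion l 1) = 1"
    using exp_add_period[of 0 m] by simp
next
  assume *: "exp (of_int a * torsion l 1) = 1"
  show "int l dvd a"
  proof (rule ccontr)
    assume "\<not> int l dvd a"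
    from exp_torsion_ne_1[OF assms this, of 0] * assms show False
      by (simp add: torsion_def mult_ac)
  qed
qed

lemma torsion_mult: "torsion l b = of_nat b * torsion l 1"
  by (simp add: torsion_def)

lemma sum_exp_torsion:
  assumes "l > 0"
  shows "(\<Sum>b<l. exp (of_int a * torsion l b)) = (if int l dvd a then of_nat l else 0)"
proof -
  define z where "z = exp (of_int a * torsion l 1)"
  have "exp (of_int a * torsion l b) = z ^ b" for b
  proof -
    have "of_int a * torsion l b = of_nat b * (of_int a * torsion l 1)"
      by (simp add: torsion_mult[of l b])
    then show ?thesis by (simp only: z_def exp_of_nat_mult)
  qed
  then have *: "(\<Sum>b<l. exp (of_int a * torsion l b)) = (\<Sum>b<l. z ^ b)" by simp
  show ?thesis
  proof (cases "int l dvd a")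
    case True
    then have "z = 1" using exp_torsion_eq_1_iff[OF assms] by (simp add: z_def)
    then show ?thesis using True by (simp add: *)
  next
    case False
    then have "z \<noteq> 1" using exp_torsion_eq_1_iff[OF assms] by (simp add: z_def)
    moreover have "z ^ l = exp (of_int (a * int l) * torsion l 1)"
      by (simp add: z_def mult_ac flip: exp_of_nat_mult)
    then have "z ^ l = 1" using exp_torsion_eq_1_iff[OF assms, of "a * int l"] by simp
    ultimately show ?thesis using False by (simp add: * geometric_sum)
  qed
qed

text \<open>An inverse finite Fourier transform in b, which isolates the residue class a; its minus
  sign cancels the one in \<open>eis_coeff\<close>.\<close>

definition stilde_fps :: "nat \<Rightarrow> nat \<Rightarrow> int \<Rightarrow> complex fps" where
  "stilde_fps l j a = (\<Sum>b<l. fps_const (- exp (of_int (- a) * torsion l b) / of_nat l) * eis_fps l j b)"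

lemma stilde_fps_conv_radius: "fps_conv_radius (stilde_fps l j a) \<ge> 1"
  unfolding stilde_fps_def
  by (rule conjunct1[OF from_q_sum]) (rule fps_conv_radius_cmult_ge[OF eis_fps_conv_radius])

lemma stilde_fps_nth:
  assumes l: "l > 0" and n: "n > 0"
  shows "fps_nth (stilde_fps l j a) n = eisenstein_coeff l j a n"
proof -
  have "(\<Sum>b<l. - exp (of_int (- a) * torsion l b) / of_nat l * eis_coeff l j b d)
     = of_nat d ^ (j - 1) * (of_bool ([int d = a] (mod int l)) + (-1) ^ j * of_bool ([int d = - a] (mod int l)))" for d
  proof -
    have e: "exp (of_int (- a) * torsion l b) * (exp (of_nat d * torsion l b) + (-1) ^ j * exp (- (of_nat d * torsion l b)))
        = exp (of_int (int d - a) * torsion l b) + (-1) ^ j * exp (of_int (- (int d + a)) * torsion l b)" for b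
      by (simp add: algebra_simps flip: exp_add)
    have "(\<Sum>b<l. - exp (of_int (- a) * torsion l b) / of_nat l * eis_coeff l j b d)
       = (of_nat d ^ (j - 1) / of_nat l) * (\<Sum>b<l. exp (of_int (- a) * torsion l b) * (exp (of_nat d * torsion l b) + (-1) ^ j * exp (- (of_nat d * torsion l b))))"
      unfolding sum_distrib_left by (rule sum.cong) (simp_all add: eis_coeff_def)
    also have "\<dots> = (of_nat d ^ (j - 1) / of_nat l) *
        ((if int l dvd int d - a then of_nat l else 0) + (-1) ^ j * (if int l dvd - (int d + a) then of_nat l else 0))"
      unfolding e sum.distrib sum_distrib_left[symmetric] sum_exp_torsion[OF l] ..
    also have "\<dots> = of_nat d ^ (j - 1) * (of_bool ([int d = a] (mod int l)) + (-1) ^ j * of_bool ([int d = - a] (mod int l)))"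
      unfolding cong_iff_dvd_diff dvd_minus_iff diff_minus_eq_add using l by (simp add: field_simps)
    finally show ?thesis .
  qed
  then show ?thesis
    using n by (simp add: stilde_fps_def eis_fps_def fps_sum_nth sum_distrib_left eisenstein_coeff_def
        sum.swap[of _ "{d. d dvd n}"] del: of_int_minus)
qed

lemma q_series_cong:
  assumes "C = C'" "\<And>n. n > 0 \<Longrightarrow> f n = g n"
  shows "q_series C f = q_series C' g"
  by (simp add: q_series_def assms cong: if_cong)

lemma q_series_stilde_fps:
  assumes "l > 0"
  shows "q_series (fps_nth (stilde_fps l j a) 0) (eisenstein_coeff l j a) = from_q (stilde_fps l j a)"
  unfolding q_series_eq_from_q[OF stilde_fps_conv_radius, symmetric]
  by (rule q_series_cong) (simp_all add: stilde_fps_nth[OF assms])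

text \<open>The Fourier weights form a character sum, which vanishes unless l divides a; so weight
  two fails for the zero class only.\<close>

lemma from_q_stilde_fps_modular:
  assumes l: "l > 0" and j: "j \<ge> 1" and "\<not> (j = 2 \<and> int l dvd a)"
  shows "from_q (stilde_fps l j a) \<in> modular_forms l j"
  unfolding stilde_fps_def
proof (rule eis_combination_modular[OF j])
  assume "j = 2"
  then have "\<not> int l dvd - a" using assms by simp
  then show "(\<Sum>b<l. - exp (of_int (- a) * torsion l b) / of_nat l) = 0"
    using sum_exp_torsion[OF l, of "- a"] by (simp only: sum_negf sum_divide_distrib[symmetric] if_False) simp
qed

text \<open>A constant obeying the law of weight j satisfies C = J^j C for J = l i + 1, whose
  modulus exceeds 1. This is the uniqueness behind the definite description in
  \<open>eisenstein_const\<close>.\<close>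

lemma modular_forms_diff_constant:
  assumes f: "f \<in> modular_forms l j" and g: "g \<in> modular_forms l j" and l: "l > 0" and j: "j \<ge> 1"
      and C: "\<And>\<tau>. \<tau> \<in> upper_half_plane \<Longrightarrow> f \<tau> - g \<tau> = C"
  shows "C = 0"
proof -
  have \<gamma>: "(1, 0, int l, 1) \<in> Gamma1 l" by (simp add: Gamma1_def SL2Z_def cong_0_iff)
  then have SL: "(1, 0, int l, 1) \<in> SL2Z" by (simp add: Gamma1_def)
  have i: "\<i> \<in> upper_half_plane" by (simp add: upper_half_plane_def)
  define J where "J = of_nat l * \<i> + 1"
  have J: "norm J > 1"
  proof -
    have "(norm J)\<^sup>2 = (real l)\<^sup>2 + 1" by (simp add: J_def cmod_power2)
    then have "1 < (norm J)\<^sup>2" using l by simp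
    then show ?thesis using power_le_one[of "norm J" 2] by fastforce
  qed
  then have J0: "J \<noteq> 0" by auto
  have *: "h (mobius (1, 0, int l, 1) \<i>) = J ^ j * h \<i>" if "h \<in> modular_forms l j" for h
  proof -
    have "slash j h (1, 0, int l, 1) \<i> = h \<i>"
      using that \<gamma> i by (auto simp: modular_forms_def simp del: slash.simps)
    then show ?thesis using J0 by (simp add: mobius_def J_def field_simps)
  qed
  have "C = J ^ j * C"
    using C[OF i] C[OF mobius_in_upper_half_plane[OF SL i]] by (simp add: *[OF f] *[OF g] flip: right_diff_distrib)
  moreover have "J ^ j \<noteq> 1"
  proof
    assume "J ^ j = 1"
    then have "norm J ^ j = 1" by (metis norm_one norm_power)
    moreover have "1 < norm J ^ j" using J j by (intro one_less_power) auto
    ultimately show False by simp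
  qed
  ultimately show ?thesis by (metis mult_cancel_right1 mult.commute)
qed

lemma q_series_diff_const:
  assumes "\<tau> \<in> upper_half_plane"
  shows "q_series C f \<tau> - q_series C' f \<tau> = C - C'"
  using assms by (simp add: q_series_def)

lemma eisenstein_const_eq_aux:
  assumes l: "l > 0" and j: "j \<ge> 1" and ex: "\<not> (j = 2 \<and> int l dvd a)"
  shows "eisenstein_const l j a = fps_nth (stilde_fps l j a) 0"
proof -
  have m: "q_series (fps_nth (stilde_fps l j a) 0) (eisenstein_coeff l j a) \<in> modular_forms l j"
    using from_q_stilde_fps_modular[OF assms] by (simp add: q_series_stilde_fps[OF l])
  have "(THE C. q_series C (eisenstein_coeff l j a) \<in> modular_forms l j) = fps_nth (stilde_fps l j a) 0"
  proof (rule the_equality)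
    show "q_series (fps_nth (stilde_fps l j a) 0) (eisenstein_coeff l j a) \<in> modular_forms l j" by (rule m)
  next
    fix C assume "q_series C (eisenstein_coeff l j a) \<in> modular_forms l j"
    from modular_forms_diff_constant[OF this m l j q_series_diff_const]
    show "C = fps_nth (stilde_fps l j a) 0" by simp
  qed
  then show ?thesis using ex by (auto simp: eisenstein_const_def cong_0_iff)
qed

lemma eisenstein_coeff_minus: "eisenstein_coeff l j (- a) n = (-1) ^ j * eisenstein_coeff l j a n"
  unfolding eisenstein_coeff_def sum_distrib_left
  by (rule sum.cong) (auto simp: algebra_simps)

lemma stilde_fps_cong:
  assumes l: "l > 0" and "[a = a'] (mod int l)"
  shows "stilde_fps l j a = stilde_fps l j a'"
proof -
  obtain m where m: "a = a' + int l * m"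
    using assms(2) by (auto simp: cong_iff_dvd_diff elim!: dvdE) (metis add.commute diff_add_cancel)
  have "exp (of_int (- a) * torsion l b) = exp (of_int (- a') * torsion l b)" for b
  proof -
    have "of_int (- a) * torsion l b = of_int (- a') * torsion l b + 2 * of_real pi * \<i> * of_int (- (m * int b))"
      using l by (simp add: m torsion_def field_simps)
    then show ?thesis by (simp only: exp_add_period)
  qed
  then show ?thesis by (simp add: stilde_fps_def del: of_int_minus)
qed

lemma modular_forms_cscale:
  assumes "f \<in> modular_forms l j"
  shows "cscale c f \<in> modular_forms l j"
proof -
  have slash: "slash j (cscale c f) \<gamma> \<tau> = c * slash j f \<gamma> \<tau>" for \<gamma> \<tau>
    by (cases \<gamma>) (simp add: cscale_def)
  have "\<exists>B Y. \<forall>\<tau>\<in>upper_half_plane. Im \<tau> \<ge> Y \<longrightarrow> norm (slash j (cscale c f) \<gamma> \<tau>) \<le> B" if "\<gamma> \<in> SL2Z" for \<gamma>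
  proof -
    obtain B Y where "\<forall>\<tau>\<in>upper_half_plane. Im \<tau> \<ge> Y \<longrightarrow> norm (slash j f \<gamma> \<tau>) \<le> B"
      using \<open>\<gamma> \<in> SL2Z\<close> assms unfolding modular_forms_def by blast
    then have "\<forall>\<tau>\<in>upper_half_plane. Im \<tau> \<ge> Y \<longrightarrow> norm (slash j (cscale c f) \<gamma> \<tau>) \<le> norm c * B"
      by (simp add: slash norm_mult mult_left_mono)
    then show ?thesis by blast
  qed
  moreover have "cscale c f holomorphic_on upper_half_plane"
    using assms unfolding cscale_def modular_forms_def by (auto intro!: holomorphic_intros)
  ultimately show ?thesis
    using assms by (auto simp: modular_forms_def slash) (simp_all add: cscale_def)
qed

lemma from_q_diff_const:
  assumes "fps_conv_radius F \<ge> 1" "fps_conv_radius G \<ge> 1" "\<And>n. n > 0 \<Longrightarrow> fps_nth F n = fps_nth G n"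
    and "\<tau> \<in> upper_half_plane"
  shows "from_q F \<tau> - from_q G \<tau> = fps_nth F 0 - fps_nth G 0"
proof -
  have "q_series (fps_nth G 0) (fps_nth G) = q_series (fps_nth G 0) (fps_nth F)"
    by (rule q_series_cong) (use assms in auto)
  then show ?thesis
    using q_series_diff_const[OF assms(4)] by (metis q_series_eq_from_q assms(1,2))
qed

text \<open>Parity is visible on the coefficients with n > 0. The constant terms follow by
  uniqueness, both sides being modular of weight j; in the remaining case - a and a are the same
  class.\<close>

lemma stilde_fps_minus:
  assumes l: "l > 0" and j: "j \<ge> 1"
  shows "stilde_fps l j (- a) = fps_const ((-1) ^ j) * stilde_fps l j a"
proof (cases "j = 2 \<and> int l dvd a")
  case True
  then have "[- a = a] (mod int l)" by (simp add: cong_iff_dvd_diff)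
  from stilde_fps_cong[OF l this] True show ?thesis by simp
next
  case False
  have mod: "from_q (stilde_fps l j a) \<in> modular_forms l j" "from_q (stilde_fps l j (- a)) \<in> modular_forms l j"
    using False by (auto intro!: from_q_stilde_fps_modular l j)
  define G where "G = fps_const ((-1) ^ j) * stilde_fps l j a"
  have G: "fps_conv_radius G \<ge> 1"
    unfolding G_def by (intro fps_conv_radius_cmult_ge stilde_fps_conv_radius)
  have Gmod: "from_q G \<in> modular_forms l j"
    unfolding G_def from_q_cmult[OF stilde_fps_conv_radius] by (intro modular_forms_cscale mod)
  have nth: "fps_nth (stilde_fps l j (- a)) n = fps_nth G n" if "n > 0" for n
    using that by (simp add: G_def stilde_fps_nth[OF l] eisenstein_coeff_minus)
  have "fps_nth (stilde_fps l j (- a)) 0 - fps_nth G 0 = 0"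
    by (rule modular_forms_diff_constant[OF mod(2) Gmod l j])
       (rule from_q_diff_const[OF stilde_fps_conv_radius G nth])
  then have "fps_nth (stilde_fps l j (- a)) n = fps_nth G n" for n
    using nth[of n] by (cases "n = 0") auto
  then show ?thesis by (simp add: fps_eq_iff G_def)
qed

section \<open>Constant terms\<close>

text \<open>Formally the sum of d^s over the integers d \<ge> 0 in the class u, with 0 counted with
  weight 1 / 2. For s = 0 and 0 < u < l its value is 1 / 2 - u / l.\<close>

definition moment :: "nat \<Rightarrow> int \<Rightarrow> nat \<Rightarrow> complex" where
  "moment l u s = fps_nth (stilde_fps l (Suc s) u) 0"

lemma moment_minus: "l > 0 \<Longrightarrow> moment l (- u) s = - ((-1) ^ s * moment l u s)"
  by (simp add: moment_def stilde_fps_minus)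

definition const_gen :: "nat \<Rightarrow> int \<Rightarrow> complex \<Rightarrow> complex" where
  "const_gen l u x = (\<Sum>b<l. - exp (of_int (- u) * torsion l b) / of_nat l * half_coth_reg l b x)"

lemma const_gen_analytic: "const_gen l u analytic_on {0}"
  unfolding const_gen_def[abs_def]
  by (intro analytic_on_sum analytic_on_mult analytic_on_const) (simp add: half_coth_reg_analytic)

lemma moment_eq_deriv: "moment l u s = (deriv ^^ s) (const_gen l u) 0"
proof -
  define c where "c = (\<lambda>b. - exp (of_int (- u) * torsion l b) / of_nat l)"
  have "(deriv ^^ s) (\<lambda>x. \<Sum>b<l. c b * half_coth_reg l b x) 0 = (\<Sum>b<l. (deriv ^^ s) (\<lambda>x. c b * half_coth_reg l b x) 0)"
    by (intro higher_deriv_sum_at analytic_on_mult analytic_on_const) (simp add: half_coth_reg_analytic)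
  also have "\<dots> = (\<Sum>b<l. c b * (deriv ^^ s) (half_coth_reg l b) 0)"
    by (intro sum.cong refl higher_deriv_cmult') (simp add: half_coth_reg_analytic)
  also have "\<dots> = moment l u s"
    by (simp add: moment_def stilde_fps_def fps_sum_nth eis_fps_def eis_const_def c_def)
  finally show ?thesis by (simp add: const_gen_def[abs_def] c_def)
qed

text \<open>Formally \<open>const_gen l u\<close> is \<open>\<Sum> e\<^bsup>dx\<^esup>\<close> over positive \<open>d \<equiv> u\<close>, so that
  multiplication by \<open>e\<^sup>x\<close> shifts \<open>u\<close> up to boundary terms.\<close>

lemma const_gen_step:
  assumes l: "l > 0" and x: "norm x < 2 * pi / l"
  shows "x * (const_gen l (u + 1) x - exp x * const_gen l u x)
     = x * (of_bool (int l dvd u + 1) / 2 + of_bool (int l dvd u) / 2 * exp x) + (1 - exp x) / of_nat l"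
proof (cases "x = 0")
  case False
  have ne: "exp (torsion l b + x) \<noteq> 1" if "b < l" for b
  proof (cases "b = 0")
    case True
    have "2 * pi / l \<le> 2 * pi / 1" using l by (intro divide_left_mono) auto
    then show ?thesis using exp_eq_1_small[of x] False True x by auto
  next
    case False
    then have "\<not> int l dvd int b" using that by (simp add: nat_dvd_not_less)
    from exp_torsion_ne_1[OF l this x] show ?thesis by (simp add: torsion_def)
  qed
  \<comment> \<open>The factor 1 - exp y cancels the pole. It arises because the Fourier weights of
    u and u + 1 differ by the factor exp (torsion l b).\<close>
  have T: "half_coth y * (1 - exp y) = - (exp y + 1) / 2" if "exp y \<noteq> 1" for y
    using that by (simp add: half_coth_def field_simps)
  define e where "e = (\<lambda>u b. exp (of_int (- u) * torsion l b))"
  have e1: "e u b = e (u + 1) b * exp (torsion l b)" for b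
    by (simp add: e_def algebra_simps flip: exp_add)
  have se: "(\<Sum>b<l. e v b) = of_nat l * of_bool (int l dvd v)" for v
    unfolding e_def sum_exp_torsion[OF l] by simp
  have cg: "const_gen l v x = (\<Sum>b<l. - e v b / of_nat l * half_coth_reg l b x)" for v
    by (simp only: const_gen_def e_def)
  have e0: "e u 0 = 1" for u by (simp add: e_def)
  \<comment> \<open>Only b = 0 carries a subtracted pole. It leaves 1 - exp x, which is - x times
    the integral of exp (t x) over [0, 1].\<close>
  have summand: "x * (e (u + 1) b * half_coth_reg l b x - exp x * (e u b * half_coth_reg l b x))
      = - (x / 2) * (e u b * exp x + e (u + 1) b) - (if b = 0 then 1 - exp x else 0)" if "b < l" for b
  proof -
    have *: "e (u + 1) b * half_coth (torsion l b + x) - exp x * (e u b * half_coth (torsion l b + x))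
        = - (e u b * exp x + e (u + 1) b) / 2"
    proof -
      have "e (u + 1) b * half_coth (torsion l b + x) - exp x * (e u b * half_coth (torsion l b + x))
        = e (u + 1) b * (half_coth (torsion l b + x) * (1 - exp (torsion l b + x)))"
        by (simp add: e1 exp_add algebra_simps)
      also have "\<dots> = - (e u b * exp x + e (u + 1) b) / 2"
        unfolding T[OF ne[OF that]] by (simp add: e1 exp_add algebra_simps)
      finally show ?thesis .
    qed
    have "x * (e (u + 1) b * half_coth_reg l b x - exp x * (e u b * half_coth_reg l b x))
      = x * (e (u + 1) b * half_coth (torsion l b + x) - exp x * (e u b * half_coth (torsion l b + x)))
        - (if b = 0 then 1 - exp x else 0)"
      using False by (auto simp: half_coth_reg_def e0 algebra_simps)
    also have "\<dots> = - (x / 2) * (e u b * exp x + e (u + 1) b) - (if b = 0 then 1 - exp x else 0)"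
      unfolding * by (simp add: field_simps)
    finally show ?thesis .
  qed
  have "x * (const_gen l (u + 1) x - exp x * const_gen l u x)
     = - (1 / of_nat l) * (\<Sum>b<l. x * (e (u + 1) b * half_coth_reg l b x - exp x * (e u b * half_coth_reg l b x)))"
    unfolding cg sum_distrib_left sum_subtractf[symmetric]
    by (rule sum.cong) (simp_all add: field_simps)
  also have "(\<Sum>b<l. x * (e (u + 1) b * half_coth_reg l b x - exp x * (e u b * half_coth_reg l b x)))
     = (\<Sum>b<l. - (x / 2) * (e u b * exp x + e (u + 1) b) - (if b = 0 then 1 - exp x else 0))"
    by (rule sum.cong) (use summand in auto)
  also have "\<dots> = - (x / 2) * ((\<Sum>b<l. e u b) * exp x + (\<Sum>b<l. e (u + 1) b)) - (1 - exp x)"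
    unfolding sum_subtractf sum_distrib_left[symmetric] sum.distrib sum_distrib_right[symmetric]
    using l by simp
  also have "(\<Sum>b<l. e u b) = of_nat l * of_bool (int l dvd u)" by (rule se)
  also have "(\<Sum>b<l. e (u + 1) b) = of_nat l * of_bool (int l dvd u + 1)" by (rule se)
  also have "- (1 / of_nat l) * (- (x / 2) * (of_nat l * of_bool (int l dvd u) * exp x + of_nat l * of_bool (int l dvd u + 1)) - (1 - exp x))
    = x * (of_bool (int l dvd u + 1) / 2 + of_bool (int l dvd u) / 2 * exp x) + (1 - exp x) / of_nat l"
    using l by (simp add: field_simps)
  finally show ?thesis .
qed simp

lemma higher_deriv_times_ident:
  assumes "f analytic_on {0}"
  shows "(deriv ^^ Suc s) (\<lambda>x. x * f x) 0 = of_nat (Suc s) * (deriv ^^ s) f 0"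
proof -
  have "(deriv ^^ Suc s) (\<lambda>x. x * f x) 0
     = (\<Sum>i = 0..Suc s. of_nat (Suc s choose i) * (deriv ^^ i) (\<lambda>x. x) 0 * (deriv ^^ (Suc s - i)) f 0)"
    by (intro higher_deriv_mult_at assms analytic_on_ident)
  also have "\<dots> = (\<Sum>i = 0..Suc s. if i = 1 then of_nat (Suc s) * (deriv ^^ s) f 0 else 0)"
    by (rule sum.cong) (auto simp del: funpow.simps)
  finally show ?thesis by (simp del: funpow.simps)
qed

text \<open>Derivatives of order s + 1 at 0 are compared in \<open>const_gen_step\<close>: the
  factor x lowers the order by one and produces s + 1. The binomial sum is Leibniz' rule for exp x
  times \<open>const_gen\<close>.\<close>

lemma moment_step:
  assumes l: "l > 0"
  shows "moment l (u + 1) s - (\<Sum>i\<le>s. of_nat (s choose i) * moment l u i)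
    = of_bool (int l dvd u + 1) / 2 * of_bool (s = 0) + of_bool (int l dvd u) / 2 - 1 / (of_nat l * of_nat (Suc s))"
proof -
  define h where "h = (\<lambda>x. const_gen l (u + 1) x - exp x * const_gen l u x)"
  define g :: "complex \<Rightarrow> complex" where "g = (\<lambda>x. of_bool (int l dvd u + 1) / 2 + of_bool (int l dvd u) / 2 * exp x)"
  define k :: "complex \<Rightarrow> complex" where "k = (\<lambda>x. 1 / of_nat l - 1 / of_nat l * exp x)"
  have E: "(exp :: complex \<Rightarrow> complex) analytic_on {0}" by (intro analytic_intros)
  have Ed: "(deriv ^^ n) exp 0 = (1 :: complex)" for n
    using higher_deriv_exp_scale[of n 1] by (simp add: fun_eq_iff)
  have an: "h analytic_on {0}" "g analytic_on {0}" "k analytic_on {0}"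
    unfolding h_def g_def k_def by (intro analytic_on_diff analytic_on_add analytic_on_mult const_gen_analytic E analytic_on_const)+
  have "\<forall>\<^sub>F x in nhds 0. x \<in> ball (0::complex) (2 * pi / l)"
    using l by (intro eventually_nhds_in_open) auto
  then have "\<forall>\<^sub>F x in nhds 0. x * h x = x * g x + k x"
    by eventually_elim (use const_gen_step[OF l] in \<open>simp add: h_def g_def k_def diff_divide_distrib\<close>)
  then have "(deriv ^^ Suc s) (\<lambda>x. x * h x) 0 = (deriv ^^ Suc s) (\<lambda>x. x * g x + k x) 0"
    by (rule higher_deriv_cong_ev) simp
  also have "\<dots> = (deriv ^^ Suc s) (\<lambda>x. x * g x) 0 + (deriv ^^ Suc s) k 0"
    by (intro higher_deriv_add_at analytic_on_mult an analytic_on_ident)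
  also have "(deriv ^^ Suc s) k 0 = - (1 / of_nat l)"
    unfolding k_def
    by (subst higher_deriv_diff_at[OF analytic_on_const analytic_on_mult[OF analytic_on_const E]],
        subst higher_deriv_cmult'[OF E]) (simp add: Ed del: funpow.simps)
  finally have "of_nat (Suc s) * (deriv ^^ s) h 0 = of_nat (Suc s) * (deriv ^^ s) g 0 - 1 / of_nat l"
    by (simp only: higher_deriv_times_ident an) simp
  then have "(deriv ^^ s) h 0 = (deriv ^^ s) g 0 - 1 / (of_nat l * of_nat (Suc s))"
    using l by (simp add: field_simps del: of_nat_Suc)
  moreover have "(deriv ^^ s) g 0 = of_bool (int l dvd u + 1) / 2 * of_bool (s = 0) + of_bool (int l dvd u) / 2"
    unfolding g_def
    by (subst higher_deriv_add_at[OF analytic_on_const analytic_on_mult[OF analytic_on_const E]],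
        subst higher_deriv_cmult'[OF E]) (simp add: Ed del: funpow.simps)
  moreover have "(deriv ^^ s) h 0 = moment l (u + 1) s - (\<Sum>i\<le>s. of_nat (s choose i) * moment l u i)"
  proof -
    have "(deriv ^^ s) (\<lambda>x. const_gen l u x * exp x) 0 = (\<Sum>i\<le>s. of_nat (s choose i) * moment l u i)"
      by (subst higher_deriv_mult_at[OF const_gen_analytic E]) (simp add: Ed moment_eq_deriv atMost_atLeast0)
    then show ?thesis
      unfolding h_def by (subst higher_deriv_diff_at)
        (auto simp: moment_eq_deriv mult.commute[of "exp _"] intro!: const_gen_analytic analytic_on_mult E)
  qed
  ultimately show ?thesis by simp
qed

text \<open>The regularised sum of a polynomial over the positive integers congruent to \<open>u\<close>.\<close>

definition reg_sum :: "nat \<Rightarrow> int \<Rightarrow> complex poly \<Rightarrow> complex" where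
  "reg_sum l u p = (\<Sum>i\<le>degree p. coeff p i * moment l u i)"

lemma reg_sum_bound:
  assumes "degree p \<le> n"
  shows "reg_sum l u p = (\<Sum>i\<le>n. coeff p i * moment l u i)"
  unfolding reg_sum_def using assms
  by (intro sum.mono_neutral_left) (auto simp: coeff_eq_0)

lemma reg_sum_add: "reg_sum l u (p + q) = reg_sum l u p + reg_sum l u q"
proof -
  define n where "n = max (degree p) (degree q)"
  have "degree p \<le> n" "degree q \<le> n" "degree (p + q) \<le> n"
    by (auto simp: n_def degree_add_le)
  then show ?thesis by (simp add: reg_sum_bound[of _ n] distrib_right sum.distrib)
qed

lemma reg_sum_smult: "reg_sum l u (Polynomial.smult c p) = c * reg_sum l u p"
  by (subst reg_sum_bound[of _ "degree p"]) (simp_all add: reg_sum_def sum_distrib_left mult.assoc degree_smult_le)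

lemma reg_sum_sum: "reg_sum l u (\<Sum>i\<in>I. f i) = (\<Sum>i\<in>I. reg_sum l u (f i))"
  by (induction I rule: infinite_finite_induct) (auto simp: reg_sum_add reg_sum_def[of l u 0])

lemma reg_sum_monom: "reg_sum l u (monom c i) = c * moment l u i"
  by (subst reg_sum_bound[of _ i]) (simp_all add: degree_monom_le if_distrib[of "\<lambda>x. x * _"] cong: if_cong)

lemma reg_sum_linear_power: "reg_sum l u ([:1, 1:] ^ s) = (\<Sum>i\<le>s. of_nat (s choose i) * moment l u i)"
proof -
  have "degree ([:1, 1:] ^ s :: complex poly) \<le> s"
    using degree_power_le[of "[:1, 1 :: complex:]" s] by simp
  then show ?thesis by (simp add: reg_sum_bound coeff_linear_poly_power)
qed

text \<open>For statements linear in the polynomial, such as those about \<open>reg_sum\<close>, the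
  monomials suffice.\<close>

lemma poly_linear_induct [consumes 0, case_names add smult monom]:
  fixes P :: "complex poly \<Rightarrow> bool"
  assumes "\<And>p q. P p \<Longrightarrow> P q \<Longrightarrow> P (p + q)" "\<And>c p. P p \<Longrightarrow> P (Polynomial.smult c p)" "\<And>i. P (monom 1 i)"
  shows "P p"
proof -
  have "P (Polynomial.smult 0 (monom 1 0))" using assms by blast
  then have 0: "P 0" by simp
  have "P (\<Sum>i\<le>n. monom (coeff p i) i)" for n
  proof (induction n)
    case 0
    show ?case using assms(2)[OF assms(3), of "coeff p 0" 0] by (simp add: smult_monom monom_0)
  next
    case (Suc n)
    then show ?case using assms(1)[OF Suc assms(2)[OF assms(3), of "coeff p (Suc n)" "Suc n"]] by (simp add: smult_monom)
  qed
  then show ?thesis by (metis poly_as_sum_of_monoms)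
qed

text \<open>\<open>moment_step\<close> extended by linearity. With the summand written as a
  derivative, the integral over [0, 1] is simply a difference of values of G.\<close>

lemma reg_sum_step:
  assumes l: "l > 0"
  shows "reg_sum l (u + 1) (pderiv G) - reg_sum l u (pcompose (pderiv G) [:1, 1:])
    = of_bool (int l dvd u + 1) / 2 * poly (pderiv G) 0 + of_bool (int l dvd u) / 2 * poly (pderiv G) 1
      - (poly G 1 - poly G 0) / of_nat l"
proof (induction G rule: poly_linear_induct)
  case (add p q)
  have lin: "A * (x + y) + B * (z + w) - ((s + t) - (s' + t')) / L = (A * x + B * z - (s - s') / L) + (A * y + B * w - (t - t') / L)"
    for A B x y z w s t s' t' L :: complex
    by (simp add: distrib_left add_divide_distrib diff_divide_distrib)
  have "reg_sum l (u + 1) (pderiv (p + q)) - reg_sum l u (pcompose (pderiv (p + q)) [:1, 1:])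
     = (reg_sum l (u + 1) (pderiv p) - reg_sum l u (pcompose (pderiv p) [:1, 1:]))
       + (reg_sum l (u + 1) (pderiv q) - reg_sum l u (pcompose (pderiv q) [:1, 1:]))"
    by (simp add: pderiv_add pcompose_add reg_sum_add)
  then show ?case unfolding add pderiv_add poly_add lin .
next
  case (smult c p)
  have lin: "A * (c * x) + B * (c * z) - (c * s - c * s') / L = c * (A * x + B * z - (s - s') / L)"
    for A B x z s s' L :: complex
    by (simp add: algebra_simps diff_divide_distrib)
  have "reg_sum l (u + 1) (pderiv (Polynomial.smult c p)) - reg_sum l u (pcompose (pderiv (Polynomial.smult c p)) [:1, 1:])
     = c * (reg_sum l (u + 1) (pderiv p) - reg_sum l u (pcompose (pderiv p) [:1, 1:]))"
    by (simp add: pderiv_smult pcompose_smult reg_sum_smult right_diff_distrib)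
  then show ?case unfolding smult pderiv_smult poly_smult lin .
next
  case (monom i)
  show ?case
  proof (cases i)
    case 0
    then show ?thesis by (simp add: pderiv_monom reg_sum_def poly_monom)
  next
    case (Suc s)
    have "pcompose (monom 1 s) [:1, 1:] = ([:1, 1:] ^ s :: complex poly)"
      by (simp add: poly_eq_poly_eq_iff[symmetric] fun_eq_iff poly_pcompose poly_monom)
    moreover have "pderiv (monom 1 i) = Polynomial.smult (of_nat (Suc s)) (monom (1 :: complex) s)"
      by (simp add: Suc pderiv_monom smult_monom)
    ultimately have "reg_sum l (u + 1) (pderiv (monom 1 i)) - reg_sum l u (pcompose (pderiv (monom 1 i)) [:1, 1:])
      = of_nat (Suc s) * (moment l (u + 1) s - (\<Sum>i\<le>s. of_nat (s choose i) * moment l u i))"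
      by (simp only: pcompose_smult reg_sum_smult reg_sum_monom reg_sum_linear_power right_diff_distrib mult_1_left)
    also have "\<dots> = of_nat (Suc s) * (of_bool (int l dvd u + 1) / 2 * of_bool (s = 0) + of_bool (int l dvd u) / 2) - 1 / of_nat l"
      unfolding moment_step[OF l] using l by (simp add: field_simps del: of_nat_Suc)
    also have "\<dots> = of_bool (int l dvd u + 1) / 2 * poly (pderiv (monom 1 i)) 0
        + of_bool (int l dvd u) / 2 * poly (pderiv (monom 1 i)) 1 - (poly (monom 1 i) 1 - poly (monom 1 i) 0) / of_nat l"
      by (cases s) (simp_all add: Suc pderiv_monom poly_monom distrib_left)
    finally show ?thesis .
  qed
qed

text \<open>Arranged by unit intervals in order to telescope with \<open>reg_sum_step\<close>: an
  integer of the class strictly between 0 and D gets weight 1, and the ends 0 and D get weight 1 /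
  2.\<close>

definition trapezoid :: "nat \<Rightarrow> int \<Rightarrow> nat \<Rightarrow> (complex \<Rightarrow> complex) \<Rightarrow> complex" where
  "trapezoid l u D g = (\<Sum>A<D. (of_bool (int l dvd u - int A) * g (of_nat A)
      + of_bool (int l dvd u - int (Suc A)) * g (of_nat (Suc A))) / 2)"

text \<open>A sum over t > 0 minus a sum over t > D is a sum over an interval. Regularisation gives
  the ends half weight and subtracts the integral divided by l, the spacing of the class.\<close>

lemma reg_sum_shift:
  assumes l: "l > 0"
  shows "reg_sum l u (pderiv G) - reg_sum l (u - int D) (pcompose (pderiv G) [:of_nat D, 1:])
    = trapezoid l u D (poly (pderiv G)) - (poly G (of_nat D) - poly G 0) / of_nat l"
proof (induction D)
  case 0
  then show ?case by (simp add: trapezoid_def pcompose_idR)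
next
  case (Suc D)
  define G' where "G' = pcompose G [:of_nat D, 1:]"
  have G': "pderiv G' = pcompose (pderiv G) [:of_nat D, 1:]"
    by (simp add: G'_def pderiv_pcompose pderiv_pCons)
  have "pcompose (pderiv G') [:1, 1:] = pcompose (pderiv G) [:of_nat (Suc D), 1:]"
    by (simp add: poly_eq_poly_eq_iff[symmetric] fun_eq_iff G' poly_pcompose algebra_simps)
  moreover have "poly (pderiv G') 0 = poly (pderiv G) (of_nat D)" "poly (pderiv G') 1 = poly (pderiv G) (of_nat (Suc D))"
    "poly G' 0 = poly G (of_nat D)" "poly G' 1 = poly G (of_nat (Suc D))"
    by (simp_all add: G' poly_pcompose add.commute) (simp_all add: G'_def poly_pcompose add.commute)
  moreover have "u - int (Suc D) + 1 = u - int D" by simp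
  moreover note reg_sum_step[OF l, of "u - int (Suc D)" G']
  ultimately have step: "reg_sum l (u - int D) (pcompose (pderiv G) [:of_nat D, 1:]) - reg_sum l (u - int (Suc D)) (pcompose (pderiv G) [:of_nat (Suc D), 1:])
      = of_bool (int l dvd u - int D) / 2 * poly (pderiv G) (of_nat D) + of_bool (int l dvd u - int (Suc D)) / 2 * poly (pderiv G) (of_nat (Suc D))
      - (poly G (of_nat (Suc D)) - poly G (of_nat D)) / of_nat l"
    by (simp only: G')
  have trap: "trapezoid l u (Suc D) (poly (pderiv G)) = trapezoid l u D (poly (pderiv G))
      + (of_bool (int l dvd u - int D) / 2 * poly (pderiv G) (of_nat D) + of_bool (int l dvd u - int (Suc D)) / 2 * poly (pderiv G) (of_nat (Suc D)))"
    by (simp add: trapezoid_def add_divide_distrib)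
  have lin: "X - R' = T + c - (g1 - g0) / L" if "X - R = T - (g - g0) / L" "R - R' = c - (g1 - g) / L"
    for X R R' T c g g0 g1 L :: complex
  proof -
    have "X - R' = (X - R) + (R - R')" by simp
    then show ?thesis unfolding that by (simp add: diff_divide_distrib)
  qed
  show ?case unfolding trap by (rule lin[OF Suc step])
qed

lemma reg_sum_cong:
  assumes "l > 0" "[u = v] (mod int l)"
  shows "reg_sum l u p = reg_sum l v p"
  using stilde_fps_cong[OF assms] by (simp add: reg_sum_def moment_def)

lemma reg_sum_minus:
  assumes "l > 0"
  shows "reg_sum l (- u) (pcompose p [:0, - 1:]) = - reg_sum l u p"
proof (induction p rule: poly_linear_induct)
  case (monom i)
  have "pcompose (monom 1 i) [:0, - 1:] = Polynomial.smult ((- 1) ^ i) (monom (1 :: complex) i)"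
    by (simp add: poly_eq_poly_eq_iff[symmetric] fun_eq_iff poly_pcompose poly_monom flip: power_mult_distrib)
  then have "reg_sum l (- u) (pcompose (monom 1 i) [:0, - 1:]) = (- 1) ^ i * moment l (- u) i"
    by (simp only: reg_sum_smult reg_sum_monom mult_1_left)
  also have "\<dots> = - (((- 1) ^ i * (- 1) ^ i) * moment l u i)"
    by (simp add: moment_minus[OF assms])
  finally show ?case by (simp add: reg_sum_monom flip: power_mult_distrib)
qed (simp_all add: pcompose_add reg_sum_add pcompose_smult reg_sum_smult)

text \<open>Formally the sum over t > 0 plus the sum over t < D. By parity the regularised sum over
  a whole class of integers is 0, so only the interval from 0 to D remains.\<close>

lemma reg_sum_reflect:
  assumes l: "l > 0"
  shows "reg_sum l u (pderiv G) + reg_sum l (int D - u) (pcompose (pderiv G) [:of_nat D, - 1:])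
    = trapezoid l u D (poly (pderiv G)) - (poly G (of_nat D) - poly G 0) / of_nat l"
proof -
  have "pcompose (pderiv G) [:of_nat D, - 1:] = pcompose (pcompose (pderiv G) [:of_nat D, 1:]) [:0, - 1:]"
    by (simp add: poly_eq_poly_eq_iff[symmetric] fun_eq_iff poly_pcompose)
  with reg_sum_minus[OF l, of "u - int D" "pcompose (pderiv G) [:of_nat D, 1:]"]
  have "reg_sum l (int D - u) (pcompose (pderiv G) [:of_nat D, - 1:]) = - reg_sum l (u - int D) (pcompose (pderiv G) [:of_nat D, 1:])"
    by simp
  with reg_sum_shift[OF l, of u G D] show ?thesis by simp
qed

lemma moment_0_0: "l > 0 \<Longrightarrow> moment l 0 0 = 0"
  using moment_minus[of l 0 0] by simp

text \<open>\<open>reg_sum_reflect\<close> for t^2 on [0, l]: even moments of the class 0 vanish,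
  the trapezoid is l^2 / 2, the integral contributes l^2 / 3, and the mixed term of (l - t)^2
  isolates the first moment. The result agrees with the exceptional value in
  \<open>eisenstein_const\<close>.\<close>

lemma moment_0_1:
  assumes l: "l > 0"
  shows "moment l 0 1 = - (of_nat l / 12)"
proof -
  define L where "L = (of_nat l :: complex)"
  have L: "L \<noteq> 0" using l by (simp add: L_def)
  define G where "G = (monom (1 / 3) 3 :: complex poly)"
  have G': "pderiv G = monom 1 2" by (simp add: G_def pderiv_monom numeral_3_eq_3 numeral_2_eq_2)
  have "trapezoid l 0 l (poly (pderiv G)) = (\<Sum>A<l. if A = l - 1 then L ^ 2 / 2 else 0)"
    unfolding trapezoid_def
  proof (rule sum.cong)
    fix A assume A: "A \<in> {..<l}"
    have d: "int l dvd 0 - int n \<longleftrightarrow> n = 0 \<or> n = l" if "n \<le> l" for n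
      using that l by (auto dest: dvd_imp_le)
    show "(of_bool (int l dvd 0 - int A) * poly (pderiv G) (of_nat A)
      + of_bool (int l dvd 0 - int (Suc A)) * poly (pderiv G) (of_nat (Suc A))) / 2 = (if A = l - 1 then L ^ 2 / 2 else 0)"
      using A d[of A] d[of "Suc A"] by (auto simp: G' poly_monom L_def)
  qed simp
  also have "\<dots> = L ^ 2 / 2" using l by simp
  finally have trap: "trapezoid l 0 l (poly (pderiv G)) = L ^ 2 / 2" .
  have "pcompose (pderiv G) [:L, - 1:] = [:L ^ 2, - 2 * L, 1:]"
    unfolding poly_eq_poly_eq_iff[symmetric] fun_eq_iff
    by (simp add: G' poly_pcompose poly_monom power2_eq_square algebra_simps)
  then have "reg_sum l (int l - 0) (pcompose (pderiv G) [:L, - 1:]) = reg_sum l 0 [:L ^ 2, - 2 * L, 1:]"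
    using reg_sum_cong[OF l, of "int l" 0] by (simp add: cong_def)
  also have "\<dots> = - 2 * L * moment l 0 1 + moment l 0 2"
    by (subst reg_sum_bound[of _ 2]) (simp_all add: numeral_2_eq_2 moment_0_0[OF l])
  finally have "moment l 0 2 + (- 2 * L * moment l 0 1 + moment l 0 2) = L ^ 2 / 2 - L ^ 3 / 3 / L"
    using reg_sum_reflect[OF l, of 0 G l] unfolding trap
    by (simp add: G' reg_sum_monom L_def[symmetric]) (simp add: G_def poly_monom)
  moreover have "moment l 0 2 = 0" using moment_minus[OF l, of 0 2] by simp
  ultimately have "- 2 * L * moment l 0 1 = L * (L / 6)"
    using L by (simp add: field_simps power2_eq_square power3_eq_cube)
  then have "- 2 * (L * moment l 0 1) = - 2 * (L * (- (L / 12)))" by simp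
  then have "L * moment l 0 1 = L * (- (L / 12))" by (subst (asm) mult_cancel_left) simp
  then have "moment l 0 1 = - (L / 12)" using L by (subst (asm) mult_cancel_left) simp
  then show ?thesis by (simp only: L_def)
qed

lemma eisenstein_const_eq:
  assumes l: "l > 0" and j: "j \<ge> 1"
  shows "eisenstein_const l j a = fps_nth (stilde_fps l j a) 0"
proof (cases "j = 2 \<and> int l dvd a")
  case True
  then have "[a = 0] (mod int l)" by (simp add: cong_0_iff)
  from stilde_fps_cong[OF l this, of 2] True moment_0_1[OF l] \<open>[a = 0] (mod int l)\<close>
  show ?thesis by (simp add: eisenstein_const_def moment_def numeral_2_eq_2)
qed (use eisenstein_const_eq_aux[OF l j] in auto)

lemma stilde_eq_from_q:
  assumes l: "l > 0" and j: "j \<ge> 1"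
  shows "stilde l j a = from_q (stilde_fps l j a)"
  by (simp add: stilde_def eisenstein_const_eq[OF assms] q_series_stilde_fps[OF l])

lemma stilde_minus:
  assumes "l > 0" "j \<ge> 1"
  shows "stilde l j (- a) = cscale ((-1) ^ j) (stilde l j a)"
  by (simp add: stilde_eq_from_q[OF assms] stilde_fps_minus[OF assms] from_q_cmult stilde_fps_conv_radius)

lemma stilde_cong:
  assumes "l > 0" "j \<ge> 1" "[a = b] (mod int l)"
  shows "stilde l j a = stilde l j b"
  using stilde_fps_cong[OF assms(1,3)] by (simp add: stilde_eq_from_q[OF assms(1,2)])

section \<open>Quasimodularity of the Eisenstein series\<close>

lemma eis_fps_2_0:
  assumes "l > 0"
  shows "from_q (eis_fps l 2 0) = cscale (- 2) E2"
proof -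
  define F where "F = divisor_sum_fps (- 1 / 24) of_nat"
  have F: "fps_conv_radius F \<ge> 1"
    unfolding F_def by (rule divisor_sum_fps_conv_radius[where K = 1 and p = 1]) simp
  \<comment> \<open>At b = 0 nothing depends on l, so the constant 1 / 12 can be read off at level
    one, where the Fourier transform has a single term.\<close>
  have "stilde_fps 1 2 0 = - eis_fps 1 2 0"
    by (simp add: stilde_fps_def flip: fps_const_neg)
  then have "eis_const 1 2 0 = 1 / 12"
    using moment_0_1[of 1] by (simp add: moment_def eis_fps_def numeral_2_eq_2)
  moreover have "eis_const l 2 0 = eis_const 1 2 0"
    by (simp add: eis_const_def half_coth_reg_def[abs_def])
  ultimately have c: "eis_const l 2 0 = 1 / 12" by simp
  have "eis_fps l 2 0 = fps_const (- 2) * F"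
    unfolding fps_eq_iff
  proof
    fix n
    have "(\<Sum>d | d dvd n. eis_coeff l 2 0 d) = - 2 * (\<Sum>d | d dvd n. of_nat d)"
      unfolding sum_distrib_left by (rule sum.cong) (simp_all add: eis_coeff_def)
    then show "fps_nth (eis_fps l 2 0) n = fps_nth (fps_const (- 2) * F) n"
      by (cases "n = 0") (simp_all only: eis_fps_def F_def fps_mult_left_const_nth divisor_sum_fps_nth c, simp_all)
  qed
  moreover have "E2 = from_q F"
    unfolding E2_def q_series_eq_from_q[OF F, symmetric] by (rule q_series_cong) (simp_all add: F_def)
  ultimately show ?thesis by (simp add: from_q_cmult[OF F] del: fps_const_neg)
qed

lemma quasimodular_vanishes:
  assumes "quasimodular l k f" "\<tau> \<notin> upper_half_plane"
  shows "f \<tau> = 0"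
  using assms by induction (auto simp: modular_forms_def E2_def q_series_def)

lemma constant_modular: "(\<lambda>\<tau>. if \<tau> \<in> upper_half_plane then c else 0) \<in> modular_forms l 0"
proof -
  define f where "f = (\<lambda>\<tau>. if \<tau> \<in> upper_half_plane then c else 0)"
  have "f holomorphic_on upper_half_plane"
    by (rule holomorphic_transform[OF holomorphic_on_const[of c]]) (simp add: f_def)
  moreover have slash: "slash 0 f \<gamma> \<tau> = c" if "\<gamma> \<in> SL2Z" "\<tau> \<in> upper_half_plane" for \<gamma> \<tau>
    using mobius_in_upper_half_plane[OF that] by (cases \<gamma>) (simp add: mobius_def f_def)
  moreover have "\<gamma> \<in> SL2Z" if "\<gamma> \<in> Gamma1 l" for \<gamma>
    using that by (auto simp: Gamma1_def)
  moreover have "\<exists>B Y. \<forall>\<tau>\<in>upper_half_plane. Im \<tau> \<ge> Y \<longrightarrow> norm (slash 0 f \<gamma> \<tau>) \<le> B" if "\<gamma> \<in> SL2Z" for \<gamma>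
    by (intro exI[of _ "norm c"]) (simp add: slash that)
  moreover have "f \<tau> = (if \<tau> \<in> upper_half_plane then c else 0)" for \<tau>
    by (simp add: f_def)
  ultimately show ?thesis
    unfolding f_def[symmetric] modular_forms_def mem_Collect_eq
    by (intro conjI allI impI ballI) (simp_all only: if_True if_False)
qed

text \<open>The inductive definition has no clause for scalars; they enter as modular forms of
  weight 0.\<close>

lemma quasimodular_cscale:
  assumes "quasimodular l k f"
  shows "quasimodular l k (cscale c f)"
proof -
  have "quasimodular l (0 + k) ((\<lambda>\<tau>. if \<tau> \<in> upper_half_plane then c else 0) * f)"
    by (rule quasimodular.mult[OF quasimodular.modular[OF constant_modular] assms])
  also have "(\<lambda>\<tau>. if \<tau> \<in> upper_half_plane then c else 0) * f = cscale c f"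
    using quasimodular_vanishes[OF assms] by (auto simp: cscale_def fun_eq_iff)
  finally show ?thesis by simp
qed

theorem quasimodular_stilde:
  assumes l: "l > 0" and j: "j \<ge> 1"
  shows "quasimodular l j (stilde l j a)"
proof (cases "j = 2 \<and> int l dvd a")
  case False
  then show ?thesis
    using from_q_stilde_fps_modular[OF l j] by (auto simp: stilde_eq_from_q[OF assms] intro: quasimodular.modular)
next
  case True
  then have "[a = 0] (mod int l)" by (simp add: cong_0_iff)
  then have S: "stilde l j a = from_q (stilde_fps l 2 0)"
    using stilde_fps_cong[OF l, of a 0 j] True by (metis stilde_eq_from_q[OF assms])
  \<comment> \<open>Adding the torsion series at b = 0 makes the weights sum to 0. That series is -
    2 \<open>E2\<close>, so the sum is modular and \<open>stilde\<close> differs from it by a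
    multiple of \<open>E2\<close>.\<close>
  define c :: "nat \<Rightarrow> complex" where "c = (\<lambda>b. - 1 / of_nat l + (if b = 0 then 1 else 0))"
  have c: "fps_const (c b) = fps_const (- 1 / of_nat l) + (if b = 0 then 1 else 0)" for b
    by (rule fps_ext) (simp add: c_def)
  have "from_q (\<Sum>b<l. fps_const (c b) * eis_fps l 2 b) \<in> modular_forms l 2"
    by (rule eis_combination_modular) (use l in \<open>simp_all add: c_def sum.distrib sum_subtractf\<close>)
  also have "(\<Sum>b<l. fps_const (c b) * eis_fps l 2 b) = (\<Sum>b<l. fps_const (- 1 / of_nat l) * eis_fps l 2 b + (if b = 0 then eis_fps l 2 0 else 0))"
    by (rule sum.cong) (auto simp: c distrib_right)
  also have "\<dots> = stilde_fps l 2 0 + eis_fps l 2 0"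
    using l by (simp add: sum.distrib stilde_fps_def)
  also have "from_q (stilde_fps l 2 0 + eis_fps l 2 0) = stilde l j a + cscale (- 2) E2"
    by (simp only: from_q_add[OF stilde_fps_conv_radius eis_fps_conv_radius] S eis_fps_2_0[OF l])
  finally have "quasimodular l 2 (stilde l j a + cscale (- 2) E2 + cscale 2 E2)"
    by (rule quasimodular.add[OF quasimodular.modular quasimodular_cscale[OF quasimodular.E2]])
  also have "stilde l j a + cscale (- 2) E2 + cscale 2 E2 = stilde l j a"
    by (simp add: cscale_def fun_eq_iff)
  finally show ?thesis using True by simp
qed

section \<open>A Euclidean identity for divisor sums\<close>

text \<open>a and b are frequencies, m and m' their cofactors: the n-th coefficient of a product of
  two divisor-sum series without constant terms is a sum over these quadruples.\<close>

definition quads :: "nat \<Rightarrow> (nat \<times> nat \<times> nat \<times> nat) set" where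
  "quads n = {(a, b, m, m'). a > 0 \<and> b > 0 \<and> m > 0 \<and> m' > 0 \<and> a * m + b * m' = n}"

lemma finite_quads: "finite (quads n)"
proof (rule finite_subset)
  show "quads n \<subseteq> {..n} \<times> {..n} \<times> {..n} \<times> {..n}"
  proof
    fix z assume "z \<in> quads n"
    then obtain a b m m' where z: "z = (a, b, m, m')" "a > 0" "b > 0" "m > 0" "m' > 0" "a * m + b * m' = n"
      by (auto simp: quads_def)
    have "a \<le> a * m" "m \<le> a * m" "b \<le> b * m'" "m' \<le> b * m'" using z by auto
    with z(6) have "a \<le> n" "b \<le> n" "m \<le> n" "m' \<le> n" by linarith+
    then show "z \<in> {..n} \<times> {..n} \<times> {..n} \<times> {..n}" by (simp add: z(1))
  qed
qed auto

lemma finite_quads_filter: "finite {(a, b, m, m'). (a, b, m, m') \<in> quads n \<and> P a b m m'}"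
  by (rule finite_subset[OF _ finite_quads]) auto

definition quad_sum :: "nat \<Rightarrow> (nat \<Rightarrow> nat \<Rightarrow> complex) \<Rightarrow> complex" where
  "quad_sum n h = (\<Sum>(a, b, m, m')\<in>quads n. h a b)"

lemma quad_sum_add: "quad_sum n (\<lambda>a b. g a b + h a b) = quad_sum n g + quad_sum n h"
  by (simp add: quad_sum_def case_prod_unfold sum.distrib)

lemma quad_sum_diff: "quad_sum n (\<lambda>a b. g a b - h a b) = quad_sum n g - quad_sum n h"
  by (simp add: quad_sum_def case_prod_unfold sum_subtractf)

lemma quad_sum_cong: "(\<And>a b. a > 0 \<Longrightarrow> b > 0 \<Longrightarrow> g a b = h a b) \<Longrightarrow> quad_sum n g = quad_sum n h"
  unfolding quad_sum_def by (rule sum.cong) (auto simp: quads_def)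

lemma quad_sum_swap: "quad_sum n (\<lambda>a b. h b a) = quad_sum n h"
  unfolding quad_sum_def
  by (rule sum.reindex_bij_witness[of _ "\<lambda>(a, b, m, m'). (b, a, m', m)" "\<lambda>(a, b, m, m'). (b, a, m', m)"])
     (auto simp: quads_def)

text \<open>In the coordinates c = a + b and m' - m, the constraint m < m' becomes positivity of a
  cofactor, and positivity of a becomes b < c.\<close>

lemma sum_quads_less:
  "(\<Sum>(a, b, m, m')\<in>{(a, b, m, m')\<in>quads n. m < m'}. h a b) = quad_sum n (\<lambda>c b. if b < c then h (c - b) b else (0 :: complex))"
proof -
  have k1: "(c - b) * m + b * (m + m') = c * m + b * m'" if lt: "b < c" for b c m m' :: nat
  proof -
    obtain k where "c = b + k" using le_Suc_ex[of b c] lt by auto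
    then show ?thesis by (simp add: algebra_simps)
  qed
  have k2: "(a + b) * m + b * (m' - m) = a * m + b * m'" if lt: "m < m'" for a b m m' :: nat
  proof -
    obtain k where "m' = m + k" using le_Suc_ex[of m m'] lt by auto
    then show ?thesis by (simp add: algebra_simps)
  qed
  have "quad_sum n (\<lambda>c b. if b < c then h (c - b) b else 0) = (\<Sum>(c, b, m, m')\<in>{(c, b, m, m')\<in>quads n. b < c}. h (c - b) b)"
    unfolding quad_sum_def by (rule sum.mono_neutral_cong_right) (auto simp: finite_quads split: if_splits)
  also have "\<dots> = (\<Sum>(a, b, m, m')\<in>{(a, b, m, m')\<in>quads n. m < m'}. h a b)"
    by (rule sum.reindex_bij_witness[of _ "\<lambda>(a, b, m, m'). (a + b, b, m, m' - m)" "\<lambda>(c, b, m, m'). (c - b, b, m, m + m')"])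
       (auto simp: quads_def k1 k2)
  finally show ?thesis ..
qed

text \<open>Euclid's step \<open>(a, b, m, m') \<mapsto> (a + b, b, m, m' - m)\<close> for \<open>m < m'\<close> preserves
  \<open>a m + b m'\<close>; only the diagonal \<open>m = m'\<close> is left over.\<close>

lemma quad_sum_euclid:
  assumes n: "n > 0"
  shows "quad_sum n h = (\<Sum>D | D dvd n. \<Sum>A\<in>{0<..<D}. h A (D - A))
      + quad_sum n (\<lambda>c b. if b < c then h (c - b) b else 0)
      + quad_sum n (\<lambda>a c. if a < c then h a (c - a) else 0)"
proof -
  have split: "quad_sum n h = (\<Sum>(a, b, m, m')\<in>{(a, b, m, m')\<in>quads n. m = m'}. h a b)
     + (\<Sum>(a, b, m, m')\<in>{(a, b, m, m')\<in>quads n. m < m'}. h a b)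
     + (\<Sum>(a, b, m, m')\<in>{(a, b, m, m')\<in>quads n. m' < m}. h a b)"
  proof -
    define A where "A = {(a, b, m, m')\<in>quads n. m = m'}"
    define B where "B = {(a, b, m, m')\<in>quads n. m < m'}"
    define C where "C = {(a, b, m, m')\<in>quads n. m' < m}"
    have "finite A" "finite B" "finite C"
      unfolding A_def B_def C_def by (rule finite_quads_filter)+
    moreover have "A \<inter> B = {}" "(A \<union> B) \<inter> C = {}" "quads n = A \<union> B \<union> C"
      by (auto simp: A_def B_def C_def)
    ultimately show ?thesis
      unfolding quad_sum_def A_def[symmetric] B_def[symmetric] C_def[symmetric]
      by (simp add: sum.union_disjoint)
  qed
  have "(\<Sum>(a, b, m, m')\<in>{(a, b, m, m')\<in>quads n. m' < m}. h a b)
     = (\<Sum>(a, b, m, m')\<in>{(a, b, m, m')\<in>quads n. m < m'}. h b a)"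
    by (rule sum.reindex_bij_witness[of _ "\<lambda>(a, b, m, m'). (b, a, m', m)" "\<lambda>(a, b, m, m'). (b, a, m', m)"])
       (auto simp: quads_def)
  also have "\<dots> = quad_sum n (\<lambda>a c. if a < c then h a (c - a) else 0)"
    unfolding sum_quads_less by (subst quad_sum_swap[symmetric]) simp
  finally have 3: "(\<Sum>(a, b, m, m')\<in>{(a, b, m, m')\<in>quads n. m' < m}. h a b)
     = quad_sum n (\<lambda>a c. if a < c then h a (c - a) else 0)" .
  have k1: "A * (n div D) + (D - A) * (n div D) = n" "0 < n div D" if "D dvd n" "A < D" for A D
    using that n by (auto simp flip: add_mult_distrib elim!: dvdE)
  have k2: "(a * m + b * m) div (a + b) = m" if "0 < a" for a b m :: nat
    using that by (simp flip: add_mult_distrib)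
  have k3: "(a + b) dvd a * m + b * m" for a b m :: nat
    by (simp flip: add_mult_distrib)
  have "(\<Sum>D | D dvd n. \<Sum>A\<in>{0<..<D}. h A (D - A)) = (\<Sum>(D, A)\<in>(SIGMA D:{D. D dvd n}. {0<..<D}). h A (D - A))"
    using n by (intro sum.Sigma) auto
  also have "\<dots> = (\<Sum>(a, b, m, m')\<in>{(a, b, m, m')\<in>quads n. m = m'}. h a b)"
    by (rule sum.reindex_bij_witness[of _ "\<lambda>(a, b, m, m'). (a + b, a)" "\<lambda>(D, A). (A, D - A, n div D, n div D)"])
       (auto simp: quads_def k1 k2 k3)
  finally have 1: "(\<Sum>(a, b, m, m')\<in>{(a, b, m, m')\<in>quads n. m = m'}. h a b) = (\<Sum>D | D dvd n. \<Sum>A\<in>{0<..<D}. h A (D - A))" ..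
  show ?thesis unfolding split 1 sum_quads_less 3 ..
qed

text \<open>For a = b = D the cofactors need only satisfy m + m' = n / D, which has n / D - 1
  positive solutions.\<close>

lemma quad_sum_diagonal:
  assumes n: "n > 0"
  shows "quad_sum n (\<lambda>a b. if a = b then h a else 0) = (\<Sum>D | D dvd n. of_nat (n div D - 1) * h D)"
proof -
  have k1: "D * m + D * (n div D - m) = n" if "D dvd n" "m < n div D" for D m
    using that by (simp flip: add_mult_distrib2)
  have k3: "0 < D" if "D dvd n" for D
    using that n by (rule dvd_pos_nat[rotated])
  have k2: "(a * m + a * m') div a = m + m'" if "0 < a" for a m m' :: nat
    using that by (simp flip: add_mult_distrib2)
  have "quad_sum n (\<lambda>a b. if a = b then h a else 0) = (\<Sum>(a, b, m, m')\<in>{(a, b, m, m')\<in>quads n. a = b}. h a)"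
    unfolding quad_sum_def by (rule sum.mono_neutral_cong_right) (auto simp: finite_quads split: if_splits)
  also have "\<dots> = (\<Sum>(D, m)\<in>(SIGMA D:{D. D dvd n}. {0<..<n div D}). h D)"
    by (rule sum.reindex_bij_witness[of _ "\<lambda>(D, m). (D, D, m, n div D - m)" "\<lambda>(a, b, m, m'). (a, m)"])
       (auto simp: quads_def k1 k2 k3)
  also have "\<dots> = (\<Sum>D | D dvd n. \<Sum>m\<in>{0<..<n div D}. h D)"
    using n by (intro sum.Sigma[symmetric]) auto
  finally show ?thesis by (simp del: of_nat_diff)
qed

section \<open>Signed frequencies and triples of sum zero\<close>

definition signed_sum :: "nat \<Rightarrow> (int \<Rightarrow> int \<Rightarrow> complex) \<Rightarrow> complex" where
  "signed_sum n F = quad_sum n (\<lambda>a b. F (int a) (int b) + F (- int a) (- int b) - F (int a) (- int b) - F (- int a) (int b))"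

text \<open>Completed to triples (x, y, - x - y), these are the ones with nonzero entries whose
  entry of largest modulus, D up to sign, is in the middle.\<close>

definition antidiagonal_sum :: "(int \<Rightarrow> int \<Rightarrow> complex) \<Rightarrow> nat \<Rightarrow> complex" where
  "antidiagonal_sum F D = (\<Sum>A\<in>{0<..<D}. F (- int A) (int D) + F (int A) (- int D))"

definition axis_sum :: "(int \<Rightarrow> int \<Rightarrow> complex) \<Rightarrow> nat \<Rightarrow> complex" where
  "axis_sum F D = F 0 (int D) + F 0 (- int D)"

text \<open>Pairs of equal sign undergo Euclid's step. Pairs of opposite sign are merely sorted by
  which entry is larger; for equal moduli the third entry of the triple is 0, an axis term of H. The
  two kinds are set apart so that they can cancel between different forms.\<close>

lemma signed_sum_split:
  assumes n: "n > 0" and G: "\<And>x y. F x y = G y (- x - y)" and H: "\<And>x y. F x y = H (- x - y) x"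
  shows "signed_sum n F
     = (\<Sum>D | D dvd n. antidiagonal_sum G D)
      + quad_sum n (\<lambda>c b. if b < c then F (int c - int b) (int b) + F (int b - int c) (- int b) else 0)
      + quad_sum n (\<lambda>a c. if a < c then F (int a) (int c - int a) + F (- int a) (int a - int c) else 0)
      - quad_sum n (\<lambda>a b. if b < a then F (int a) (- int b) + F (- int a) (int b) else 0)
      - quad_sum n (\<lambda>a b. if a < b then F (int a) (- int b) + F (- int a) (int b) else 0)
      - (\<Sum>D | D dvd n. of_nat (n div D - 1) * axis_sum H D)"
proof -
  define h where "h = (\<lambda>a b. F (int a) (int b) + F (- int a) (- int b))"
  define g where "g = (\<lambda>a b. F (int a) (- int b) + F (- int a) (int b))"
  have ax: "F (int D) (- int D) + F (- int D) (int D) = axis_sum H D" for D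
    using H[of "int D" "- int D"] H[of "- int D" "int D"] by (simp add: axis_sum_def)
  have anti: "(\<Sum>A\<in>{0<..<D}. h A (D - A)) = antidiagonal_sum G D" for D
  proof -
    have "(\<Sum>A\<in>{0<..<D}. h A (D - A)) = (\<Sum>A\<in>{0<..<D}. h (D - A) A)"
      by (rule sum.reindex_bij_witness[of _ "\<lambda>A. D - A" "\<lambda>A. D - A"]) auto
    also have "\<dots> = antidiagonal_sum G D"
      unfolding antidiagonal_sum_def
    proof (rule sum.cong)
      fix A assume "A \<in> {0<..<D}"
      then show "h (D - A) A = G (- int A) (int D) + G (int A) (- int D)"
        using G[of "int D - int A" "int A"] G[of "int A - int D" "- int A"]
          G[of "- int (D - A)" "- int A"] by (simp add: h_def of_nat_diff)
    qed simp
    finally show ?thesis .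
  qed
  have "signed_sum n F = quad_sum n h - quad_sum n g"
    unfolding signed_sum_def quad_sum_diff[symmetric] by (simp add: h_def g_def algebra_simps)
  also have "quad_sum n g = quad_sum n (\<lambda>a b. (if b < a then g a b else 0) + (if a < b then g a b else 0) + (if a = b then g a a else 0))"
    by (rule quad_sum_cong) auto
  also have "\<dots> = quad_sum n (\<lambda>a b. if b < a then g a b else 0) + quad_sum n (\<lambda>a b. if a < b then g a b else 0)
      + (\<Sum>D | D dvd n. of_nat (n div D - 1) * g D D)"
    unfolding quad_sum_add quad_sum_diagonal[OF n] ..
  also have "quad_sum n h = (\<Sum>D | D dvd n. \<Sum>A\<in>{0<..<D}. h A (D - A))
      + quad_sum n (\<lambda>c b. if b < c then h (c - b) b else 0)
      + quad_sum n (\<lambda>a c. if a < c then h a (c - a) else 0)"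
    by (rule quad_sum_euclid[OF n])
  also have "(\<lambda>c b. if b < c then h (c - b) b else 0)
      = (\<lambda>c b. if b < c then F (int c - int b) (int b) + F (int b - int c) (- int b) else 0)"
    by (auto simp: fun_eq_iff h_def of_nat_diff)
  also have "(\<lambda>a c. if a < c then h a (c - a) else 0)
      = (\<lambda>a c. if a < c then F (int a) (int c - int a) + F (- int a) (int a - int c) else 0)"
    by (auto simp: fun_eq_iff h_def of_nat_diff)
  finally show ?thesis unfolding ax anti g_def by (simp add: diff_diff_eq)
qed

text \<open>By \<open>e1\<close> an equal-sign pair (c - b, b) is an opposite-sign pair (b, - c) of
  the next form; by \<open>e2\<close> a pair (a, c - a) is an opposite-sign pair (- c, a) of the
  previous one. After the exchange of variables in \<open>sw\<close> all of these cancel.\<close>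

theorem signed_sum_three_term:
  assumes n: "n > 0"
    and FG: "\<And>x y. F x y = G y (- x - y)" and HF: "\<And>x y. F x y = H (- x - y) x"
  shows "signed_sum n F + signed_sum n G + signed_sum n H
    = (\<Sum>D | D dvd n. antidiagonal_sum F D + antidiagonal_sum G D + antidiagonal_sum H D)
    - (\<Sum>D | D dvd n. of_nat (n div D - 1) * (axis_sum F D + axis_sum G D + axis_sum H D))"
proof -
  have GF: "G x y = F (- x - y) x" for x y using FG[of "- x - y" x] by simp
  have GH: "G x y = H y (- x - y)" for x y using HF[of "- x - y" x] GF[of x y] by simp
  have HF': "H x y = F y (- x - y)" for x y using HF[of y "- x - y"] by simp
  have HG: "H x y = G (- x - y) x" for x y using GH[of "- x - y" x] by simp
  have e1: "F (int c - int b) (int b) = G (int b) (- int c)" "F (int b - int c) (- int b) = G (- int b) (int c)"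
     "G (int c - int b) (int b) = H (int b) (- int c)" "G (int b - int c) (- int b) = H (- int b) (int c)"
     "H (int c - int b) (int b) = F (int b) (- int c)" "H (int b - int c) (- int b) = F (- int b) (int c)" for b c
    using FG[of "int c - int b" "int b"] FG[of "int b - int c" "- int b"]
      GH[of "int c - int b" "int b"] GH[of "int b - int c" "- int b"]
      HF'[of "int c - int b" "int b"] HF'[of "int b - int c" "- int b"] by simp_all
  have e2: "F (int a) (int c - int a) = H (- int c) (int a)" "F (- int a) (int a - int c) = H (int c) (- int a)"
     "G (int a) (int c - int a) = F (- int c) (int a)" "G (- int a) (int a - int c) = F (int c) (- int a)"
     "H (int a) (int c - int a) = G (- int c) (int a)" "H (- int a) (int a - int c) = G (int c) (- int a)" for a c
    using HF[of "int a" "int c - int a"] HF[of "- int a" "int a - int c"]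
      GF[of "int a" "int c - int a"] GF[of "- int a" "int a - int c"]
      HG[of "int a" "int c - int a"] HG[of "- int a" "int a - int c"] by simp_all
  have sw: "quad_sum n (\<lambda>c b. if b < c then K (int b) (- int c) + K (- int b) (int c) else 0)
     = quad_sum n (\<lambda>a b. if a < b then K (int a) (- int b) + K (- int a) (int b) else 0)"
    "quad_sum n (\<lambda>a c. if a < c then K (- int c) (int a) + K (int c) (- int a) else 0)
     = quad_sum n (\<lambda>a b. if b < a then K (int a) (- int b) + K (- int a) (int b) else 0)" for K
  proof -
    show "quad_sum n (\<lambda>c b. if b < c then K (int b) (- int c) + K (- int b) (int c) else 0)
     = quad_sum n (\<lambda>a b. if a < b then K (int a) (- int b) + K (- int a) (int b) else 0)"
      by (rule quad_sum_swap)
    have "quad_sum n (\<lambda>a c. if a < c then K (- int c) (int a) + K (int c) (- int a) else 0)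
     = quad_sum n (\<lambda>a b. if b < a then K (- int a) (int b) + K (int a) (- int b) else 0)"
      by (rule quad_sum_swap)
    also have "\<dots> = quad_sum n (\<lambda>a b. if b < a then K (int a) (- int b) + K (- int a) (int b) else 0)"
      by (rule quad_sum_cong) simp
    finally show "quad_sum n (\<lambda>a c. if a < c then K (- int c) (int a) + K (int c) (- int a) else 0)
     = quad_sum n (\<lambda>a b. if b < a then K (int a) (- int b) + K (- int a) (int b) else 0)" .
  qed
  show ?thesis
    unfolding signed_sum_split[where F = F and G = G and H = H, OF n FG HF] signed_sum_split[where F = G and G = H and H = F, OF n GH GF] signed_sum_split[where F = H and G = F and H = G, OF n HF' HG]
      e1 e2 sw[of F] sw[of G] sw[of H]
    by (simp add: sum.distrib distrib_left)
qed

section \<open>Fourier coefficients of the three-term sum\<close>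

definition residue_ind :: "nat \<Rightarrow> int \<Rightarrow> int \<Rightarrow> complex" where
  "residue_ind l u d = of_bool (int l dvd d - u)"

definition hom_eval :: "nat \<Rightarrow> (nat \<Rightarrow> complex) \<Rightarrow> complex \<Rightarrow> complex \<Rightarrow> complex" where
  "hom_eval m \<alpha> x y = (\<Sum>i\<le>m. \<alpha> i * x ^ i * y ^ (m - i))"

text \<open>Since (-1)^(i + 1) d^i = - (- d)^i, the second indicator becomes the first one at the
  frequency - d. The signs of \<open>signed_sum\<close> are products of these.\<close>

lemma eisenstein_coeff_eq:
  "eisenstein_coeff l (Suc i) u n
     = (\<Sum>d | d dvd n. residue_ind l u (int d) * of_nat d ^ i - residue_ind l u (- int d) * (- of_nat d) ^ i)"
  unfolding eisenstein_coeff_def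
proof (rule sum.cong)
  fix d
  have "- int d - u = - (int d + u)" by simp
  then have "int l dvd - int d - u \<longleftrightarrow> int l dvd int d + u"
    by (simp only: dvd_minus_iff)
  then show "of_nat d ^ (Suc i - 1) * (of_bool ([int d = u] (mod int l)) + (-1) ^ Suc i * of_bool ([int d = - u] (mod int l)))
     = residue_ind l u (int d) * of_nat d ^ i - residue_ind l u (- int d) * (- of_nat d) ^ i"
    by (simp add: residue_ind_def cong_iff_dvd_diff power_minus[of "of_nat d :: complex"] right_diff_distrib)
qed simp

lemma quad_sum_eq:
  "quad_sum n h = (\<Sum>p\<in>{0<..<n}. \<Sum>a | a dvd p. \<Sum>b | b dvd (n - p). h a b)"
proof -
  have "(\<Sum>p\<in>{0<..<n}. \<Sum>a | a dvd p. \<Sum>b | b dvd (n - p). h a b)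
      = (\<Sum>p\<in>{0<..<n}. \<Sum>(a, b)\<in>{a. a dvd p} \<times> {b. b dvd (n - p)}. h a b)"
    by (simp add: sum.cartesian_product)
  also have "\<dots> = (\<Sum>(p, a, b)\<in>(SIGMA p:{0<..<n}. {a. a dvd p} \<times> {b. b dvd (n - p)}). h a b)"
    by (subst sum.Sigma) (auto simp: case_prod_unfold)
  also have "\<dots> = quad_sum n h"
    unfolding quad_sum_def
    by (rule sum.reindex_bij_witness[of _ "\<lambda>(a, b, m, m'). (a * m, a, b)" "\<lambda>(p, a, b). (a, b, p div a, (n - p) div b)"])
       (auto simp: quads_def dvd_div_eq_0_iff intro!: Nat.gr0I)
  finally show ?thesis ..
qed

definition char_form :: "nat \<Rightarrow> nat \<Rightarrow> (nat \<Rightarrow> complex) \<Rightarrow> int \<Rightarrow> int \<Rightarrow> int \<Rightarrow> int \<Rightarrow> complex" where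
  "char_form l m \<alpha> u v x y = residue_ind l u x * residue_ind l v y * hom_eval m \<alpha> (of_int x) (of_int y)"

text \<open>The contribution to the n-th coefficient in which neither factor supplies its constant
  term.\<close>

lemma pure_part:
  "(\<Sum>i\<le>m. \<alpha> i * (\<Sum>p\<in>{0<..<n}. eisenstein_coeff l (Suc i) u p * eisenstein_coeff l (Suc (m - i)) v (n - p)))
     = signed_sum n (char_form l m \<alpha> u v)"
proof -
  define e where "e = (\<lambda>i u d. residue_ind l u (int d) * of_nat d ^ i - residue_ind l u (- int d) * (- of_nat d) ^ i)"
  have "(\<Sum>i\<le>m. \<alpha> i * (\<Sum>p\<in>{0<..<n}. eisenstein_coeff l (Suc i) u p * eisenstein_coeff l (Suc (m - i)) v (n - p)))
      = (\<Sum>i\<le>m. \<alpha> i * quad_sum n (\<lambda>a b. e i u a * e (m - i) v b))"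
    unfolding quad_sum_eq eisenstein_coeff_eq e_def sum_product ..
  also have "\<dots> = quad_sum n (\<lambda>a b. \<Sum>i\<le>m. \<alpha> i * (e i u a * e (m - i) v b))"
    unfolding quad_sum_def sum_distrib_left by (subst sum.swap) (simp add: case_prod_unfold)
  also have "\<dots> = signed_sum n (char_form l m \<alpha> u v)"
    unfolding signed_sum_def
  proof (rule quad_sum_cong)
    fix a b :: nat
    show "(\<Sum>i\<le>m. \<alpha> i * (e i u a * e (m - i) v b)) = char_form l m \<alpha> u v (int a) (int b)
       + char_form l m \<alpha> u v (- int a) (- int b) - char_form l m \<alpha> u v (int a) (- int b) - char_form l m \<alpha> u v (- int a) (int b)"
      unfolding char_form_def hom_eval_def sum_distrib_left sum.distrib[symmetric] sum_subtractf[symmetric]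
      by (rule sum.cong) (simp_all add: e_def algebra_simps)
  qed
  finally show ?thesis .
qed

section \<open>Products of a constant term with a Fourier coefficient\<close>

lemma pderiv_sum_poly: "pderiv (\<Sum>i\<in>I. f i) = (\<Sum>i\<in>I. pderiv (f i :: complex poly))"
  by (induction I rule: infinite_finite_induct) (auto simp: pderiv_add)

text \<open>The integral of \<open>hom_eval m \<alpha> (- t) 1\<close> over t from 0 to 1.\<close>

definition hom_integral :: "nat \<Rightarrow> (nat \<Rightarrow> complex) \<Rightarrow> complex" where
  "hom_integral m \<alpha> = (\<Sum>i\<le>m. \<alpha> i * (- 1) ^ i / of_nat (Suc i))"

text \<open>p D is the form with second variable D, as a polynomial in minus the first; by
  homogeneity its integral over [0, D] is D^(m + 1) times that over [0, 1] for D = 1.\<close>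

lemma reg_sum_hom_reflect:
  fixes \<alpha> :: "nat \<Rightarrow> complex" and m :: nat
  assumes l: "l > 0"
  defines "p \<equiv> \<lambda>D::nat. (\<Sum>i\<le>m. monom (\<alpha> i * (- 1) ^ i * of_nat D ^ (m - i)) i)"
  shows "reg_sum l u (p D) + reg_sum l (int D - u) (pcompose (p D) [:of_nat D, - 1:])
     = trapezoid l u D (\<lambda>t. hom_eval m \<alpha> (- t) (of_nat D)) - hom_integral m \<alpha> * of_nat D ^ Suc m / of_nat l"
    and "poly (p D) t = hom_eval m \<alpha> (- t) (of_nat D)"
proof -
  define G where "G = (\<Sum>i\<le>m. monom (\<alpha> i * (- 1) ^ i * of_nat D ^ (m - i) / of_nat (Suc i)) (Suc i))"
  have pG: "p D = pderiv G"
    unfolding p_def G_def pderiv_sum_poly pderiv_monom by (rule sum.cong) (simp_all del: of_nat_Suc)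
  have poly_p: "poly (p D) t = hom_eval m \<alpha> (- t) (of_nat D)" for t
    unfolding p_def hom_eval_def poly_sum poly_monom
    by (rule sum.cong) (simp_all add: power_minus[of t] mult_ac)
  have "poly G (of_nat D) - poly G 0 = hom_integral m \<alpha> * of_nat D ^ Suc m"
    unfolding G_def hom_integral_def poly_sum poly_monom sum_distrib_right
    by (simp del: of_nat_Suc, rule sum.cong)
       (simp_all add: mult_ac flip: power_add power_Suc)
  then show "reg_sum l u (p D) + reg_sum l (int D - u) (pcompose (p D) [:of_nat D, - 1:])
     = trapezoid l u D (\<lambda>t. hom_eval m \<alpha> (- t) (of_nat D)) - hom_integral m \<alpha> * of_nat D ^ Suc m / of_nat l"
    using reg_sum_reflect[OF l, of u G D] unfolding pG[symmetric] poly_p by simp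
  show "poly (p D) t = hom_eval m \<alpha> (- t) (of_nat D)" by (rule poly_p)
qed

lemma hom_eval_minus: "hom_eval m \<alpha> (- x) (- y) = (- 1) ^ m * hom_eval m \<alpha> x y"
  unfolding hom_eval_def sum_distrib_left
proof (rule sum.cong)
  fix i assume "i \<in> {..m}"
  then have "(- 1 :: complex) ^ m = (- 1) ^ i * (- 1) ^ (m - i)" by (simp flip: power_add)
  then show "\<alpha> i * (- x) ^ i * (- y) ^ (m - i) = (- 1) ^ m * (\<alpha> i * x ^ i * y ^ (m - i))"
    by (simp add: power_minus[of x] power_minus[of y] mult_ac)
qed simp

text \<open>A frequency s D in the class v meets the constants of the class u in one product and
  those of the class w in the next. Both contributions are regularised sums of the same polynomial,
  and since u + v + w = 0, the substitution of - s D - t for t exchanges the classes u and w. This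
  is the situation of \<open>reg_sum_reflect\<close>.\<close>

lemma cross_term:
  fixes \<alpha> \<beta> :: "nat \<Rightarrow> complex" and m D :: nat
  assumes l: "l > 0" and uvw: "[u + v + w = 0] (mod int l)"
      and \<alpha>\<beta>: "\<And>x y. hom_eval m \<alpha> x y = hom_eval m \<beta> y (- x - y)"
  defines "e \<equiv> \<lambda>s. residue_ind l v (s * int D) * ((\<Sum>i\<le>m. \<alpha> i * moment l u i * of_int (s * int D) ^ (m - i))
                       + (\<Sum>i\<le>m. \<beta> i * of_int (s * int D) ^ i * moment l w (m - i)))"
  shows "e 1 = residue_ind l v (int D) * (hom_integral m \<alpha> * of_nat D ^ Suc m / of_nat l
            - trapezoid l (- u) D (\<lambda>t. hom_eval m \<alpha> (- t) (of_nat D)))"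
    and "e (- 1) = residue_ind l v (- int D) * ((- 1) ^ m * (trapezoid l u D (\<lambda>t. hom_eval m \<alpha> (- t) (of_nat D))
            - hom_integral m \<alpha> * of_nat D ^ Suc m / of_nat l))"
proof -
  define p where "p = (\<Sum>i\<le>m. monom (\<alpha> i * (- 1) ^ i * of_nat D ^ (m - i)) i)"
  define PA where "PA = (\<lambda>d. \<Sum>i\<le>m. monom (\<alpha> i * d ^ (m - i)) i)"
  define PB where "PB = (\<lambda>d. \<Sum>i\<le>m. monom (\<beta> i * d ^ i) (m - i))"
  note refl = reg_sum_hom_reflect(1)[OF l, where \<alpha> = \<alpha> and m = m and D = D, folded p_def]
  have poly_p: "poly p t = hom_eval m \<alpha> (- t) (of_nat D)" for t
    unfolding p_def by (rule reg_sum_hom_reflect(2)[OF l])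
  have poly_PA: "poly (PA d) t = hom_eval m \<alpha> t d" for d t
    unfolding PA_def hom_eval_def poly_sum poly_monom by (rule sum.cong) simp_all
  have poly_PB: "poly (PB d) t = hom_eval m \<alpha> (- d - t) d" for d t
    unfolding \<alpha>\<beta> by (simp add: PB_def hom_eval_def poly_sum poly_monom)
  have e: "e s = residue_ind l v (s * int D) * (reg_sum l u (PA (of_int (s * int D))) + reg_sum l w (PB (of_int (s * int D))))" for s
    by (simp add: e_def PA_def PB_def reg_sum_sum reg_sum_monom mult_ac)
  show "e 1 = residue_ind l v (int D) * (hom_integral m \<alpha> * of_nat D ^ Suc m / of_nat l
            - trapezoid l (- u) D (\<lambda>t. hom_eval m \<alpha> (- t) (of_nat D)))"
  proof (cases "int l dvd int D - v")
    case True
    moreover have "int l dvd u + v + w" using uvw by (simp add: cong_0_iff)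
    ultimately have "int l dvd - (u + v + w + (int D - v))" by (simp only: dvd_minus_iff dvd_add)
    also have "- (u + v + w + (int D - v)) = - w - (int D - - u)" by simp
    \<comment> \<open>The double minus is kept because \<open>reg_sum_reflect\<close> is applied to
      the class - u.\<close>
    finally have "[- w = int D - - u] (mod int l)" by (simp only: cong_iff_dvd_diff)
    note w = reg_sum_cong[OF l this]
    have "PA (of_nat D) = pcompose p [:0, - 1:]"
      unfolding poly_eq_poly_eq_iff[symmetric] fun_eq_iff by (simp add: poly_PA poly_p poly_pcompose)
    then have 1: "reg_sum l u (PA (of_nat D)) = - reg_sum l (- u) p"
      using reg_sum_minus[OF l, of "- u" p] by simp
    have "PB (of_nat D) = pcompose (pcompose p [:of_nat D, - 1:]) [:0, - 1:]"
      unfolding poly_eq_poly_eq_iff[symmetric] fun_eq_iff by (simp add: poly_PB poly_p poly_pcompose)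
    then have 2: "reg_sum l w (PB (of_nat D)) = - reg_sum l (int D - - u) (pcompose p [:of_nat D, - 1:])"
      using reg_sum_minus[OF l, of "- w" "pcompose p [:of_nat D, - 1:]"] by (simp add: w)
    have "reg_sum l u (PA (of_nat D)) + reg_sum l w (PB (of_nat D))
        = - (reg_sum l (- u) p + reg_sum l (int D - - u) (pcompose p [:of_nat D, - 1:]))"
      unfolding 1 2 by simp
    also have "\<dots> = hom_integral m \<alpha> * of_nat D ^ Suc m / of_nat l
            - trapezoid l (- u) D (\<lambda>t. hom_eval m \<alpha> (- t) (of_nat D))"
      unfolding refl by (rule minus_diff_eq)
    finally show ?thesis by (simp add: e)
  qed (simp add: e residue_ind_def)
  show "e (- 1) = residue_ind l v (- int D) * ((- 1) ^ m * (trapezoid l u D (\<lambda>t. hom_eval m \<alpha> (- t) (of_nat D))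
            - hom_integral m \<alpha> * of_nat D ^ Suc m / of_nat l))"
  proof (cases "int l dvd - int D - v")
    case True
    moreover have "int l dvd u + v + w" using uvw by (simp add: cong_0_iff)
    ultimately have "int l dvd (u + v + w + (- int D - v))" by (simp only: dvd_add)
    also have "(u + v + w + (- int D - v)) = w - (int D - u)" by simp
    finally have "[w = int D - u] (mod int l)" by (simp only: cong_iff_dvd_diff)
    note w = reg_sum_cong[OF l this]
    have 1: "PA (- of_nat D) = Polynomial.smult ((- 1) ^ m) p"
      unfolding poly_eq_poly_eq_iff[symmetric] fun_eq_iff
      using hom_eval_minus[of m \<alpha> "- t" "of_nat D" for t] by (simp add: poly_PA poly_p)
    have 2: "PB (- of_nat D) = Polynomial.smult ((- 1) ^ m) (pcompose p [:of_nat D, - 1:])"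
      unfolding poly_eq_poly_eq_iff[symmetric] fun_eq_iff
      using hom_eval_minus[of m \<alpha> "- (of_nat D - t)" "of_nat D" for t] by (simp add: poly_PB poly_p poly_pcompose)
    show ?thesis unfolding refl[of u, symmetric] by (simp add: e 1 2 w reg_sum_smult distrib_left)
  qed (simp add: e residue_ind_def)
qed

lemma sum_trapezoid:
  fixes f :: "nat \<Rightarrow> complex"
  assumes "D > 0"
  shows "(\<Sum>A<D. (f A + f (Suc A)) / 2) = (\<Sum>A\<in>{0<..<D}. f A) + f 0 / 2 + f D / 2"
  using assms
proof (induction D rule: nat_induct_non_zero)
  case (Suc D)
  have "{0<..<Suc D} = insert D {0<..<D}" using Suc by auto
  then show ?case using Suc by (simp add: add_divide_distrib)
qed (auto intro!: sum.neutral)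

text \<open>The endpoint terms of the trapezoidal sum have weight \<open>1 / 2\<close>; the one at \<open>(- D, D)\<close> is an axis
  term of the next form in the cyclic order.\<close>

lemma trapezoid_char_form:
  assumes D: "D > 0" and H: "\<And>x y. char_form l m \<alpha> u v x y = H (- x - y) x"
  shows "residue_ind l v (int D) * trapezoid l (- u) D (\<lambda>t. hom_eval m \<alpha> (- t) (of_nat D))
      + residue_ind l v (- int D) * ((- 1) ^ m * trapezoid l u D (\<lambda>t. hom_eval m \<alpha> (- t) (of_nat D)))
     = antidiagonal_sum (char_form l m \<alpha> u v) D + axis_sum (char_form l m \<alpha> u v) D / 2 + axis_sum H D / 2"
proof -
  define F where "F = char_form l m \<alpha> u v"
  define f where "f = (\<lambda>A. F (- int A) (int D) + F (int A) (- int D))"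
  have r: "of_bool (int l dvd - u - int A) = residue_ind l u (- int A)"
    "of_bool (int l dvd u - int A) = residue_ind l u (int A)" for A
  proof -
    have "- u - int A = - int A - u" "u - int A = - (int A - u)" by simp_all
    then show "of_bool (int l dvd - u - int A) = residue_ind l u (- int A)"
      "of_bool (int l dvd u - int A) = residue_ind l u (int A)"
      by (simp_all only: residue_ind_def dvd_minus_iff)
  qed
  have h: "(- 1) ^ m * hom_eval m \<alpha> (- of_nat A) (of_nat D) = hom_eval m \<alpha> (of_nat A) (- of_nat D)" for A
    using hom_eval_minus[of m \<alpha> "- of_nat A" "of_nat D"] by simp
  have "residue_ind l v (int D) * trapezoid l (- u) D (\<lambda>t. hom_eval m \<alpha> (- t) (of_nat D))
      + residue_ind l v (- int D) * ((- 1) ^ m * trapezoid l u D (\<lambda>t. hom_eval m \<alpha> (- t) (of_nat D)))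
     = (\<Sum>A<D. (f A + f (Suc A)) / 2)"
    unfolding trapezoid_def r sum_distrib_left sum.distrib[symmetric]
  proof (rule sum.cong)
    fix A
    have f: "f A = residue_ind l v (int D) * (residue_ind l u (- int A) * hom_eval m \<alpha> (- of_nat A) (of_nat D))
       + residue_ind l v (- int D) * (residue_ind l u (int A) * ((- 1) ^ m * hom_eval m \<alpha> (- of_nat A) (of_nat D)))" for A
      unfolding h by (simp add: f_def F_def char_form_def)
    show "residue_ind l v (int D) * ((residue_ind l u (- int A) * hom_eval m \<alpha> (- of_nat A) (of_nat D)
         + residue_ind l u (- int (Suc A)) * hom_eval m \<alpha> (- of_nat (Suc A)) (of_nat D)) / 2)
      + residue_ind l v (- int D) * ((- 1) ^ m * ((residue_ind l u (int A) * hom_eval m \<alpha> (- of_nat A) (of_nat D)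
         + residue_ind l u (int (Suc A)) * hom_eval m \<alpha> (- of_nat (Suc A)) (of_nat D)) / 2))
      = (f A + f (Suc A)) / 2"
      unfolding f by (simp add: algebra_simps add_divide_distrib del: of_nat_Suc)
  qed simp
  also have "\<dots> = (\<Sum>A\<in>{0<..<D}. f A) + f 0 / 2 + f D / 2"
    by (rule sum_trapezoid[OF D])
  also have "f 0 = axis_sum F D" by (simp add: f_def axis_sum_def)
  also have "f D = axis_sum H D"
    using H[of "- int D" "int D"] H[of "int D" "- int D"] by (simp add: f_def axis_sum_def F_def)
  finally show ?thesis by (simp add: antidiagonal_sum_def f_def F_def)
qed

text \<open>i is the exponent of the frequency of the first factor, as in \<open>hom_eval\<close>;
  every summand has weight m + 2.\<close>

definition stilde_product :: "nat \<Rightarrow> nat \<Rightarrow> (nat \<Rightarrow> complex) \<Rightarrow> int \<Rightarrow> int \<Rightarrow> complex fps" where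
  "stilde_product l m \<alpha> u v = (\<Sum>i\<le>m. fps_const (\<alpha> i) * (stilde_fps l (Suc i) u * stilde_fps l (Suc (m - i)) v))"

lemma stilde_product_nth:
  assumes l: "l > 0" and n: "n > 0"
  shows "fps_nth (stilde_product l m \<alpha> u v) n
     = signed_sum n (char_form l m \<alpha> u v)
      + (\<Sum>i\<le>m. \<alpha> i * moment l u i * eisenstein_coeff l (Suc (m - i)) v n)
      + (\<Sum>i\<le>m. \<alpha> i * eisenstein_coeff l (Suc i) u n * moment l v (m - i))"
proof -
  have nth: "fps_nth (stilde_fps l (Suc i) u * stilde_fps l (Suc j) v) n
     = moment l u i * eisenstein_coeff l (Suc j) v n + eisenstein_coeff l (Suc i) u n * moment l v j
      + (\<Sum>p\<in>{0<..<n}. eisenstein_coeff l (Suc i) u p * eisenstein_coeff l (Suc j) v (n - p))" for i j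
  proof -
    have "{0..n} = insert 0 (insert n {0<..<n})" using n by auto
    moreover have "(\<Sum>p\<in>{0<..<n}. fps_nth (stilde_fps l (Suc i) u) p * fps_nth (stilde_fps l (Suc j) v) (n - p))
       = (\<Sum>p\<in>{0<..<n}. eisenstein_coeff l (Suc i) u p * eisenstein_coeff l (Suc j) v (n - p))"
      by (rule sum.cong) (auto simp: stilde_fps_nth[OF l])
    ultimately show ?thesis
      using n by (simp add: fps_mult_nth stilde_fps_nth[OF l] moment_def)
  qed
  show ?thesis
    unfolding stilde_product_def fps_sum_nth fps_mult_left_const_nth nth pure_part[symmetric] distrib_left sum.distrib
    by (simp add: mult_ac)
qed

text \<open>\<open>cross_term\<close> summed over the divisors, with the signs of
  \<open>eisenstein_coeff_eq\<close>: the integrals combine to a coefficient of weight m + 2, the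
  trapezoids to interior terms of weight 1 and axis terms of weight 1 / 2.\<close>

lemma cross_sum:
  assumes l: "l > 0" and uvw: "[u + v + w = 0] (mod int l)" and n: "n > 0"
      and \<alpha>\<beta>: "\<And>x y. hom_eval m \<alpha> x y = hom_eval m \<beta> y (- x - y)"
      and H: "\<And>x y. char_form l m \<alpha> u v x y = H (- x - y) x"
  shows "(\<Sum>i\<le>m. \<alpha> i * moment l u i * eisenstein_coeff l (Suc (m - i)) v n)
      + (\<Sum>i\<le>m. \<beta> i * eisenstein_coeff l (Suc i) v n * moment l w (m - i))
     = hom_integral m \<alpha> / of_nat l * eisenstein_coeff l (Suc (Suc m)) v n
      - (\<Sum>D | D dvd n. antidiagonal_sum (char_form l m \<alpha> u v) D
           + axis_sum (char_form l m \<alpha> u v) D / 2 + axis_sum H D / 2)"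
proof -
  define E where "E = (\<lambda>D s. residue_ind l v (s * int D) * ((\<Sum>i\<le>m. \<alpha> i * moment l u i * of_int (s * int D) ^ (m - i))
                       + (\<Sum>i\<le>m. \<beta> i * of_int (s * int D) ^ i * moment l w (m - i))))"
  define T where "T = (\<lambda>D. residue_ind l v (int D) * trapezoid l (- u) D (\<lambda>t. hom_eval m \<alpha> (- t) (of_nat D))
      + residue_ind l v (- int D) * ((- 1) ^ m * trapezoid l u D (\<lambda>t. hom_eval m \<alpha> (- t) (of_nat D))))"
  have "(\<Sum>i\<le>m. \<alpha> i * moment l u i * eisenstein_coeff l (Suc (m - i)) v n)
      + (\<Sum>i\<le>m. \<beta> i * eisenstein_coeff l (Suc i) v n * moment l w (m - i))
     = (\<Sum>D | D dvd n. \<Sum>i\<le>m. \<alpha> i * moment l u i * (residue_ind l v (int D) * of_nat D ^ (m - i) - residue_ind l v (- int D) * (- of_nat D) ^ (m - i)))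
      + (\<Sum>D | D dvd n. \<Sum>i\<le>m. \<beta> i * (residue_ind l v (int D) * of_nat D ^ i - residue_ind l v (- int D) * (- of_nat D) ^ i) * moment l w (m - i))"
    unfolding eisenstein_coeff_eq sum_distrib_left sum_distrib_right
    by (rule arg_cong2[where f = "(+)"]; rule sum.swap)
  also have "\<dots> = (\<Sum>D | D dvd n. E D 1 - E D (- 1))"
    unfolding sum.distrib[symmetric]
  proof (rule sum.cong)
    fix D
    have "of_int (- 1 * int D) = (- of_nat D :: complex)" by simp
    then have "E D 1 - E D (- 1) = (\<Sum>i\<le>m. residue_ind l v (int D) * (\<alpha> i * moment l u i * of_nat D ^ (m - i))
         - residue_ind l v (- int D) * (\<alpha> i * moment l u i * (- of_nat D) ^ (m - i)))
       + (\<Sum>i\<le>m. residue_ind l v (int D) * (\<beta> i * of_nat D ^ i * moment l w (m - i))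
         - residue_ind l v (- int D) * (\<beta> i * (- of_nat D) ^ i * moment l w (m - i)))"
      unfolding sum_subtractf sum_distrib_left[symmetric] by (simp only: E_def) (simp add: distrib_left)
    also have "\<dots> = (\<Sum>i\<le>m. \<alpha> i * moment l u i * (residue_ind l v (int D) * of_nat D ^ (m - i) - residue_ind l v (- int D) * (- of_nat D) ^ (m - i))
      + \<beta> i * (residue_ind l v (int D) * of_nat D ^ i - residue_ind l v (- int D) * (- of_nat D) ^ i) * moment l w (m - i))"
      unfolding sum.distrib[symmetric] by (rule sum.cong) (simp_all add: algebra_simps)
    finally show "(\<Sum>i\<le>m. \<alpha> i * moment l u i * (residue_ind l v (int D) * of_nat D ^ (m - i) - residue_ind l v (- int D) * (- of_nat D) ^ (m - i))
      + \<beta> i * (residue_ind l v (int D) * of_nat D ^ i - residue_ind l v (- int D) * (- of_nat D) ^ i) * moment l w (m - i))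
      = E D 1 - E D (- 1)" ..
  qed simp
  also have "\<dots> = (\<Sum>D | D dvd n. hom_integral m \<alpha> / of_nat l *
      (residue_ind l v (int D) * of_nat D ^ Suc m - residue_ind l v (- int D) * (- of_nat D) ^ Suc m) - T D)"
  proof (rule sum.cong)
    fix D
    have "E D 1 - E D (- 1) = residue_ind l v (int D) * (hom_integral m \<alpha> * of_nat D ^ Suc m / of_nat l
            - trapezoid l (- u) D (\<lambda>t. hom_eval m \<alpha> (- t) (of_nat D)))
       - residue_ind l v (- int D) * ((- 1) ^ m * (trapezoid l u D (\<lambda>t. hom_eval m \<alpha> (- t) (of_nat D))
            - hom_integral m \<alpha> * of_nat D ^ Suc m / of_nat l))"
      unfolding E_def cross_term[OF l uvw \<alpha>\<beta>] ..
    also have "\<dots> = hom_integral m \<alpha> / of_nat l *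
      (residue_ind l v (int D) * of_nat D ^ Suc m - residue_ind l v (- int D) * (- of_nat D) ^ Suc m) - T D"
      by (simp add: T_def power_minus[of "of_nat D :: complex"] algebra_simps)
    finally show "E D 1 - E D (- 1) = hom_integral m \<alpha> / of_nat l *
      (residue_ind l v (int D) * of_nat D ^ Suc m - residue_ind l v (- int D) * (- of_nat D) ^ Suc m) - T D" .
  qed simp
  also have "\<dots> = hom_integral m \<alpha> / of_nat l * eisenstein_coeff l (Suc (Suc m)) v n - (\<Sum>D | D dvd n. T D)"
    unfolding eisenstein_coeff_eq sum_distrib_left by (rule sum_subtractf)
  also have "(\<Sum>D | D dvd n. T D) = (\<Sum>D | D dvd n. antidiagonal_sum (char_form l m \<alpha> u v) D
           + axis_sum (char_form l m \<alpha> u v) D / 2 + axis_sum H D / 2)"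
  proof (rule sum.cong)
    fix D assume "D \<in> {D. D dvd n}"
    then have "D > 0" using n by (auto intro: dvd_pos_nat)
    from trapezoid_char_form[OF this H] show "T D = antidiagonal_sum (char_form l m \<alpha> u v) D
           + axis_sum (char_form l m \<alpha> u v) D / 2 + axis_sum H D / 2" by (simp only: T_def)
  qed simp
  finally show ?thesis .
qed

text \<open>At first variable 0 only \<alpha> 0 y^m is left, and (n / D) D^m = n D^(m - 1): a
  coefficient of weight m times n, hence one of a derivative.\<close>

lemma axis_sum_char_form:
  assumes m: "m > 0" and n: "n > 0"
  shows "(\<Sum>D | D dvd n. of_nat (n div D) * axis_sum (char_form l m \<alpha> u v) D)
     = residue_ind l u 0 * \<alpha> 0 * (of_nat n * eisenstein_coeff l m v n)"
proof -
  obtain m' where m': "m = Suc m'" using m by (cases m) auto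
  have h: "hom_eval m \<alpha> 0 y = \<alpha> 0 * y ^ m" for y
  proof -
    have "hom_eval m \<alpha> 0 y = (\<Sum>i\<le>m. if i = 0 then \<alpha> 0 * y ^ m else 0)"
      unfolding hom_eval_def by (rule sum.cong) auto
    then show ?thesis by simp
  qed
  show ?thesis
    unfolding m' eisenstein_coeff_eq sum_distrib_left
  proof (rule sum.cong)
    fix D assume "D \<in> {D. D dvd n}"
    then have "of_nat (n div D) * of_nat D = (of_nat n :: complex)"
      by (metis dvd_div_mult_self mem_Collect_eq of_nat_mult)
    then have *: "of_nat (n div D) * (of_nat D * z) = of_nat n * z" for z :: complex
      by (metis mult.assoc)
    show "of_nat (n div D) * axis_sum (char_form l (Suc m') \<alpha> u v) D = residue_ind l u 0 * \<alpha> 0 *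
      (of_nat n * (residue_ind l v (int D) * of_nat D ^ m' - residue_ind l v (- int D) * (- of_nat D) ^ m'))"
      by (simp add: axis_sum_def char_form_def h[unfolded m'] flip: *) (simp add: algebra_simps)
  qed simp
qed

text \<open>The interior terms of the Euclidean part and of the trapezoids are opposite. An axis
  term has multiplicity - (n / D - 1) in the former and is the end of two trapezoids, with - 1 / 2
  each; the total - n / D is what \<open>axis_sum_char_form\<close> evaluates.\<close>

theorem three_term_coeff:
  assumes l: "l > 0" and m: "m > 0" and uvw: "[u + v + w = 0] (mod int l)" and n: "n > 0"
      and \<alpha>\<beta>: "\<And>x y. hom_eval m \<alpha> x y = hom_eval m \<beta> y (- x - y)"
      and \<alpha>\<gamma>: "\<And>x y. hom_eval m \<alpha> x y = hom_eval m \<gamma> (- x - y) x"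
  shows "fps_nth (stilde_product l m \<alpha> u v + stilde_product l m \<beta> v w + stilde_product l m \<gamma> w u) n
     = hom_integral m \<alpha> / of_nat l * eisenstein_coeff l (Suc (Suc m)) v n
      + hom_integral m \<beta> / of_nat l * eisenstein_coeff l (Suc (Suc m)) w n
      + hom_integral m \<gamma> / of_nat l * eisenstein_coeff l (Suc (Suc m)) u n
      - (residue_ind l u 0 * \<alpha> 0 * (of_nat n * eisenstein_coeff l m v n)
         + residue_ind l v 0 * \<beta> 0 * (of_nat n * eisenstein_coeff l m w n)
         + residue_ind l w 0 * \<gamma> 0 * (of_nat n * eisenstein_coeff l m u n))"
proof -
  define F where "F = char_form l m \<alpha> u v"
  define G where "G = char_form l m \<beta> v w"
  define H where "H = char_form l m \<gamma> w u"
  have \<beta>\<gamma>: "hom_eval m \<beta> x y = hom_eval m \<gamma> y (- x - y)" for x y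
    using \<alpha>\<beta>[of "- x - y" x] \<alpha>\<gamma>[of "- x - y" x] by simp
  have \<gamma>\<alpha>: "hom_eval m \<gamma> x y = hom_eval m \<alpha> y (- x - y)" for x y
    using \<alpha>\<gamma>[of y "- x - y"] by simp
  have vwu: "[v + w + u = 0] (mod int l)" "[w + u + v = 0] (mod int l)"
    using uvw by (simp_all add: add_ac)
  \<comment> \<open>Once x lies in its class, y lies in its own exactly when - x - y lies in the
    third.\<close>
  have res: "residue_ind l b y = residue_ind l c (- x - y)"
    if "int l dvd x - a" "[a + b + c = 0] (mod int l)" for a b c x y
  proof -
    have "int l dvd a + b + c" using that(2) by (simp add: cong_0_iff)
    then have "int l dvd - ((y - b) + ((x - a) + (a + b + c))) \<longleftrightarrow> int l dvd y - b"
      using that(1) by (simp only: dvd_minus_iff dvd_add_left_iff dvd_add)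
    also have "- ((y - b) + ((x - a) + (a + b + c))) = - x - y - c" by simp
    finally have "int l dvd - x - y - c \<longleftrightarrow> int l dvd y - b" .
    then show ?thesis by (simp add: residue_ind_def)
  qed
  \<comment> \<open>So the three forms, indicators included, are one function on the triples of sum
    0, and the combinatorial identity applies.\<close>
  have cyc: "char_form l m A a b x y = char_form l m B b c y (- x - y)"
    if "[a + b + c = 0] (mod int l)" "\<And>x y. hom_eval m A x y = hom_eval m B y (- x - y)" for A B a b c x y
  proof -
    have "residue_ind l a x * residue_ind l b y = residue_ind l b y * residue_ind l c (- x - y)"
    proof (cases "int l dvd y - b")
      case True
      have "[b + a + c = 0] (mod int l)" using that(1) by (simp add: add_ac)
      from res[OF True this, of x] have "residue_ind l a x = residue_ind l c (- y - x)" .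
      also have "- y - x = - x - y" by simp
      finally show ?thesis by simp
    qed (simp add: residue_ind_def)
    then show ?thesis using that(2)[of "of_int x" "of_int y"] by (simp add: char_form_def)
  qed
  have FG: "F x y = G y (- x - y)" and GH: "G x y = H y (- x - y)" and HF: "H x y = F y (- x - y)" for x y
    unfolding F_def G_def H_def
    using cyc[OF uvw \<alpha>\<beta>] cyc[OF vwu(1) \<beta>\<gamma>] cyc[OF vwu(2) \<gamma>\<alpha>] by blast+
  have FH: "F x y = H (- x - y) x" and GF: "G x y = F (- x - y) x" and HG: "H x y = G (- x - y) x" for x y
    using HF[of "- x - y" x] FG[of "- x - y" x] GH[of "- x - y" x] by simp_all
  define S where "S = (\<lambda>D. axis_sum F D + axis_sum G D + axis_sum H D)"
  define A where "A = (\<lambda>D. antidiagonal_sum F D + antidiagonal_sum G D + antidiagonal_sum H D)"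
  have "fps_nth (stilde_product l m \<alpha> u v + stilde_product l m \<beta> v w + stilde_product l m \<gamma> w u) n
     = (signed_sum n F + signed_sum n G + signed_sum n H)
      + (((\<Sum>i\<le>m. \<alpha> i * moment l u i * eisenstein_coeff l (Suc (m - i)) v n)
        + (\<Sum>i\<le>m. \<beta> i * eisenstein_coeff l (Suc i) v n * moment l w (m - i)))
      + ((\<Sum>i\<le>m. \<beta> i * moment l v i * eisenstein_coeff l (Suc (m - i)) w n)
        + (\<Sum>i\<le>m. \<gamma> i * eisenstein_coeff l (Suc i) w n * moment l u (m - i)))
      + ((\<Sum>i\<le>m. \<gamma> i * moment l w i * eisenstein_coeff l (Suc (m - i)) u n)
        + (\<Sum>i\<le>m. \<alpha> i * eisenstein_coeff l (Suc i) u n * moment l v (m - i))))"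
    unfolding fps_add_nth stilde_product_nth[OF l n] F_def G_def H_def by (simp only: add_ac)
  also have "\<dots> = (\<Sum>D | D dvd n. A D) - (\<Sum>D | D dvd n. of_nat (n div D - 1) * S D)
      + ((hom_integral m \<alpha> / of_nat l * eisenstein_coeff l (Suc (Suc m)) v n
           - (\<Sum>D | D dvd n. antidiagonal_sum F D + axis_sum F D / 2 + axis_sum H D / 2))
       + (hom_integral m \<beta> / of_nat l * eisenstein_coeff l (Suc (Suc m)) w n
           - (\<Sum>D | D dvd n. antidiagonal_sum G D + axis_sum G D / 2 + axis_sum F D / 2))
       + (hom_integral m \<gamma> / of_nat l * eisenstein_coeff l (Suc (Suc m)) u n
           - (\<Sum>D | D dvd n. antidiagonal_sum H D + axis_sum H D / 2 + axis_sum G D / 2)))"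
    unfolding signed_sum_three_term[where F = F and G = G and H = H, OF n FG FH] A_def S_def
      cross_sum[OF l uvw n \<alpha>\<beta> FH[unfolded F_def], folded F_def]
      cross_sum[OF l vwu(1) n \<beta>\<gamma> GF[unfolded G_def], folded G_def]
      cross_sum[OF l vwu(2) n \<gamma>\<alpha> HG[unfolded H_def], folded H_def] ..
  also have "\<dots> = hom_integral m \<alpha> / of_nat l * eisenstein_coeff l (Suc (Suc m)) v n
      + hom_integral m \<beta> / of_nat l * eisenstein_coeff l (Suc (Suc m)) w n
      + hom_integral m \<gamma> / of_nat l * eisenstein_coeff l (Suc (Suc m)) u n
      - ((\<Sum>D | D dvd n. of_nat (n div D - 1) * S D) + (\<Sum>D | D dvd n. S D))"
  proof -
    have "(\<Sum>D | D dvd n. antidiagonal_sum F D + axis_sum F D / 2 + axis_sum H D / 2)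
       + (\<Sum>D | D dvd n. antidiagonal_sum G D + axis_sum G D / 2 + axis_sum F D / 2)
       + (\<Sum>D | D dvd n. antidiagonal_sum H D + axis_sum H D / 2 + axis_sum G D / 2)
      = (\<Sum>D | D dvd n. A D + S D)"
      unfolding sum.distrib[symmetric] by (rule sum.cong) (simp_all add: A_def S_def)
    moreover have "a - b + ((x - s) + (y - t) + (z - r)) = x + y + z - (b + c)"
      if "s + t + r = a + c" for a b c x y z s t r :: complex
    proof -
      have "a = s + t + r - c" using that by simp
      then show ?thesis by simp
    qed
    ultimately show ?thesis unfolding sum.distrib[of A] by blast
  qed
  also have "(\<Sum>D | D dvd n. of_nat (n div D - 1) * S D) + (\<Sum>D | D dvd n. S D) = (\<Sum>D | D dvd n. of_nat (n div D) * S D)"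
    unfolding sum.distrib[symmetric]
  proof (rule sum.cong)
    fix D assume "D \<in> {D. D dvd n}"
    then have "n div D \<ge> 1" using n by (auto elim!: dvdE simp: Suc_le_eq)
    then show "of_nat (n div D - 1) * S D + S D = of_nat (n div D) * S D"
      by (simp add: of_nat_diff algebra_simps)
  qed simp
  also have "\<dots> = residue_ind l u 0 * \<alpha> 0 * (of_nat n * eisenstein_coeff l m v n)
         + residue_ind l v 0 * \<beta> 0 * (of_nat n * eisenstein_coeff l m w n)
         + residue_ind l w 0 * \<gamma> 0 * (of_nat n * eisenstein_coeff l m u n)"
    unfolding S_def F_def G_def H_def distrib_left sum.distrib axis_sum_char_form[OF m n] ..
  finally show ?thesis .
qed

section \<open>Quasimodularity along a family of matrices\<close>

text \<open>The anomaly c / (2 pi i J) of weight two, multiplied by J^2, becomes e c J; in the other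
  weights the e constructed here is 0.\<close>

lemma stilde_Gamma1:
  assumes l: "l > 0" and j: "j \<ge> 1"
  obtains e where "\<And>a' b c d \<tau>. \<lbrakk>(a', b, c, d) \<in> Gamma1 l; \<tau> \<in> upper_half_plane\<rbrakk> \<Longrightarrow>
     stilde l j a (mobius (a', b, c, d) \<tau>) = (of_int c * \<tau> + of_int d) ^ j * stilde l j a \<tau> + e * of_int c * (of_int c * \<tau> + of_int d)"
proof
  define C where "C = (\<lambda>b. - exp (of_int (- a) * torsion l b) / of_nat l)"
  define \<kappa> :: complex where "\<kappa> = (if j = 2 then 1 / (2 * of_real pi * \<i>) else 0)"
  note r = fps_conv_radius_cmult_ge[OF eis_fps_conv_radius]
  have f: "stilde l j a \<tau> = (\<Sum>b<l. C b * eis l j b \<tau>)" if "\<tau> \<in> upper_half_plane" for \<tau>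
    using j that
    by (simp add: stilde_eq_from_q[OF l j] stilde_fps_def C_def conjunct2[OF from_q_sum[OF r]] from_q_cmult
        eis_fps_conv_radius cscale_def eis_eq_from_q sum_fun_apply)
  fix a' b' c d \<tau> assume \<gamma>: "(a', b', c, d) \<in> Gamma1 l" and \<tau>: "\<tau> \<in> upper_half_plane"
  define J where "J = of_int c * \<tau> + of_int d"
  have SL: "(a', b', c, d) \<in> SL2Z" using \<gamma> by (simp add: Gamma1_def)
  have J: "J \<noteq> 0" unfolding J_def by (rule automorphy_nonzero[OF SL \<tau>])
  have eis: "eis l j b (mobius (a', b', c, d) \<tau>) = J ^ j * eis l j b \<tau> + \<kappa> * of_int c * J" if "b < l" for b
  proof -
    have "eis l j b (mobius (a', b', c, d) \<tau>) = J ^ j * (eis l j b (mobius (a', b', c, d) \<tau>) / J ^ j)"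
      using J by simp
    also have "\<dots> = J ^ j * (eis l j b \<tau> + (if j = 2 then of_int c / (2 * of_real pi * \<i> * J) else 0))"
      unfolding J_def by (subst eis_Gamma1[OF \<gamma> \<tau> j that]) simp
    also have "\<dots> = J ^ j * eis l j b \<tau> + \<kappa> * of_int c * J"
      using J by (simp add: \<kappa>_def distrib_left power2_eq_square mult_ac)
    finally show ?thesis .
  qed
  have "stilde l j a (mobius (a', b', c, d) \<tau>) = (\<Sum>b<l. J ^ j * (C b * eis l j b \<tau>) + C b * \<kappa> * of_int c * J)"
    unfolding f[OF mobius_in_upper_half_plane[OF SL \<tau>]] by (rule sum.cong) (simp_all add: eis algebra_simps)
  also have "\<dots> = J ^ j * stilde l j a \<tau> + (\<Sum>b<l. C b * \<kappa>) * of_int c * J"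
    unfolding f[OF \<tau>] sum.distrib sum_distrib_left sum_distrib_right ..
  finally show "stilde l j a (mobius (a', b', c, d) \<tau>) = (of_int c * \<tau> + of_int d) ^ j * stilde l j a \<tau>
     + (\<Sum>b<l. C b * \<kappa>) * of_int c * (of_int c * \<tau> + of_int d)"
    by (simp only: J_def)
qed

text \<open>The lower left entry is fixed at l, so the anomaly at i is linear in the automorphy
  factor, which runs through the infinitely many values l i + 1 + l n.\<close>

definition Gamma1_rep :: "nat \<Rightarrow> nat \<Rightarrow> int \<times> int \<times> int \<times> int" where
  "Gamma1_rep l n = (1, int n, int l, 1 + int l * int n)"

text \<open>A quasimodular form of positive weight, evaluated along the matrices \<open>Gamma1_rep l n\<close>, is a
  polynomial without constant term in the automorphy factor; a constant form therefore vanishes.\<close>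

definition poly_growth :: "nat \<Rightarrow> (complex \<Rightarrow> complex) \<Rightarrow> bool" where
  "poly_growth l f \<longleftrightarrow> (\<exists>p. poly p 0 = 0 \<and>
     (\<forall>n. f (mobius (Gamma1_rep l n) \<i>) = poly p (of_nat l * \<i> + 1 + of_nat l * of_nat n)))"

lemma Gamma1_rep_in_Gamma1: "Gamma1_rep l n \<in> Gamma1 l"
  by (simp add: Gamma1_rep_def Gamma1_def SL2Z_def cong_iff_dvd_diff algebra_simps)

lemma poly_growth_add: "poly_growth l f \<Longrightarrow> poly_growth l g \<Longrightarrow> poly_growth l (f + g)"
  unfolding poly_growth_def
  by (elim exE, rule_tac x = "p + pa" in exI) auto

lemma poly_growth_mult: "poly_growth l f \<Longrightarrow> poly_growth l g \<Longrightarrow> poly_growth l (f * g)"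
  unfolding poly_growth_def
  by (elim exE, rule_tac x = "p * pa" in exI) auto

lemma poly_growth_cscale: "poly_growth l f \<Longrightarrow> poly_growth l (cscale c f)"
  unfolding poly_growth_def
  by (elim exE, rule_tac x = "Polynomial.smult c p" in exI) (auto simp: cscale_def)

lemma poly_growth_0: "poly_growth l 0"
  unfolding poly_growth_def by (rule exI[of _ 0]) simp

lemma i_in_upper_half_plane: "\<i> \<in> upper_half_plane"
  by (simp add: upper_half_plane_def)

lemma poly_growth_stilde:
  assumes l: "l > 0" and j: "j \<ge> 1"
  shows "poly_growth l (stilde l j a)"
proof -
  obtain e where e: "\<And>a' b c d \<tau>. \<lbrakk>(a', b, c, d) \<in> Gamma1 l; \<tau> \<in> upper_half_plane\<rbrakk> \<Longrightarrow>
     stilde l j a (mobius (a', b, c, d) \<tau>) = (of_int c * \<tau> + of_int d) ^ j * stilde l j a \<tau> + e * of_int c * (of_int c * \<tau> + of_int d)"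
    using stilde_Gamma1[OF assms] by blast
  show ?thesis
    unfolding poly_growth_def
    using e[OF Gamma1_rep_in_Gamma1[unfolded Gamma1_rep_def] i_in_upper_half_plane] j
    by (intro exI[of _ "monom (stilde l j a \<i>) j + monom (e * of_nat l) 1"])
       (simp add: Gamma1_rep_def poly_monom add.assoc mult_ac)
qed

text \<open>The transformation law is differentiated at i. The inner derivative is 1 / J^2 because
  the determinant is 1, so the derivative at the image point is J^2 times a polynomial in J.\<close>

lemma poly_growth_dtau_stilde:
  assumes l: "l > 0" and j: "j \<ge> 1"
  shows "poly_growth l (dtau (stilde l j a))"
proof -
  define f where "f = stilde l j a"
  obtain e where e: "\<And>a' b c d \<tau>. \<lbrakk>(a', b, c, d) \<in> Gamma1 l; \<tau> \<in> upper_half_plane\<rbrakk> \<Longrightarrow>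
     f (mobius (a', b, c, d) \<tau>) = (of_int c * \<tau> + of_int d) ^ j * f \<tau> + e * of_int c * (of_int c * \<tau> + of_int d)"
    using stilde_Gamma1[OF assms] unfolding f_def by blast
  have hol: "f holomorphic_on upper_half_plane"
    unfolding f_def stilde_eq_from_q[OF assms] by (rule from_q_holomorphic[OF stilde_fps_conv_radius])
  have D: "(f has_field_derivative deriv f \<tau>) (at \<tau>)" if "\<tau> \<in> upper_half_plane" for \<tau>
    by (rule holomorphic_derivI[OF hol open_upper_half_plane that])
  have "dtau f (mobius (Gamma1_rep l n) \<i>) = J ^ 2 * (of_nat j * of_nat l * J ^ (j - 1) * f \<i> + J ^ j * deriv f \<i> + e * of_nat l ^ 2)"
    if J: "J = of_nat l * \<i> + 1 + of_nat l * of_nat n" for n J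
  proof -
    define d where "d = 1 + int l * int n"
    have \<gamma>: "(1, int n, int l, d) \<in> Gamma1 l" using Gamma1_rep_in_Gamma1[of l n] by (simp add: Gamma1_rep_def d_def)
    then have SL: "(1, int n, int l, d) \<in> SL2Z" by (simp add: Gamma1_def)
    define g where "g = mobius (1, int n, int l, d)"
    have J': "J = of_nat l * \<i> + of_int d" by (simp add: J d_def)
    have J0: "J \<noteq> 0" using automorphy_nonzero[OF SL i_in_upper_half_plane] by (simp add: J')
    have g_in: "g \<i> \<in> upper_half_plane"
      unfolding g_def by (rule mobius_in_upper_half_plane[OF SL i_in_upper_half_plane])
    have "(g has_field_derivative (1 * J - (\<i> + of_nat n) * of_nat l) / (J * J)) (at \<i>)"
      unfolding g_def mobius_def prod.case J' using J0[unfolded J']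
      by (auto intro!: derivative_eq_intros)
    also have "1 * J - (\<i> + of_nat n) * of_nat l = 1" by (simp add: J algebra_simps)
    finally have "((\<lambda>\<tau>. f (g \<tau>)) has_field_derivative deriv f (g \<i>) * (1 / (J * J))) (at \<i>)"
      by (rule DERIV_chain2[where f = f and g = g and x = \<i>, OF D[OF g_in]])
    moreover have "((\<lambda>\<tau>. (of_nat l * \<tau> + of_int d) ^ j * f \<tau> + e * of_nat l * (of_nat l * \<tau> + of_int d))
       has_field_derivative (of_nat j * of_nat l * J ^ (j - 1) * f \<i> + J ^ j * deriv f \<i> + e * of_nat l ^ 2)) (at \<i>)"
      unfolding J' by (auto intro!: derivative_eq_intros D[OF i_in_upper_half_plane] simp: power2_eq_square algebra_simps)
    then have "((\<lambda>\<tau>. f (g \<tau>)) has_field_derivative (of_nat j * of_nat l * J ^ (j - 1) * f \<i> + J ^ j * deriv f \<i> + e * of_nat l ^ 2)) (at \<i>)"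
      by (rule has_field_derivative_transform_within_open[OF _ open_upper_half_plane i_in_upper_half_plane])
         (simp add: g_def e[OF \<gamma>])
    ultimately have deq: "deriv f (g \<i>) * (1 / (J * J)) = of_nat j * of_nat l * J ^ (j - 1) * f \<i> + J ^ j * deriv f \<i> + e * of_nat l ^ 2"
      by (rule DERIV_unique)
    have "deriv f (g \<i>) = J ^ 2 * (deriv f (g \<i>) * (1 / (J * J)))"
      using J0 by (simp add: power2_eq_square)
    then have "deriv f (g \<i>) = J ^ 2 * (of_nat j * of_nat l * J ^ (j - 1) * f \<i> + J ^ j * deriv f \<i> + e * of_nat l ^ 2)"
      by (simp only: deq)
    then show ?thesis using g_in by (simp add: dtau_def g_def Gamma1_rep_def d_def)
  qed
  then show ?thesis
    unfolding poly_growth_def f_def[symmetric]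
    by (intro exI[of _ "monom 1 2 * (monom (of_nat j * of_nat l * f \<i>) (j - 1) + monom (deriv f \<i>) j + [:e * of_nat l ^ 2:])"])
       (simp add: poly_monom mult_ac)
qed

text \<open>A polynomial taking the value C infinitely often is constant, yet this one vanishes at
  0.\<close>

lemma poly_growth_constant:
  assumes l: "l > 0" and f: "poly_growth l f" and C: "\<And>\<tau>. \<tau> \<in> upper_half_plane \<Longrightarrow> f \<tau> = C"
  shows "C = 0"
proof -
  obtain p where p: "poly p 0 = 0" "\<And>n. f (mobius (Gamma1_rep l n) \<i>) = poly p (of_nat l * \<i> + 1 + of_nat l * of_nat n)"
    using f unfolding poly_growth_def by blast
  define z where "z = (\<lambda>n::nat. of_nat l * \<i> + 1 + of_nat l * of_nat n :: complex)"
  have "inj z" using l by (auto simp: inj_def z_def)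
  then have "infinite (range z)" by (rule range_inj_infinite)
  moreover have "Gamma1_rep l n \<in> SL2Z" for n using Gamma1_rep_in_Gamma1[of l n] by (auto simp: Gamma1_def Gamma1_rep_def)
  then have "poly p (z n) = C" for n
    using p(2)[of n] C[OF mobius_in_upper_half_plane[OF _ i_in_upper_half_plane]] by (simp add: z_def)
  then have "range z \<subseteq> {x. poly (p - [:C:]) x = 0}" by auto
  ultimately have "p - [:C:] = 0" using poly_roots_finite finite_subset by blast
  then have "poly (p - [:C:]) 0 = 0" by simp
  then show ?thesis using p(1) by simp
qed

section \<open>The three-term relation\<close>

lemma eisenstein_subspace_subspace: "cfun.subspace (eisenstein_subspace l k)"
  unfolding eisenstein_subspace_def by (rule cfun.subspace_span)

lemma stilde_in_eisenstein_subspace: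
  assumes l: "l > 0" and k: "k \<ge> 1"
  shows "stilde l k a \<in> eisenstein_subspace l k"
proof -
  have "stilde l k (a mod int l) \<in> eisenstein_subspace l k"
    unfolding eisenstein_subspace_def
    by (intro cfun.span_base UnI1 CollectI exI[of _ "a mod int l"] conjI refl) (use l in simp)
  moreover have "stilde l k a = stilde l k (a mod int l)"
    by (rule stilde_cong[OF assms]) (simp add: cong_def)
  ultimately show ?thesis by (simp only:)
qed

lemma dtau_stilde_in_eisenstein_subspace:
  assumes l: "l > 0" and k: "k \<ge> 3"
  shows "dtau (stilde l (k - 2) a) \<in> eisenstein_subspace l k"
proof -
  have "dtau (stilde l (k - 2) (a mod int l)) \<in> eisenstein_subspace l k"
    unfolding eisenstein_subspace_def
    by (intro cfun.span_base UnI2 CollectI exI[of _ "a mod int l"] conjI refl) (use l in simp)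
  moreover have "stilde l (k - 2) a = stilde l (k - 2) (a mod int l)"
    by (rule stilde_cong[OF l]) (use k in \<open>simp_all add: cong_def\<close>)
  ultimately show ?thesis by (simp only:)
qed

lemma fps_conv_radius_add_ge:
  fixes F G :: "complex fps"
  assumes "fps_conv_radius F \<ge> 1" "fps_conv_radius G \<ge> 1"
  shows "fps_conv_radius (F + G) \<ge> 1"
  by (rule order_trans[OF _ fps_conv_radius_add]) (use assms in simp)

lemma fps_conv_radius_mult_ge:
  fixes F G :: "complex fps"
  assumes "fps_conv_radius F \<ge> 1" "fps_conv_radius G \<ge> 1"
  shows "fps_conv_radius (F * G) \<ge> 1"
  by (rule order_trans[OF _ fps_conv_radius_mult]) (use assms in simp)

lemma stilde_product_conv_radius:
  "fps_conv_radius (stilde_product l m \<alpha> u v) \<ge> 1"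
  and from_q_stilde_product: "l > 0 \<Longrightarrow> from_q (stilde_product l m \<alpha> u v)
     = (\<Sum>i\<le>m. cscale (\<alpha> i) (stilde l (Suc i) u * stilde l (Suc (m - i)) v))"
proof -
  have r: "fps_conv_radius (stilde_fps l (Suc i) u * stilde_fps l (Suc j) v) \<ge> 1" for i j
    by (intro fps_conv_radius_mult_ge stilde_fps_conv_radius)
  note s = from_q_sum[OF fps_conv_radius_cmult_ge[OF r]]
  show "fps_conv_radius (stilde_product l m \<alpha> u v) \<ge> 1"
    unfolding stilde_product_def by (rule conjunct1[OF s])
  assume l: "l > 0"
  show "from_q (stilde_product l m \<alpha> u v) = (\<Sum>i\<le>m. cscale (\<alpha> i) (stilde l (Suc i) u * stilde l (Suc (m - i)) v))"
    unfolding stilde_product_def conjunct2[OF s]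
    by (simp add: from_q_cmult[OF r] from_q_mult stilde_fps_conv_radius stilde_eq_from_q[OF l])
qed

lemma poly_growth_sum: "(\<And>i. i \<in> I \<Longrightarrow> poly_growth l (f i)) \<Longrightarrow> poly_growth l (\<Sum>i\<in>I. f i)"
  by (induction I rule: infinite_finite_induct) (auto simp: poly_growth_0 poly_growth_add)

theorem three_term_relation:
  assumes l: "l > 0" and k: "k \<ge> 3" and uvw: "[u + v + w = 0] (mod int l)"
      and \<alpha>\<beta>: "\<And>x y. hom_eval (k - 2) \<alpha> x y = hom_eval (k - 2) \<beta> y (- x - y)"
      and \<alpha>\<gamma>: "\<And>x y. hom_eval (k - 2) \<alpha> x y = hom_eval (k - 2) \<gamma> (- x - y) x"
  shows "from_q (stilde_product l (k - 2) \<alpha> u v) + from_q (stilde_product l (k - 2) \<beta> v w)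
     + from_q (stilde_product l (k - 2) \<gamma> w u) \<in> eisenstein_subspace l k"
proof -
  define m where "m = k - 2"
  have m: "m > 0" and km: "k = Suc (Suc m)" using k by (simp_all add: m_def)
  note ab = \<alpha>\<beta>[folded m_def] and ag = \<alpha>\<gamma>[folded m_def]
  define X where "X = stilde_product l m \<alpha> u v + stilde_product l m \<beta> v w + stilde_product l m \<gamma> w u"
  define N where "N = (\<lambda>a. fps_X * fps_deriv (stilde_fps l m a))"
  \<comment> \<open>Each triple holds the factor of the weight k series, the factor of the
    derivative and the residue class, so that E and f treat the three summands of
    \<open>three_term_coeff\<close> uniformly.\<close>
  define t1 where "t1 = (hom_integral m \<alpha> / of_nat l, residue_ind l u 0 * \<alpha> 0, v)"
  define t2 where "t2 = (hom_integral m \<beta> / of_nat l, residue_ind l v 0 * \<beta> 0, w)"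
  define t3 where "t3 = (hom_integral m \<gamma> / of_nat l, residue_ind l w 0 * \<gamma> 0, u)"
  define E where "E = (\<lambda>(x, y, a). fps_const x * stilde_fps l k a + fps_const (- y) * N a)"
  define f where "f = (\<lambda>(x, y, a). cscale x (stilde l k a) + cscale (- y / (2 * of_real pi * \<i>)) (dtau (stilde l m a)))"
  have N: "fps_conv_radius (N a) \<ge> 1" for a
    unfolding N_def
    by (intro fps_conv_radius_mult_ge order_trans[OF stilde_fps_conv_radius fps_conv_radius_deriv]) simp
  have dt: "from_q (N a) = cscale (1 / (2 * of_real pi * \<i>)) (dtau (stilde l m a))" for a
    using m by (simp add: N_def stilde_eq_from_q[OF l] dtau_from_q[OF stilde_fps_conv_radius] cscale_def fun_eq_iff)
  have Er: "fps_conv_radius (E t) \<ge> 1" for t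
    unfolding E_def case_prod_unfold
    by (intro fps_conv_radius_add_ge fps_conv_radius_cmult_ge N stilde_fps_conv_radius)
  have Ef: "from_q (E t) = f t" for t
    unfolding E_def f_def case_prod_unfold
    using k by (simp add: from_q_add fps_conv_radius_cmult_ge N stilde_fps_conv_radius from_q_cmult dt
        stilde_eq_from_q[OF l] del: fps_const_neg)
  have fW: "f t \<in> eisenstein_subspace l k" for t
    unfolding f_def case_prod_unfold
    using stilde_in_eisenstein_subspace[OF l, of k] dtau_stilde_in_eisenstein_subspace[OF l k] k
    by (intro cfun.subspace_add cfun.subspace_scale eisenstein_subspace_subspace) (auto simp: m_def)
  have fg: "poly_growth l (f t)" for t
    unfolding f_def case_prod_unfold using m k
    by (intro poly_growth_add poly_growth_cscale poly_growth_stilde poly_growth_dtau_stilde l) auto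
  have Xg: "poly_growth l (from_q (stilde_product l m A a b))" for A a b
    unfolding from_q_stilde_product[OF l]
    by (intro poly_growth_sum poly_growth_cscale poly_growth_mult poly_growth_stilde l) auto
  have Xr: "fps_conv_radius X \<ge> 1" and Xq: "from_q X = from_q (stilde_product l m \<alpha> u v)
      + from_q (stilde_product l m \<beta> v w) + from_q (stilde_product l m \<gamma> w u)"
    unfolding X_def
    by (intro fps_conv_radius_add_ge stilde_product_conv_radius)
       (simp add: from_q_add fps_conv_radius_add_ge stilde_product_conv_radius)
  define R where "R = E t1 + E t2 + E t3"
  have Rr: "fps_conv_radius R \<ge> 1" and Rq: "from_q R = f t1 + f t2 + f t3"
    unfolding R_def by (intro fps_conv_radius_add_ge Er) (simp add: from_q_add fps_conv_radius_add_ge Er Ef)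
  have nth_eq: "fps_nth X n = fps_nth R n" if "n > 0" for n
  proof -
    have "fps_nth (E (x, y, a)) n = x * eisenstein_coeff l (Suc (Suc m)) a n - y * (of_nat n * eisenstein_coeff l m a n)" for x y a
      using that by (simp add: E_def N_def stilde_fps_nth[OF l] km)
    then show ?thesis
      unfolding X_def three_term_coeff[OF l m uvw that ab ag] R_def t1_def t2_def t3_def by simp
  qed
  have const: "from_q X \<tau> - from_q R \<tau> = fps_nth X 0 - fps_nth R 0" if "\<tau> \<in> upper_half_plane" for \<tau>
    by (rule from_q_diff_const[OF Xr Rr _ that]) (rule nth_eq)
  define C where "C = fps_nth X 0 - fps_nth R 0"
  have "poly_growth l (from_q X + cscale (- 1) (from_q R))"
    unfolding Xq Rq by (intro poly_growth_add poly_growth_cscale fg Xg)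
  then have C0: "C = 0"
    by (rule poly_growth_constant[OF l]) (use const in \<open>simp add: cscale_def C_def\<close>)
  have "from_q X = from_q R"
  proof (intro ext)
    fix \<tau>
    show "from_q X \<tau> = from_q R \<tau>"
    proof (cases "\<tau> \<in> upper_half_plane")
      case True
      from const[OF this] C0 show ?thesis by (simp add: C_def)
    qed (simp add: from_q_def)
  qed
  then have "from_q X \<in> eisenstein_subspace l k"
    unfolding Rq by (auto intro!: cfun.subspace_add eisenstein_subspace_subspace fW)
  then show ?thesis by (simp add: Xq m_def)
qed

section \<open>Manin symbols\<close>

definition index_set :: "nat \<Rightarrow> nat \<Rightarrow> symbol set" where
  "index_set l k = {(r, s, u, v). r + s = k - 2 \<and> (u, v) \<in> unimodular_pairs l}"

lemma finite_index_set: "finite (index_set l k)"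
  by (rule finite_subset[of _ "{..k - 2} \<times> {..k - 2} \<times> {0..<int l} \<times> {0..<int l}"])
     (auto simp: index_set_def unimodular_pairs_def)

definition symbol_image :: "nat \<Rightarrow> symbol \<Rightarrow> complex \<Rightarrow> complex" where
  "symbol_image l = (\<lambda>(r, s, u, v). cscale ((-1) ^ s) (stilde l (s + 1) u * stilde l (r + 1) v))"

text \<open>A finite sum that makes sense for every function on symbols, so linearity holds without
  conditions on the support.\<close>

definition free_map :: "nat \<Rightarrow> nat \<Rightarrow> (symbol \<Rightarrow> complex) \<Rightarrow> complex \<Rightarrow> complex" where
  "free_map l k h = (\<Sum>t\<in>index_set l k. cscale (h t) (symbol_image l t))"

lemma free_map_add: "free_map l k (g + h) = free_map l k g + free_map l k h"
  by (simp add: free_map_def cfun.scale_left_distrib sum.distrib)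

lemma free_map_scale: "free_map l k (cscale c h) = cscale c (free_map l k h)"
  by (simp add: free_map_def cfun.scale_sum_right) (simp add: cscale_def)

lemma free_map_0: "free_map l k 0 = 0"
  by (simp add: free_map_def)

lemma free_map_sum: "free_map l k (\<Sum>i\<in>I. f i) = (\<Sum>i\<in>I. free_map l k (f i))"
proof (induction I rule: infinite_finite_induct)
  case (insert i I)
  show ?case unfolding sum.insert[OF insert(1,2)] free_map_add insert(3) ..
next
  case (infinite I)
  show ?case unfolding sum.infinite[OF infinite] by (rule free_map_0)
qed (simp only: sum.empty free_map_0)

lemma free_map_generator:
  assumes "t \<in> index_set l k"
  shows "free_map l k (manin_generator t) = symbol_image l t"
proof -
  have "free_map l k (manin_generator t) = (\<Sum>t'\<in>index_set l k. if t' = t then symbol_image l t else 0)"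
    unfolding free_map_def by (rule sum.cong) (auto simp: manin_generator_def cscale_def)
  then show ?thesis using assms finite_index_set[of l k] by simp
qed

text \<open>By \<open>comb\<close> the combinations of a and b include those of u and v, which
  already represent every residue.\<close>

lemma unimodular_pairs_mod:
  assumes l: "l > 0" and uv: "(u, v) \<in> unimodular_pairs l"
      and comb: "\<And>m n. \<exists>m' n'. m * u + n * v = m' * a + n' * b"
  shows "(a mod int l, b mod int l) \<in> unimodular_pairs l"
  unfolding unimodular_pairs_def
proof (simp only: mem_Collect_eq prod.case, intro conjI allI)
  show "a mod int l \<in> {0..<int l}" "b mod int l \<in> {0..<int l}" using l by simp_all
  fix w
  obtain m n where mn: "[m * u + n * v = w] (mod int l)"
    using uv unfolding unimodular_pairs_def by blast
  obtain m' n' where "m * u + n * v = m' * a + n' * b" using comb by blast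
  moreover have "[m' * (a mod int l) + n' * (b mod int l) = m' * a + n' * b] (mod int l)"
    by (intro cong_add cong_mult cong_refl) simp_all
  ultimately show "\<exists>m n. [m * (a mod int l) + n * (b mod int l) = w] (mod int l)"
    using mn by (metis cong_trans)
qed

section \<open>Polynomials of symbols as functions of two frequencies\<close>

definition hom_sum :: "nat \<Rightarrow> complex poly poly \<Rightarrow> complex \<Rightarrow> complex \<Rightarrow> complex" where
  "hom_sum m P x y = (\<Sum>s\<le>m. coeff (coeff P s) (m - s) * x ^ (m - s) * y ^ s)"

lemma hom_sum_add: "hom_sum m (P + Q) x y = hom_sum m P x y + hom_sum m Q x y"
  by (simp add: hom_sum_def distrib_right sum.distrib)

lemma hom_sum_sum: "hom_sum m (\<Sum>i\<in>I. f i) x y = (\<Sum>i\<in>I. hom_sum m (f i) x y)"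
  by (induction I rule: infinite_finite_induct) (auto simp: hom_sum_add hom_sum_def[of m 0])

lemma polyX_polyY_power: "polyX ^ r * polyY ^ s = monom (monom 1 r) s"
proof -
  have "polyX ^ r = [:monom 1 r:]"
    by (induction r) (simp_all add: monom_0 monom_Suc mult.commute flip: one_pCons)
  moreover have "polyY ^ s = (monom 1 s :: complex poly poly)"
    by (simp add: monom_altdef)
  ultimately show ?thesis by (simp add: smult_monom)
qed

text \<open>The integer factor is there for the binomial expansions of the two rotated
  polynomials.\<close>

lemma hom_sum_monomial:
  assumes "r + s = m"
  shows "hom_sum m (of_int c * (polyX ^ r * polyY ^ s)) x y = of_int c * (x ^ r * y ^ s)"
proof -
  have "hom_sum m (of_int c * (polyX ^ r * polyY ^ s)) x y = (\<Sum>s'\<le>m. if s' = s then of_int c * (x ^ r * y ^ s) else 0)"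
    unfolding hom_sum_def polyX_polyY_power
  proof (rule sum.cong)
    fix s' assume "s' \<in> {..m}"
    have "of_int c * monom (monom 1 r) s = (monom (monom (of_int c) r) s :: complex poly poly)"
      by (simp add: of_int_poly smult_monom)
    then show "coeff (coeff (of_int c * monom (monom 1 r) s) s') (m - s') * x ^ (m - s') * y ^ s'
       = (if s' = s then of_int c * (x ^ r * y ^ s) else 0)"
      using assms by auto
  qed simp
  then show ?thesis using assms by simp
qed

lemma power_times_power_diff:
  fixes a b :: "'a :: comm_ring_1"
  shows "b ^ r * (a - b) ^ s = (\<Sum>i\<le>s. of_int (int (s choose i) * (- 1) ^ (s - i)) * (a ^ i * b ^ (s - i + r)))"
proof -
  have "b ^ r * (a - b) ^ s = (\<Sum>i\<le>s. b ^ r * (of_nat (s choose i) * a ^ i * (- b) ^ (s - i)))"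
    using binomial_ring[of a "- b" s] by (simp add: sum_distrib_left)
  also have "\<dots> = (\<Sum>i\<le>s. of_int (int (s choose i) * (- 1) ^ (s - i)) * (a ^ i * b ^ (s - i + r)))"
  proof (rule sum.cong)
    fix i
    have "(- b) ^ (s - i) = (- 1) ^ (s - i) * b ^ (s - i)" by (rule power_minus)
    then show "b ^ r * (of_nat (s choose i) * a ^ i * (- b) ^ (s - i))
      = of_int (int (s choose i) * (- 1) ^ (s - i)) * (a ^ i * b ^ (s - i + r))"
      by (simp add: power_add mult_ac)
  qed simp
  finally show ?thesis .
qed

lemma hom_sum_polyY_power:
  assumes "r + s = m"
  shows "hom_sum m (polyY ^ r * (polyX - polyY) ^ s) x y = y ^ r * (x - y) ^ s"
  unfolding power_times_power_diff hom_sum_sum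
  by (rule sum.cong[OF refl], rule hom_sum_monomial) (use assms in auto)

lemma hom_sum_polyX_power:
  assumes "r + s = m"
  shows "hom_sum m ((polyY - polyX) ^ r * polyX ^ s) x y = (y - x) ^ r * x ^ s"
proof -
  have "(polyY - polyX) ^ r * polyX ^ s
      = (\<Sum>i\<le>r. of_int (int (r choose i) * (- 1) ^ (r - i)) * (polyX ^ (r - i + s) * polyY ^ i))"
    unfolding mult.commute[of _ "polyX ^ s"] power_times_power_diff by (rule sum.cong) (simp_all only: mult.commute)
  moreover have "(y - x) ^ r * x ^ s
      = (\<Sum>i\<le>r. of_int (int (r choose i) * (- 1) ^ (r - i)) * (x ^ (r - i + s) * y ^ i))"
    unfolding mult.commute[of _ "x ^ s"] power_times_power_diff by (rule sum.cong) (simp_all only: mult.commute)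
  moreover have "hom_sum m (of_int (int (r choose i) * (- 1) ^ (r - i)) * (polyX ^ (r - i + s) * polyY ^ i)) x y
      = of_int (int (r choose i) * (- 1) ^ (r - i)) * (x ^ (r - i + s) * y ^ i)" if "i \<le> r" for i
    by (rule hom_sum_monomial) (use assms that in auto)
  ultimately show ?thesis by (simp only: hom_sum_sum) (rule sum.cong; simp)
qed

text \<open>The exponent of y belongs to the first factor and carries the sign (-1)^s, which amounts
  to the substitution P(y, -x). The scalar c takes up the sign in front of a symbol in a
  relation.\<close>

definition symbol_coeffs :: "nat \<Rightarrow> complex \<Rightarrow> complex poly poly \<Rightarrow> nat \<Rightarrow> complex" where
  "symbol_coeffs m c P s = c * ((-1) ^ s * coeff (coeff P s) (m - s))"

lemma hom_eval_symbol_coeffs: "hom_eval m (symbol_coeffs m c P) x y = c * hom_sum m P y (- x)"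
  unfolding hom_eval_def hom_sum_def symbol_coeffs_def sum_distrib_left
  by (rule sum.cong) (simp_all add: power_minus[of x] mult_ac)

lemma free_map_manin_symbol:
  assumes l: "l > 0" and uv: "(u mod int l, v mod int l) \<in> unimodular_pairs l"
  shows "free_map l k (cscale c (manin_symbol l k P u v)) = from_q (stilde_product l (k - 2) (symbol_coeffs (k - 2) c P) u v)"
proof -
  define m where "m = k - 2"
  have sc: "stilde l (Suc i) (a mod int l) = stilde l (Suc i) a" for i a
    by (rule stilde_cong[OF l]) (simp_all add: cong_def)
  have "free_map l k (manin_symbol l k P u v)
     = (\<Sum>r\<le>m. cscale (coeff (coeff P (m - r)) r) (symbol_image l (r, m - r, u mod int l, v mod int l)))"
    unfolding manin_symbol_def free_map_sum free_map_scale m_def[symmetric]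
    by (rule sum.cong[OF refl]) (subst free_map_generator, use uv in \<open>auto simp: index_set_def m_def\<close>)
  also have "\<dots> = (\<Sum>s\<le>m. cscale (coeff (coeff P s) (m - s)) (symbol_image l (m - s, s, u mod int l, v mod int l)))"
    by (rule sum.reindex_bij_witness[of _ "\<lambda>s. m - s" "\<lambda>s. m - s"]) auto
  finally have "free_map l k (cscale c (manin_symbol l k P u v))
     = (\<Sum>s\<le>m. cscale c (cscale (coeff (coeff P s) (m - s)) (symbol_image l (m - s, s, u mod int l, v mod int l))))"
    by (simp add: free_map_scale cfun.scale_sum_right)
  also have "\<dots> = from_q (stilde_product l m (symbol_coeffs m c P) u v)"
    unfolding from_q_stilde_product[OF l]
    by (rule sum.cong) (simp_all add: symbol_image_def symbol_coeffs_def sc mult_ac)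
  finally show ?thesis by (simp only: m_def)
qed

lemma manin_symbol_monomial:
  assumes "r + s = k - 2"
  shows "manin_symbol l k (polyX ^ r * polyY ^ s) u v = manin_generator (r, s, u mod int l, v mod int l)"
proof -
  have "manin_symbol l k (polyX ^ r * polyY ^ s) u v
     = (\<Sum>r'\<le>k - 2. if r' = r then manin_generator (r, s, u mod int l, v mod int l) else 0)"
    unfolding manin_symbol_def polyX_polyY_power
    by (rule sum.cong) (use assms in auto)
  then show ?thesis using assms by simp
qed

lemma unimodular_pairs_rotate:
  assumes l: "l > 0" and uv: "(u, v) \<in> unimodular_pairs l"
  shows "(v mod int l, (- u) mod int l) \<in> unimodular_pairs l"
    and "(v mod int l, (- u - v) mod int l) \<in> unimodular_pairs l"
    and "((- u - v) mod int l, u mod int l) \<in> unimodular_pairs l"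
proof -
  have "m * u + n * v = n * v + (- m) * (- u)" "m * u + n * v = (n - m) * v + (- m) * (- u - v)"
    "m * u + n * v = (- n) * (- u - v) + (m - n) * u" for m n
    by (simp_all add: algebra_simps)
  then show "(v mod int l, (- u) mod int l) \<in> unimodular_pairs l"
    "(v mod int l, (- u - v) mod int l) \<in> unimodular_pairs l"
    "((- u - v) mod int l, u mod int l) \<in> unimodular_pairs l"
    using l uv by (blast intro: unimodular_pairs_mod)+
qed

lemma unimodular_pairs_reduced:
  "(u, v) \<in> unimodular_pairs l \<Longrightarrow> u mod int l = u \<and> v mod int l = v"
  by (auto simp: unimodular_pairs_def)

lemma free_map_relation:
  assumes l: "l > 0" and k: "k \<ge> 3" and h: "h \<in> manin_relations l k"
  shows "free_map l k h \<in> eisenstein_subspace l k"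
proof -
  consider (two) r s u v where "r + s = k - 2" "(u, v) \<in> unimodular_pairs l"
      "h = manin_symbol l k (polyX ^ r * polyY ^ s) u v + cscale ((-1) ^ r) (manin_symbol l k (polyX ^ s * polyY ^ r) v (- u))"
    | (three) r s u v where "r + s = k - 2" "(u, v) \<in> unimodular_pairs l"
      "h = manin_symbol l k (polyX ^ r * polyY ^ s) u v
      + cscale ((-1) ^ r) (manin_symbol l k (polyY ^ r * (polyX - polyY) ^ s) v (- u - v))
      + cscale ((-1) ^ s) (manin_symbol l k ((polyY - polyX) ^ r * polyX ^ s) (- u - v) u)"
    using h unfolding manin_relations_def by blast
  then show ?thesis
  proof cases
    case two
    have uv: "(u mod int l, v mod int l) \<in> unimodular_pairs l"
      using two(2) unimodular_pairs_reduced[OF two(2)] by simp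
    have sc: "stilde l (Suc i) (a mod int l) = stilde l (Suc i) a" for i a
      by (rule stilde_cong[OF l]) (simp_all add: cong_def)
    have "free_map l k h = symbol_image l (r, s, u mod int l, v mod int l)
        + cscale ((-1) ^ r) (symbol_image l (s, r, v mod int l, (- u) mod int l))"
      using two(1) uv unimodular_pairs_rotate(1)[OF l two(2)]
      by (simp add: two(3) free_map_add free_map_scale manin_symbol_monomial free_map_generator index_set_def add.commute)
    \<comment> \<open>Replacing - u by u costs (-1)^(s + 1), opposite to the sign (-1)^s of the
      first symbol; the two factors (-1)^r cancel each other.\<close>
    also have "\<dots> = 0"
      by (simp add: symbol_image_def sc stilde_minus[OF l] cscale_def fun_eq_iff flip: power_add mult_2)
    finally show ?thesis
      by (simp add: cfun.subspace_0 eisenstein_subspace_subspace)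
  next
    case three
    define m where "m = k - 2"
    define w where "w = - u - v"
    have rs: "r + s = m" using three(1) by (simp add: m_def)
    have uv: "(u mod int l, v mod int l) \<in> unimodular_pairs l"
      using three(2) unimodular_pairs_reduced[OF three(2)] by simp
    define \<alpha> where "\<alpha> = symbol_coeffs m 1 (polyX ^ r * polyY ^ s)"
    define \<beta> where "\<beta> = symbol_coeffs m ((-1) ^ r) (polyY ^ r * (polyX - polyY) ^ s)"
    define \<gamma> where "\<gamma> = symbol_coeffs m ((-1) ^ s) ((polyY - polyX) ^ r * polyX ^ s)"
    \<comment> \<open>Here and for \<open>\<beta>\<close> and \<open>\<gamma>\<close>: the signs and
      arguments of the relation are such that all three forms take the value (- x)^s y^r on the
      triple (x, y, - x - y).\<close>
    have \<alpha>: "hom_eval m \<alpha> x y = (- x) ^ s * y ^ r" for x y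
      using hom_sum_monomial[OF rs, of 1 y "- x"] by (simp add: \<alpha>_def hom_eval_symbol_coeffs mult.commute)
    have "hom_eval m \<beta> y (- x - y) = (-1) ^ r * ((- y) ^ r * (- x - y - - y) ^ s)" for x y
      unfolding \<beta>_def hom_eval_symbol_coeffs hom_sum_polyY_power[OF rs] ..
    also have "\<dots> x y = (- x) ^ s * y ^ r" for x y :: complex
      by (simp add: mult_ac flip: power_mult_distrib)
    finally have \<beta>: "hom_eval m \<beta> y (- x - y) = (- x) ^ s * y ^ r" for x y .
    have "hom_eval m \<gamma> (- x - y) x = (-1) ^ s * ((- (- x - y) - x) ^ r * x ^ s)" for x y
      unfolding \<gamma>_def hom_eval_symbol_coeffs hom_sum_polyX_power[OF rs] ..
    also have "\<dots> x y = (- x) ^ s * y ^ r" for x y :: complex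
      by (simp add: mult_ac flip: power_mult_distrib)
    finally have \<gamma>: "hom_eval m \<gamma> (- x - y) x = (- x) ^ s * y ^ r" for x y .
    have "free_map l k h = from_q (stilde_product l m \<alpha> u v) + from_q (stilde_product l m \<beta> v w) + from_q (stilde_product l m \<gamma> w u)"
      using free_map_manin_symbol[OF l uv, of k 1]
      by (simp add: three(3) free_map_add free_map_manin_symbol[OF l] unimodular_pairs_rotate[OF l three(2)]
          \<alpha>_def \<beta>_def \<gamma>_def m_def w_def del: cfun.scale_scale)
    also have "\<dots> \<in> eisenstein_subspace l k"
      unfolding m_def
      by (rule three_term_relation[OF l k]) (simp_all add: w_def \<alpha>[unfolded m_def] \<beta>[unfolded m_def] \<gamma>[unfolded m_def])
    finally show ?thesis .
  qed
qed

lemma free_map_relations_span: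
  assumes l: "l > 0" and k: "k \<ge> 3" and h: "h \<in> cfun.span (manin_relations l k)"
  shows "free_map l k h \<in> eisenstein_subspace l k"
  using h
proof (induction rule: cfun.span_induct_alt)
  case base
  show ?case unfolding free_map_0 by (rule cfun.subspace_0[OF eisenstein_subspace_subspace])
next
  case (step c x y)
  then show ?case
    unfolding free_map_add free_map_scale
    by (rule cfun.subspace_add[OF eisenstein_subspace_subspace
          cfun.subspace_scale[OF eisenstein_subspace_subspace free_map_relation[OF l k]]])
qed

lemma quasimodular_forms_subspace: "cfun.subspace (quasimodular_forms l k)"
proof (rule cfun.subspaceI)
  have "(0 :: complex \<Rightarrow> complex) \<in> modular_forms l k"
  proof -
    have "slash k 0 \<gamma> \<tau> = 0" for \<gamma> \<tau> by (cases \<gamma>) simp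
    then show ?thesis by (auto simp: modular_forms_def zero_fun_def)
  qed
  then show "0 \<in> quasimodular_forms l k"
    by (simp add: quasimodular_forms_def quasimodular.modular)
qed (auto simp: quasimodular_forms_def quasimodular.add quasimodular_cscale)

lemma free_map_quasimodular:
  assumes l: "l > 0" and k: "k \<ge> 3"
  shows "free_map l k h \<in> quasimodular_forms l k"
  unfolding free_map_def
proof (rule cfun.subspace_sum[OF quasimodular_forms_subspace])
  fix t assume "t \<in> index_set l k"
  then obtain r s u v where t: "t = (r, s, u, v)" "r + s = k - 2" by (auto simp: index_set_def)
  then have k': "k = (s + 1) + (r + 1)" using k by simp
  have "quasimodular l ((s + 1) + (r + 1)) (stilde l (s + 1) u * stilde l (r + 1) v)"
    by (intro quasimodular.mult quasimodular_stilde l) simp_all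
  then show "cscale (h t) (symbol_image l t) \<in> quasimodular_forms l k"
    using k' by (simp add: quasimodular_forms_def symbol_image_def t quasimodular_cscale)
qed

section \<open>Passage to the quotient spaces\<close>

lemma coset_eq_iff:
  assumes W: "cfun.subspace W"
  shows "f +o W = g +o W \<longleftrightarrow> f - g \<in> W"
proof
  assume eq: "f +o W = g +o W"
  have "f \<in> f +o W"
    using cfun.subspace_0[OF W] by (force simp: elt_set_plus_def)
  then obtain x where "x \<in> W" "f = g + x" unfolding eq by (auto simp: elt_set_plus_def)
  then show "f - g \<in> W" by simp
next
  assume fg: "f - g \<in> W"
  have sub: "a +o W \<subseteq> b +o W" if "a - b \<in> W" for a b
  proof
    fix x assume "x \<in> a +o W"
    then obtain y where "y \<in> W" "x = a + y" by (auto simp: elt_set_plus_def)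
    then have "x = b + ((a - b) + y)" "(a - b) + y \<in> W"
      using that W by (simp_all add: cfun.subspace_add)
    then show "x \<in> b +o W" unfolding elt_set_plus_def by blast
  qed
  have "g - f \<in> W" using cfun.subspace_neg[OF W fg] by simp
  then show "f +o W = g +o W" using sub fg by blast
qed

theorem corollary6p3:
  fixes l k :: nat
  assumes "l \<ge> 1" and "k > 2"
  shows "\<exists>!\<mu>. \<mu> \<in> linear_maps (manin_space l k) (quasimodular_quotient l k) \<and>
           (\<forall>r s u v. r + s = k - 2 \<and> (u, v) \<in> unimodular_pairs l \<longrightarrow>
              \<mu> (manin_class l k r s u v) =
                cscale ((-1) ^ s) (stilde l (s + 1) u * stilde l (r + 1) v)
                  +o eisenstein_subspace l k)"
proof -
  have l: "l > 0" and k: "k \<ge> 3" using assms by auto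
  define V where "V = manin_free_space l k"
  define R where "R = cfun.span (manin_relations l k)"
  define W where "W = eisenstein_subspace l k"
  define Q where "Q = quasimodular_forms l k"
  have M: "manin_space l k = quotient_space V R" by (simp add: manin_space_def V_def R_def)
  have N: "quasimodular_quotient l k = quotient_space Q W" by (simp add: quasimodular_quotient_def Q_def W_def)
  have Vs: "cfun.subspace V" unfolding V_def manin_free_space_def by (rule cfun.subspace_span)
  have Rs: "cfun.subspace R" unfolding R_def by (rule cfun.subspace_span)
  have Ws: "cfun.subspace W" unfolding W_def by (rule eisenstein_subspace_subspace)
  define \<phi> where "\<phi> = free_map l k"
  have \<phi>_add: "\<phi> (g + h) = \<phi> g + \<phi> h" and \<phi>_scale: "\<phi> (cscale c h) = cscale c (\<phi> h)" for g h c
    by (simp_all add: \<phi>_def free_map_add free_map_scale)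
  have \<phi>_R: "\<phi> h \<in> W" if "h \<in> R" for h
    using free_map_relations_span[OF l k] that by (simp add: \<phi>_def R_def W_def)
  have \<phi>_Q: "\<phi> h \<in> Q" for h
    using free_map_quasimodular[OF l k] by (simp add: \<phi>_def Q_def)
  have wd: "\<phi> g +o W = \<phi> h +o W" if "g +o R = h +o R" for g h
  proof -
    have "g = h + (g - h)" by simp
    then have "\<phi> g = \<phi> h + \<phi> (g - h)" using \<phi>_add by metis
    moreover have "\<phi> (g - h) \<in> W"
      using that by (intro \<phi>_R) (simp add: coset_eq_iff[OF Rs])
    ultimately show ?thesis by (simp add: coset_eq_iff[OF Ws])
  qed
  \<comment> \<open>The choice of a representative is harmless by \<open>wd\<close>; the restricted
    abstraction supplies \<open>undefined\<close> off the carrier, as \<open>linear_maps\<close>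
    demands.\<close>
  define \<mu> where "\<mu> = (\<lambda>X\<in>carrier (manin_space l k). \<phi> (SOME h. h \<in> V \<and> X = h +o R) +o W)"
  have \<mu>: "\<mu> (h +o R) = \<phi> h +o W" if "h \<in> V" for h
  proof -
    have "\<exists>g. g \<in> V \<and> h +o R = g +o R" using that by blast
    then have "h +o R = (SOME g. g \<in> V \<and> h +o R = g +o R) +o R" by (metis (mono_tags, lifting) someI_ex)
    from wd[OF this] that show ?thesis by (auto simp: \<mu>_def M quotient_space_carrier)
  qed
  have gen_V: "manin_generator (r, s, u, v) \<in> V" if "r + s = k - 2" "(u, v) \<in> unimodular_pairs l" for r s u v
    unfolding V_def manin_free_space_def using that by (intro cfun.span_base) blast
  have class_eq: "manin_class l k r s u v = manin_generator (r, s, u, v) +o R" for r s u v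
    by (simp add: manin_class_def R_def)
  have add: "(g +o R) \<oplus>\<^bsub>manin_space l k\<^esub> (h +o R) = (g + h) +o R" for g h
    unfolding M by (rule quotient_space_add[OF Rs])
  have scale: "c \<odot>\<^bsub>manin_space l k\<^esub> (h +o R) = cscale c h +o R" for c h
    unfolding M by (rule quotient_space_smult[OF Rs])
  have \<mu>_lin: "\<mu> \<in> linear_maps (manin_space l k) (quasimodular_quotient l k)"
    unfolding linear_maps_def mem_Collect_eq
  proof (intro conjI ballI allI)
    show "\<mu> \<in> carrier (manin_space l k) \<rightarrow>\<^sub>E carrier (quasimodular_quotient l k)"
    proof (rule PiE_I)
      fix X assume "X \<in> carrier (manin_space l k)"
      then obtain h where "h \<in> V" "X = h +o R" by (auto simp: M quotient_space_carrier)
      then show "\<mu> X \<in> carrier (quasimodular_quotient l k)"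
        using \<phi>_Q by (auto simp: \<mu> N quotient_space_carrier)
    qed (simp add: \<mu>_def)
  next
    fix X Y assume "X \<in> carrier (manin_space l k)" "Y \<in> carrier (manin_space l k)"
    then obtain g h where gh: "g \<in> V" "X = g +o R" "h \<in> V" "Y = h +o R" by (auto simp: M quotient_space_carrier)
    then show "\<mu> (X \<oplus>\<^bsub>manin_space l k\<^esub> Y) = \<mu> X \<oplus>\<^bsub>quasimodular_quotient l k\<^esub> \<mu> Y"
      using Vs by (simp add: add \<mu> N quotient_space_add[OF Ws] \<phi>_add cfun.subspace_add)
  next
    fix c X assume "X \<in> carrier (manin_space l k)"
    then obtain h where h: "h \<in> V" "X = h +o R" by (auto simp: M quotient_space_carrier)
    then show "\<mu> (c \<odot>\<^bsub>manin_space l k\<^esub> X) = c \<odot>\<^bsub>quasimodular_quotient l k\<^esub> \<mu> X"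
      using Vs by (simp add: scale \<mu> N quotient_space_smult[OF Ws] \<phi>_scale cfun.subspace_scale)
  qed
  have \<mu>_gen: "\<mu> (manin_class l k r s u v) = cscale ((-1) ^ s) (stilde l (s + 1) u * stilde l (r + 1) v) +o W"
    if "r + s = k - 2" "(u, v) \<in> unimodular_pairs l" for r s u v
    using that by (simp add: class_eq \<mu> gen_V \<phi>_def free_map_generator index_set_def symbol_image_def)
  show ?thesis
    unfolding W_def[symmetric]
  proof (rule ex1I[of _ \<mu>])
    show "\<mu> \<in> linear_maps (manin_space l k) (quasimodular_quotient l k) \<and>
      (\<forall>r s u v. r + s = k - 2 \<and> (u, v) \<in> unimodular_pairs l \<longrightarrow>
        \<mu> (manin_class l k r s u v) = cscale ((-1) ^ s) (stilde l (s + 1) u * stilde l (r + 1) v) +o W)"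
      using \<mu>_lin \<mu>_gen by blast
  next
    fix \<nu> assume \<nu>: "\<nu> \<in> linear_maps (manin_space l k) (quasimodular_quotient l k) \<and>
      (\<forall>r s u v. r + s = k - 2 \<and> (u, v) \<in> unimodular_pairs l \<longrightarrow>
        \<nu> (manin_class l k r s u v) = cscale ((-1) ^ s) (stilde l (s + 1) u * stilde l (r + 1) v) +o W)"
    have lin: "\<eta> ((cscale c g + h) +o R) = (c \<odot>\<^bsub>quasimodular_quotient l k\<^esub> \<eta> (g +o R)) \<oplus>\<^bsub>quasimodular_quotient l k\<^esub> \<eta> (h +o R)"
      if "\<eta> \<in> linear_maps (manin_space l k) (quasimodular_quotient l k)" "g \<in> V" "h \<in> V" for \<eta> c g h
    proof -
      have "cscale c g +o R \<in> carrier (manin_space l k)" "g +o R \<in> carrier (manin_space l k)" "h +o R \<in> carrier (manin_space l k)"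
        using that Vs by (auto simp: M quotient_space_carrier cfun.subspace_scale)
      then show ?thesis
        using that(1) unfolding linear_maps_def by (simp flip: add scale)
    qed
    \<comment> \<open>\<open>linear_maps\<close> asks only for additivity and homogeneity, so the
      value at the zero class is obtained by scaling with 0.\<close>
    have zero: "\<eta> (0 +o R) = W" if \<eta>: "\<eta> \<in> linear_maps (manin_space l k) (quasimodular_quotient l k)" for \<eta>
    proof -
      have 0: "0 +o R \<in> carrier (manin_space l k)"
        unfolding M quotient_space_carrier by (rule imageI[OF cfun.subspace_0[OF Vs]])
      then have "\<eta> (0 +o R) \<in> carrier (quasimodular_quotient l k)"
        using \<eta> unfolding linear_maps_def by blast
      then obtain f where f: "\<eta> (0 +o R) = f +o W" by (auto simp: N quotient_space_carrier)
      have "\<eta> (0 \<odot>\<^bsub>manin_space l k\<^esub> (0 +o R)) = 0 \<odot>\<^bsub>quasimodular_quotient l k\<^esub> \<eta> (0 +o R)"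
        using \<eta> 0 unfolding linear_maps_def by blast
      moreover have "0 \<odot>\<^bsub>manin_space l k\<^esub> (0 +o R) = 0 +o R"
        unfolding scale cfun.scale_zero_left ..
      ultimately have "\<eta> (0 +o R) = 0 \<odot>\<^bsub>quasimodular_quotient l k\<^esub> (f +o W)"
        by (simp only: f)
      then show ?thesis unfolding N quotient_space_smult[OF Ws] cfun.scale_zero_left by simp
    qed
    \<comment> \<open>Membership in V is carried through the induction because \<open>lin\<close>
      requires it of the partial sums.\<close>
    have agree: "h \<in> V \<and> \<nu> (h +o R) = \<mu> (h +o R)" if "h \<in> V" for h
      using that[unfolded V_def manin_free_space_def]
    proof (induction rule: cfun.span_induct_alt)
      case base
      then show ?case using \<nu> \<mu>_lin zero cfun.subspace_0[OF Vs] by metis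
    next
      case (step c g h)
      then obtain r s u v where g: "g = manin_generator (r, s, u, v)" "r + s = k - 2" "(u, v) \<in> unimodular_pairs l"
        by blast
      then have gV: "g \<in> V" by (simp add: gen_V)
      have "\<nu> (g +o R) = \<mu> (g +o R)"
        using \<nu> \<mu>_gen g by (simp flip: class_eq)
      moreover have "h \<in> V" "\<nu> (h +o R) = \<mu> (h +o R)" using step by auto
      ultimately have "\<nu> ((cscale c g + h) +o R) = \<mu> ((cscale c g + h) +o R)"
        using \<nu> \<mu>_lin gV by (simp only: lin)
      moreover have "cscale c g + h \<in> V"
        by (rule cfun.subspace_add[OF Vs cfun.subspace_scale[OF Vs gV] \<open>h \<in> V\<close>])
      ultimately show ?case by (intro conjI)
    qed
    show "\<nu> = \<mu>"
    proof (rule extensionalityI[of _ "carrier (manin_space l k)"])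
      show "\<nu> \<in> extensional (carrier (manin_space l k))" "\<mu> \<in> extensional (carrier (manin_space l k))"
        using \<nu> \<mu>_lin by (auto simp: linear_maps_def PiE_def)
      fix X assume "X \<in> carrier (manin_space l k)"
      then show "\<nu> X = \<mu> X" using agree by (auto simp: M quotient_space_carrier)
    qed
  qed
qed

end
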